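(* For any $\alpha,\beta,r,r',\sigma>0$ there exists a constant $C_{\alpha\beta r r'\sigma}$, depending only on these parameters, such that the following holds for all $n\ge C_{\alpha\beta r r'\sigma}$. Let $\pi$ be a permutation of $[n]$, let $F\in[0,1]^{n\times n}$ be a Robinson matrix with $F\in\mathcal{AL}(\alpha,\beta,r,r')$, and let $A=F_\pi+\sigma E$ be the observation. Let $\hat\pi$ be the output of SABRE$(A,\sigma,\delta_1,\delta_2,\delta_3,\delta_4)$ with $\delta_1=n^{3/4}\log n$ and $\delta_{k+1}=\delta_k\log n$ for $k\in\{1,2,3\}$. Then, with probability at least $1-1/n^2$, $$L_K(\hat\pi,\pi)\ \le\ 40\,\frac{\sigma}{\alpha}\sqrt{n\log n}.$$
   Context: **Notation.** $[n]=\{1,\dots,n\}$, $a\vee b=\max(a,b)$, $a\wedge b=\min(a,b)$, $M_i$ is the $i$-th row of a matrix $M$, $\|\cdot\|$ is the Euclidean norm, $\langle\cdot,\cdot\rangle$ the Euclidean inner product, $|G|$ the cardinality of $G$, $\mathbf 1_n$ the all-ones vector. **Model.** A symmetric matrix $F$ is Robinson if $F_{jk}<F_{ik}$ for all $k\le i<j$ and $F_{ik}<F_{jk}$ for all $i<j\le k$. $(F_\pi)_{ij}=F_{\pi_i\pi_j}$. $E$ is a symmetric $n\times n$ random matrix whose entries $E_{ij}$, $i\le j$, are independent, centered and sub-Gaussian with $\mathbb E[e^{sE_{ij}}]\le e^{s^2/2}$ for all $s\in\mathbb R$. **Kendall's tau loss.** $K(\hat\pi,\pi)=\frac1n\sum_{1\le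 i<j\le n}\mathbf 1_{\{\mathrm{sign}(\pi_i-\pi_j)\,\mathrm{sign}(\hat\pi_i-\hat\pi_j)<0\}}$ and, with $\pi^{\mathrm{rev}}_i=n+1-\pi_i$, $L_K(\hat\pi,\pi)=K(\hat\pi,\pi)\wedge K(\hat\pi,\pi^{\mathrm{rev}})$. **Average-Lipschitz class.** Let $c_0=1/32$. $F\in[0,1]^{n\times n}$ is in $\mathcal{AL}(\alpha,\beta,r,r')$ if (i) for all $i<j$ with $j-i\le rn$: $\|F_i-F_j\|\le\beta|i-j|/\sqrt n$ and $\big(\sum_{k<i-c_0n}(F_{ik}-F_{jk})\big)\vee\big(\sum_{k>j+c_0n}(F_{jk}-F_{ik})\big)\ge\alpha|i-j|$; and (ii) if $|i-j|>rn$ then $\|F_i-F_j\|>r'\sqrt n$. **Algorithm SABRE$(A,\sigma,\delta_1,\dots,\delta_4)$** (ties in argmin/argmax/largest are broken arbitrarily). *EstimateDistance$(A,S)$*, $S\subset[n]$: let $A^S_{ij}=A_{ij}$ if $i,j\in S$ and $0$ otherwise. For $i\in S$ let $\widehat m_i\in\arg\min_{j\in S,j\ne i}\max_{k\in S\setminus\{i,j\}}|\langle A^S_k,A^S_i-A^S_j\rangle|$. For $i\neq j$ in $S$ let $\widehat D_{ij}=\widehat D_{ji}\ge0$ be given by $\widehat D_{ij}^2=n\big(\langle A^S_i,A^S_{\widehat m_i}\rangle+\langle A^S_j,A^S_{\widehat m_j}\rangle-2\langle A^S_i,A^S_j\rangle\big)$ (with the right side replaced by $0$ if negative); all other entries are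 $0$. Return $\widehat D$. *Stage 1.* $D=$ EstimateDistance$(A,[n])$. *Stage 2 (first seriation).* For each $i$, let $\mathcal G_i$ be the graph on $[n]\setminus\{i\}$ with an edge between $k,l$ whenever $D_{kl}\le\delta_1$ and $D_{ik}\vee D_{il}\ge\delta_2$. Among connected components of $\mathcal G_i$ containing some $k$ with $D_{ik}\ge\delta_3$, let $G_i,G_i'$ be the largest and second largest ($\emptyset$ if nonexistent). Orientation: pick $c\in\arg\max_i(|G_i|\wedge|G_i'|)$, set $L_c=G_c$, $R_c=G_c'$. For $i\ne c$ with $G_i'=\emptyset$: if $i\in L_c$ set $(L_i,R_i)=(\emptyset,G_i)$, else $(L_i,R_i)=(G_i,\emptyset)$. For $i\neq c$ with $G_i'\ne\emptyset$: if $G_i\cap L_c=\emptyset$ or $G_i'\cap R_c=\emptyset$ set $(L_i,R_i)=(G_i',G_i)$, else $(L_i,R_i)=(G_i,G_i')$. Define $H\in\{-1,0,1\}^{n\times n}$, initially $0$: for $i\ne j$ with $(L_i,R_i)\ne(\emptyset,\emptyset)$, $H_{ij}=-1$ if $i\in L_j$ or $j\in R_i$; else $H_{ij}=1$ if $i\in R_j$ or $j\in L_i$. *Stage 3 (refined seriation).* Draw a uniformly random partition $(S^1,S^2,S^3)$ of $[n]$ (independent of $A$) with $\lfloor n/3\rfloor\le|S^t|\le\lceil n/3\rceil$; let $\widehat D^t=$ EstimateDistance$(A,S^t)$. Initialize $\widetilde H=0$. For each $i<j$ with $H_{ij}=0$: let $L_{ij}=\{k:H_{ik}=H_{jk}=1\}$,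 $R_{ij}=\{k:H_{ik}=H_{jk}=-1\}$; choose $t=t_{ij}$ with $i,j\notin S^t$; let $p_{ij}\in\arg\min_{p\in S^t}D_{ip}$; let $\tilde L_{ij}=\{k\in L_{ij}\cap S^t:\widehat D^t_{p_{ij}k}\ge\delta_4\}$ and $\tilde R_{ij}=\{k\in R_{ij}\cap S^t:\widehat D^t_{p_{ij}k}\ge\delta_4\}$; let $l=\sum_{k\in\tilde L_{ij}}(A_{ik}-A_{jk})$ and $\varrho=\sum_{k\in\tilde R_{ij}}(A_{ik}-A_{jk})$; set $\widetilde H_{ij}=-\mathrm{sign}(l)$ if $|l|\ge5\sigma\sqrt{n\log n}$, else $\widetilde H_{ij}=\mathrm{sign}(\varrho)$ if $|\varrho|\ge5\sigma\sqrt{n\log n}$, else $0$; set $\widetilde H_{ji}=-\widetilde H_{ij}$. Put $\widehat H=H+\widetilde H$. *Output.* $\hat\pi_i=(\widehat H_i\mathbf 1_n+n+1)/2$, $i\in[n]$ (a real vector). *)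

theory Defs
  imports "HOL-Probability.Probability" "HOL-Combinatorics.Permutations"
begin

text \<open>
  An \<open>n \<times> n\<close> matrix is a function \<open>nat \<Rightarrow> nat \<Rightarrow> real\<close> of which only the entries
  with both indices in \<open>{1..n}\<close> are used; a vector of length \<open>n\<close> is treated in the same way.
  The Euclidean norm over \<open>{1..n}\<close> is \<open>L2_set\<close>.
\<close>

definition dot :: "nat \<Rightarrow> (nat \<Rightarrow> real) \<Rightarrow> (nat \<Rightarrow> real) \<Rightarrow> real" where
  "dot n u v = (\<Sum>l\<in>{1..n}. u l * v l)"


section \<open>Model\<close>

definition robinson :: "nat \<Rightarrow> (nat \<Rightarrow> nat \<Rightarrow> real) \<Rightarrow> bool" where
  "robinson n F \<longleftrightarrow>
     (\<forall>i\<in>{1..n}. \<forall>j\<in>{1..n}. F i j = F j i) \<and>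
     (\<forall>i\<in>{1..n}. \<forall>j\<in>{1..n}. \<forall>k\<in>{1..n}.
        (k \<le> i \<and> i < j \<longrightarrow> F j k < F i k) \<and>
        (i < j \<and> j \<le> k \<longrightarrow> F i k < F j k))"

definition avg_lipschitz ::
  "nat \<Rightarrow> real \<Rightarrow> real \<Rightarrow> real \<Rightarrow> real \<Rightarrow> (nat \<Rightarrow> nat \<Rightarrow> real) set" where
  "avg_lipschitz n \<alpha> \<beta> r r' =
    {F. (\<forall>i\<in>{1..n}. \<forall>j\<in>{1..n}. 0 \<le> F i j \<and> F i j \<le> 1) \<and>
        (\<forall>i\<in>{1..n}. \<forall>j\<in>{1..n}. i < j \<and> real j - real i \<le> r * real n \<longrightarrow>
           L2_set (\<lambda>k. F i k - F j k) {1..n} \<le> \<beta> * \<bar>real i - real j\<bar> / sqrt (real n) \<and>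
           max (\<Sum>k | k \<in> {1..n} \<and> real k < real i - (1/32) * real n. F i k - F j k)
               (\<Sum>k | k \<in> {1..n} \<and> real k > real j + (1/32) * real n. F j k - F i k)
             \<ge> \<alpha> * \<bar>real i - real j\<bar>) \<and>
        (\<forall>i\<in>{1..n}. \<forall>j\<in>{1..n}. \<bar>real i - real j\<bar> > r * real n \<longrightarrow>
           L2_set (\<lambda>k. F i k - F j k) {1..n} > r' * sqrt (real n))}"

text \<open>The explicit integrability conditions are needed because the Bochner integral of a
  non-integrable function is \<open>0\<close>.\<close>

definition subgaussian_noise :: "nat \<Rightarrow> 'w measure \<Rightarrow> ('w \<Rightarrow> nat \<Rightarrow> nat \<Rightarrow> real) \<Rightarrow> bool" where
  "subgaussian_noise n M E \<longleftrightarrow>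
     (\<forall>\<omega>\<in>space M. \<forall>i\<in>{1..n}. \<forall>j\<in>{1..n}. E \<omega> i j = E \<omega> j i) \<and>
     prob_space.indep_vars M (\<lambda>_. borel) (\<lambda>(i, j) \<omega>. E \<omega> i j) {(i, j). 1 \<le> i \<and> i \<le> j \<and> j \<le> n} \<and>
     (\<forall>i j. 1 \<le> i \<and> i \<le> j \<and> j \<le> n \<longrightarrow>
        integrable M (\<lambda>\<omega>. E \<omega> i j) \<and> (\<integral>\<omega>. E \<omega> i j \<partial>M) = 0 \<and>
        (\<forall>s. integrable M (\<lambda>\<omega>. exp (s * E \<omega> i j)) \<and>
             (\<integral>\<omega>. exp (s * E \<omega> i j) \<partial>M) \<le> exp (s\<^sup>2 / 2)))"

definition observation ::
  "real \<Rightarrow> (nat \<Rightarrow> nat) \<Rightarrow> (nat \<Rightarrow> nat \<Rightarrow> real) \<Rightarrow> (nat \<Rightarrow> nat \<Rightarrow> real) \<Rightarrow> nat \<Rightarrow> nat \<Rightarrow> real" where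
  "observation \<sigma> \<pi> F E i j = F (\<pi> i) (\<pi> j) + \<sigma> * E i j"


section \<open>Loss\<close>

definition kendall_tau :: "nat \<Rightarrow> (nat \<Rightarrow> real) \<Rightarrow> (nat \<Rightarrow> real) \<Rightarrow> real" where
  "kendall_tau n p q =
     (1 / real n) * (\<Sum>(i, j)\<in>{(i, j). 1 \<le> i \<and> i < j \<and> j \<le> n}.
        of_bool (sgn (q i - q j) * sgn (p i - p j) < 0))"

definition kendall_loss :: "nat \<Rightarrow> (nat \<Rightarrow> real) \<Rightarrow> (nat \<Rightarrow> nat) \<Rightarrow> real" where
  "kendall_loss n p \<pi> =
     min (kendall_tau n p (\<lambda>i. real (\<pi> i)))
         (kendall_tau n p (\<lambda>i. real n + 1 - real (\<pi> i)))"


section \<open>Distance estimation\<close>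

definition masked :: "(nat \<Rightarrow> nat \<Rightarrow> real) \<Rightarrow> nat set \<Rightarrow> nat \<Rightarrow> nat \<Rightarrow> real" where
  "masked A S i j = (if i \<in> S \<and> j \<in> S then A i j else 0)"

text \<open>
  Ties in the choice of \<open>m\<^sub>i\<close> are resolved by an arbitrary rule \<open>tie\<close>: \<open>tie S i T\<close> selects an
  element of the set \<open>T\<close> of minimisers arising for the index \<open>i\<close> in the call on \<open>S\<close>.  In
  particular the distance estimate is a function of the masked matrix alone.
\<close>

type_synonym tie_rule = "nat set \<Rightarrow> nat \<Rightarrow> nat set \<Rightarrow> nat"

definition valid_tie_rule :: "tie_rule \<Rightarrow> bool" where
  "valid_tie_rule tie \<longleftrightarrow> (\<forall>S i T. T \<noteq> {} \<longrightarrow> tie S i T \<in> T)"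

definition neighbour ::
  "nat \<Rightarrow> tie_rule \<Rightarrow> (nat \<Rightarrow> nat \<Rightarrow> real) \<Rightarrow> nat set \<Rightarrow> nat \<Rightarrow> nat" where
  "neighbour n tie A S i = (let B = masked A S in
     tie S i {m. is_arg_min
       (\<lambda>j. MAX k\<in>S - {i, j}. \<bar>dot n (B k) (\<lambda>l. B i l - B j l)\<bar>) (\<lambda>j. j \<in> S \<and> j \<noteq> i) m})"

definition estimate_distance ::
  "nat \<Rightarrow> tie_rule \<Rightarrow> (nat \<Rightarrow> nat \<Rightarrow> real) \<Rightarrow> nat set \<Rightarrow> nat \<Rightarrow> nat \<Rightarrow> real" where
  "estimate_distance n tie A S i j =
     (if i \<in> S \<and> j \<in> S \<and> i \<noteq> j
      then let B = masked A S; m = neighbour n tie A S in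
        sqrt (max 0 (real n * (dot n (B i) (B (m i)) + dot n (B j) (B (m j)) - 2 * dot n (B i) (B j))))
      else 0)"


section \<open>First seriation\<close>

definition graph_edges ::
  "nat \<Rightarrow> (nat \<Rightarrow> nat \<Rightarrow> real) \<Rightarrow> real \<Rightarrow> real \<Rightarrow> nat \<Rightarrow> (nat \<times> nat) set" where
  "graph_edges n D \<delta>1 \<delta>2 i =
     {(k, l). k \<in> {1..n} - {i} \<and> l \<in> {1..n} - {i} \<and> k \<noteq> l \<and>
              D k l \<le> \<delta>1 \<and> max (D i k) (D i l) \<ge> \<delta>2}"

text \<open>The edge relation is symmetric for symmetric \<open>D\<close>, so connectedness is its reflexive
  transitive closure.\<close>

definition components :: "'a set \<Rightarrow> ('a \<times> 'a) set \<Rightarrow> 'a set set" where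
  "components V R = V // (R\<^sup>* \<inter> V \<times> V)"

definition far_components ::
  "nat \<Rightarrow> (nat \<Rightarrow> nat \<Rightarrow> real) \<Rightarrow> real \<Rightarrow> real \<Rightarrow> real \<Rightarrow> nat \<Rightarrow> nat set set" where
  "far_components n D \<delta>1 \<delta>2 \<delta>3 i =
     {X \<in> components ({1..n} - {i}) (graph_edges n D \<delta>1 \<delta>2 i). \<exists>k\<in>X. D i k \<ge> \<delta>3}"

definition is_largest :: "'a set set \<Rightarrow> 'a set \<Rightarrow> bool" where
  "is_largest \<X> X \<longleftrightarrow> (if \<X> = {} then X = {} else is_arg_max card (\<lambda>Y. Y \<in> \<X>) X)"

text \<open>The pair \<open>(L\<^sub>i, R\<^sub>i)\<close>.\<close>

definition orientation ::
  "(nat \<Rightarrow> nat set) \<Rightarrow> (nat \<Rightarrow> nat set) \<Rightarrow> nat \<Rightarrow> nat \<Rightarrow> nat set \<times> nat set" where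
  "orientation G G' c i =
     (if i = c then (G c, G' c)
      else if G' i = {} then (if i \<in> G c then ({}, G i) else (G i, {}))
      else if G i \<inter> G c = {} \<or> G' i \<inter> G' c = {} then (G' i, G i)
      else (G i, G' i))"

definition first_comparison :: "(nat \<Rightarrow> nat set) \<Rightarrow> (nat \<Rightarrow> nat set) \<Rightarrow> nat \<Rightarrow> nat \<Rightarrow> real" where
  "first_comparison L R i j =
     (if i = j \<or> (L i, R i) = ({}, {}) then 0
      else if i \<in> L j \<or> j \<in> R i then -1
      else if i \<in> R j \<or> j \<in> L i then 1
      else 0)"

text \<open>\<open>H\<close> is a possible result of the first seriation; the choice of the largest components
  and of the reference index \<open>c\<close> is unconstrained when there are ties.\<close>

definition first_seriation ::
  "nat \<Rightarrow> (nat \<Rightarrow> nat \<Rightarrow> real) \<Rightarrow> real \<Rightarrow> real \<Rightarrow> real \<Rightarrow> (nat \<Rightarrow> nat \<Rightarrow> real) \<Rightarrow> bool" where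
  "first_seriation n D \<delta>1 \<delta>2 \<delta>3 H \<longleftrightarrow>
     (\<exists>G G' c.
        (\<forall>i\<in>{1..n}. is_largest (far_components n D \<delta>1 \<delta>2 \<delta>3 i) (G i) \<and>
                    is_largest (far_components n D \<delta>1 \<delta>2 \<delta>3 i - {G i}) (G' i)) \<and>
        is_arg_max (\<lambda>i. min (card (G i)) (card (G' i))) (\<lambda>i. i \<in> {1..n}) c \<and>
        (\<forall>i\<in>{1..n}. \<forall>j\<in>{1..n}.
           H i j = first_comparison (\<lambda>k. fst (orientation G G' c k))
                                    (\<lambda>k. snd (orientation G G' c k)) i j))"


section \<open>Refined seriation\<close>

text \<open>Ordered triples; the parts may differ in size by one.\<close>

definition balanced_partitions :: "nat \<Rightarrow> (nat set \<times> nat set \<times> nat set) set" where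
  "balanced_partitions n =
     {(S1, S2, S3). S1 \<union> S2 \<union> S3 = {1..n} \<and>
        S1 \<inter> S2 = {} \<and> S1 \<inter> S3 = {} \<and> S2 \<inter> S3 = {} \<and>
        (\<forall>T\<in>{S1, S2, S3}. \<lfloor>real n / 3\<rfloor> \<le> int (card T) \<and> int (card T) \<le> \<lceil>real n / 3\<rceil>)}"

text \<open>The entry for a pair \<open>i < j\<close> with \<open>H i j = 0\<close>, given the part \<open>T\<close> and the proxy \<open>p\<close>
  of \<open>i\<close> in \<open>T\<close>.\<close>

definition refined_comparison ::
  "nat \<Rightarrow> tie_rule \<Rightarrow> (nat \<Rightarrow> nat \<Rightarrow> real) \<Rightarrow> real \<Rightarrow> real \<Rightarrow> (nat \<Rightarrow> nat \<Rightarrow> real) \<Rightarrow>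
   nat set \<Rightarrow> nat \<Rightarrow> nat \<Rightarrow> nat \<Rightarrow> real" where
  "refined_comparison n tie A \<sigma> \<delta>4 H T p i j =
     (let far = {k \<in> T. estimate_distance n tie A T p k \<ge> \<delta>4};
          l = (\<Sum>k\<in>{k \<in> {1..n}. H i k = 1 \<and> H j k = 1} \<inter> far. A i k - A j k);
          \<rho> = (\<Sum>k\<in>{k \<in> {1..n}. H i k = -1 \<and> H j k = -1} \<inter> far. A i k - A j k);
          \<tau> = 5 * \<sigma> * sqrt (real n * ln (real n))
      in if \<bar>l\<bar> \<ge> \<tau> then - sgn l else if \<bar>\<rho>\<bar> \<ge> \<tau> then sgn \<rho> else 0)"

definition refined_seriation ::
  "nat \<Rightarrow> tie_rule \<Rightarrow> (nat \<Rightarrow> nat \<Rightarrow> real) \<Rightarrow> real \<Rightarrow> real \<Rightarrow> nat set \<times> nat set \<times> nat set \<Rightarrow>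
   (nat \<Rightarrow> nat \<Rightarrow> real) \<Rightarrow> (nat \<Rightarrow> nat \<Rightarrow> real) \<Rightarrow> (nat \<Rightarrow> nat \<Rightarrow> real) \<Rightarrow> bool" where
  "refined_seriation n tie A \<sigma> \<delta>4 P D H H' \<longleftrightarrow>
     (case P of (S1, S2, S3) \<Rightarrow>
       (\<forall>i\<in>{1..n}. H' i i = 0) \<and>
       (\<forall>i\<in>{1..n}. \<forall>j\<in>{1..n}. i < j \<longrightarrow>
          H' j i = - H' i j \<and>
          (if H i j = 0
           then \<exists>T\<in>{S1, S2, S3}. i \<notin> T \<and> j \<notin> T \<and>
                  (\<exists>p. is_arg_min (\<lambda>q. D i q) (\<lambda>q. q \<in> T) p \<and>
                       H' i j = refined_comparison n tie A \<sigma> \<delta>4 H T p i j)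
           else H' i j = 0)))"


section \<open>The algorithm\<close>

text \<open>\<open>p\<close> is a possible output of SABRE on \<open>A\<close> when the partition drawn is \<open>P\<close>.\<close>

definition sabre_output ::
  "nat \<Rightarrow> tie_rule \<Rightarrow> (nat \<Rightarrow> nat \<Rightarrow> real) \<Rightarrow> real \<Rightarrow> real \<Rightarrow> real \<Rightarrow> real \<Rightarrow> real \<Rightarrow>
   nat set \<times> nat set \<times> nat set \<Rightarrow> (nat \<Rightarrow> real) \<Rightarrow> bool" where
  "sabre_output n tie A \<sigma> \<delta>1 \<delta>2 \<delta>3 \<delta>4 P p \<longleftrightarrow>
     (\<exists>D H H'. D = estimate_distance n tie A {1..n} \<and>
        first_seriation n D \<delta>1 \<delta>2 \<delta>3 H \<and>
        refined_seriation n tie A \<sigma> \<delta>4 P D H H' \<and>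
        (\<forall>i\<in>{1..n}. p i = ((\<Sum>j\<in>{1..n}. H i j + H' i j) + real n + 1) / 2))"

text \<open>The partition is uniform on \<open>balanced_partitions n\<close> and independent of the
  random matrix \<open>A\<close>.\<close>

definition random_partition ::
  "nat \<Rightarrow> 'w measure \<Rightarrow> ('w \<Rightarrow> nat \<Rightarrow> nat \<Rightarrow> real) \<Rightarrow> ('w \<Rightarrow> nat set \<times> nat set \<times> nat set) \<Rightarrow> bool" where
  "random_partition n M A P \<longleftrightarrow>
     P \<in> measurable M (count_space UNIV) \<and>
     distr M (count_space UNIV) P = measure_pmf (pmf_of_set (balanced_partitions n)) \<and>
     prob_space.indep_set M
       {(\<lambda>\<omega>. \<lambda>(i, j)\<in>{1..n} \<times> {1..n}. A \<omega> i j) -` B \<inter> space M | B.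
          B \<in> sets (PiM ({1..n} \<times> {1..n}) (\<lambda>_. borel))}
       {P -` Q \<inter> space M | Q. Q \<in> sets (count_space UNIV)}"

end

theory Submission
  imports Defs "HOL-Real_Asymp.Real_Asymp"
begin

text \<open>
  Write \<open>G i j = F (\<pi> i) (\<pi> j)\<close>.  The average-Lipschitz condition makes \<open>sqrt n\<close> times the row distance
  of \<open>G\<close> comparable to \<open>\<bar>\<pi> i - \<pi> j\<bar>\<close>, globally, and a Chernoff bound for uniform random partitions shows
  that this, and one fifth of the signal, survives restriction to each part.  Inner products of
  distinct noisy rows have errors of order \<open>sqrt n * ln n\<close>, so the estimated distances are accurate up to
  \<open>n powr (3/4) * sqrt (ln n)\<close>, below all thresholds.  Hence the graphs of the first seriation split
  exactly into a left and a right side, and up to reversal \<open>H\<close> has no wrong sign and vanishes only on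
  pairs at distance of order \<open>\<delta>3\<close>.  In the second stage the set of comparison columns is then determined by
  the block of \<open>A\<close> on one part \<open>T\<close>, which is independent of the rows compared; summing over the values
  of this set, the noise stays below \<open>3 \<sigma> sqrt (n ln n)\<close>.  So no wrong sign is produced, and a pair left
  undecided has signal less than \<open>8 \<sigma> sqrt (n ln n)\<close>, that is, lies at distance less than
  \<open>40 (\<sigma> / \<alpha>) sqrt (n ln n)\<close>.  Each estimated rank is therefore off by at most half of this, which bounds the
  number of inverted pairs.
\<close>

section \<open>Distance estimation\<close>

text \<open>Three parts are used because any pair \<open>i\<close>, \<open>j\<close> then misses at
  least one of them. The obstacle in the second stage is dependence: the matrix \<open>H\<close> and
  the proxy \<open>p\<close> are functions of all of \<open>A\<close>, including the rows that are
  compared. \<open>H\<close> does no harm because its entries at columns far from \<open>p\<close>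
  are forced by the ranks, so the comparison columns are just the far columns on one side of
  \<open>p\<close>, and being far is decided by the block on \<open>T\<close>. The choice of the
  proxy is absorbed by asking for the noise bound at every \<open>p\<close> in \<open>T\<close>
  simultaneously. A proxy is needed at all because \<open>i\<close> is not in \<open>T\<close>, so
  its distances cannot be read off from that block.

  The order is recoverable only up to reversal, and the data decide which of the two orders
  \<open>H\<close> follows; the good events are therefore kept invariant under reversing the ranks.
  The constant 40 is \<open>5 * (5 + 3)\<close>: decision threshold plus noise level, divided by the
  retained fraction \<open>1/5\<close>. That fraction lies below the mean share \<open>1/3\<close>
  of a part, which is what makes losing more exponentially unlikely.\<close>

lemma dot_masked:
  assumes "S \<subseteq> {1..n}" "i \<in> S" "j \<in> S"
  shows "dot n (masked A S i) (masked A S j) = (\<Sum>l\<in>S. A i l * A j l)"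
proof -
  have "dot n (masked A S i) (masked A S j) = (\<Sum>l\<in>{1..n} \<inter> S. A i l * A j l)"
    unfolding dot_def masked_def using assms
    by (subst sum.inter_restrict) (auto intro!: sum.cong)
  also have "{1..n} \<inter> S = S" using assms by auto
  finally show ?thesis .
qed

lemma dot_diff_right: "dot n u (\<lambda>l. v l - w l) = dot n u v - dot n u w"
  by (simp add: dot_def algebra_simps sum_subtractf)

lemma dot_commute: "dot n u v = dot n v u"
  by (simp add: dot_def mult.commute)

lemma estimate_distance_commute:
  "estimate_distance n tie A S i j = estimate_distance n tie A S j i"
  unfolding estimate_distance_def Let_def
  by (simp add: dot_commute[of n "masked A S i" "masked A S j"] add.commute)

lemma abs_sum_mult_le:
  fixes u v :: "'a \<Rightarrow> real"
  assumes "(\<Sum>l\<in>S. (u l)\<^sup>2) \<le> p" "(\<Sum>l\<in>S. (v l)\<^sup>2) \<le> q"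
  shows "\<bar>\<Sum>l\<in>S. u l * v l\<bar> \<le> sqrt (p * q)"
proof -
  have "(\<Sum>l\<in>S. u l * v l)\<^sup>2 \<le> (\<Sum>l\<in>S. (u l)\<^sup>2) * (\<Sum>l\<in>S. (v l)\<^sup>2)"
    by (rule Cauchy_Schwarz_ineq_sum)
  also have "\<dots> \<le> p * q"
    using assms by (intro mult_mono) (auto intro: sum_nonneg order_trans[OF sum_nonneg[of S] assms(1)])
  finally have "sqrt ((\<Sum>l\<in>S. u l * v l)\<^sup>2) \<le> sqrt (p * q)" by (rule real_sqrt_le_mono)
  then show ?thesis by simp
qed

text \<open>Since the difference of the roots is dominated by their sum, its square is at most
  \<open>|x - y|\<close>. Passing from squared distances to distances in this way costs a square
  root of the error, but it needs no lower bound on the distances and so covers nearby rows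
  too.\<close>

lemma abs_diff_sqrt_le:
  fixes x y e :: real
  assumes "0 \<le> x" "0 \<le> y" "\<bar>x - y\<bar> \<le> e"
  shows "\<bar>sqrt x - sqrt y\<bar> \<le> sqrt e"
proof -
  have *: "\<bar>sqrt x - sqrt y\<bar>\<^sup>2 \<le> \<bar>x - y\<bar>"
  proof -
    have "\<bar>sqrt x - sqrt y\<bar>\<^sup>2 = \<bar>sqrt x - sqrt y\<bar> * \<bar>sqrt x - sqrt y\<bar>"
      by (simp add: power2_eq_square)
    also have "\<dots> \<le> \<bar>sqrt x - sqrt y\<bar> * \<bar>sqrt x + sqrt y\<bar>"
      using real_sqrt_ge_zero[OF assms(1)] real_sqrt_ge_zero[OF assms(2)]
      by (intro mult_left_mono) linarith+
    also have "\<dots> = \<bar>(sqrt x - sqrt y) * (sqrt x + sqrt y)\<bar>"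
      by (simp add: abs_mult)
    also have "(sqrt x - sqrt y) * (sqrt x + sqrt y) = x - y"
      using assms by (simp add: algebra_simps)
    finally show ?thesis .
  qed
  then have "\<bar>sqrt x - sqrt y\<bar>\<^sup>2 \<le> e" using assms by linarith
  then show ?thesis by (simp add: real_le_rsqrt)
qed

lemma sum_sq_diff_le_card:
  assumes "\<And>l. l \<in> S \<Longrightarrow> 0 \<le> u l \<and> u l \<le> (1::real)" "\<And>l. l \<in> S \<Longrightarrow> 0 \<le> v l \<and> v l \<le> 1"
  shows "(\<Sum>l\<in>S. (u l - v l)\<^sup>2) \<le> real (card S)"
proof -
  have "(\<Sum>l\<in>S. (u l - v l)\<^sup>2) \<le> (\<Sum>l\<in>S. 1)"
    using assms by (intro sum_mono) (force simp: abs_square_le_1 intro: abs_leI)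
  then show ?thesis by simp
qed

text \<open>The proxy \<open>m\<close> of \<open>i\<close> avoids the noise bias of \<open>\<langle>A\<^sub>i, A\<^sub>i\<rangle>\<close>.  Its defining minimisation controls
  \<open>\<langle>G\<^sub>k, G\<^sub>i - G\<^sub>m\<rangle>\<close> only for \<open>k\<close> different from \<open>i\<close> and \<open>m\<close>; the case \<open>k = i\<close> is reached through the near
  row \<open>i'\<close>.\<close>

lemma neighbour_inner_product:
  fixes G A :: "nat \<Rightarrow> nat \<Rightarrow> real" and S :: "nat set" and n :: nat and e h :: real
  assumes S: "S \<subseteq> {1..n}" "card S \<ge> 3" and h: "0 \<le> h"
    and tie: "valid_tie_rule tie"
    and G01: "\<And>i l. i \<in> S \<Longrightarrow> l \<in> S \<Longrightarrow> 0 \<le> G i l \<and> G i l \<le> 1"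
    and inner: "\<And>k l. k \<in> S \<Longrightarrow> l \<in> S \<Longrightarrow> k \<noteq> l \<Longrightarrow>
        \<bar>(\<Sum>m\<in>S. A k m * A l m) - (\<Sum>m\<in>S. G k m * G l m)\<bar> \<le> e"
    and i: "i \<in> S"
    and near: "i' \<in> S" "i' \<noteq> i" "real n * (\<Sum>m\<in>S. (G i m - G i' m)\<^sup>2) \<le> h\<^sup>2"
  defines "m \<equiv> neighbour n tie A S i"
  shows "m \<in> S" "m \<noteq> i"
    "\<bar>(\<Sum>l\<in>S. A i l * A m l) - (\<Sum>l\<in>S. G i l * G i l)\<bar> \<le> 5 * e + 2 * h"
proof -
  define B where "B = masked A S"
  define P where "P x y = (\<Sum>l\<in>S. A x l * A y l)" for x y
  define Q where "Q x y = (\<Sum>l\<in>S. G x l * G y l)" for x y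
  define f where "f j = (MAX k\<in>S - {i, j}. \<bar>dot n (B k) (\<lambda>l. B i l - B j l)\<bar>)" for j
  have finS: "finite S" using S finite_subset by blast
  have n: "real n > 0" using S card_mono[OF _ S(1)] by simp
  have f_eq: "f j = (MAX k\<in>S - {i, j}. \<bar>P k i - P k j\<bar>)" if "j \<in> S" for j
    unfolding f_def dot_diff_right B_def P_def using that i S(1)
    by (intro arg_cong[where f=Max] image_cong) (auto simp: dot_masked)
  have ne: "S - {i, j} \<noteq> {}" for j
  proof
    assume "S - {i, j} = {}"
    then have "S \<subseteq> {i, j}" by auto
    then have "card S \<le> card {i, j}" by (intro card_mono) auto
    also have "card {i, j} \<le> 2" by (simp add: card_insert_if)
    finally show False using S by simp
  qed
  have arg: "{x. is_arg_min f (\<lambda>j. j \<in> S \<and> j \<noteq> i) x} \<noteq> {}"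
  proof -
    have "finite (S - {i})" "S - {i} \<noteq> {}" using finS ne[of i] by auto
    then obtain x where "x \<in> S - {i}" "\<forall>y\<in>S - {i}. f x \<le> f y"
      using ex_min_if_finite[of "f ` (S - {i})"] by (auto simp: not_less)
    then show ?thesis by (force simp: is_arg_min_def not_less)
  qed
  have mdef: "m = tie S i {x. is_arg_min f (\<lambda>j. j \<in> S \<and> j \<noteq> i) x}"
    by (simp add: m_def neighbour_def Let_def f_def[abs_def] B_def)
  have marg: "is_arg_min f (\<lambda>j. j \<in> S \<and> j \<noteq> i) m"
    using tie[unfolded valid_tie_rule_def, rule_format, OF arg, of S i] by (simp add: mdef)
  then show m: "m \<in> S" "m \<noteq> i" by (auto simp: is_arg_min_def)
  have e: "0 \<le> e" using inner[OF i m(1)] m(2) by fastforce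
  have norm1: "(\<Sum>l\<in>S. (G x l)\<^sup>2) \<le> real n" if "x \<in> S" for x
  proof -
    have "(\<Sum>l\<in>S. (G x l - 0)\<^sup>2) \<le> real (card S)"
      using G01[OF that] by (intro sum_sq_diff_le_card) auto
    also have "\<dots> \<le> real n" using card_mono[OF _ S(1)] by simp
    finally show ?thesis by simp
  qed
  have norm2: "(\<Sum>l\<in>S. (G i l - G m l)\<^sup>2) \<le> real n"
  proof -
    have "(\<Sum>l\<in>S. (G i l - G m l)\<^sup>2) \<le> real (card S)"
      using G01 i m by (intro sum_sq_diff_le_card) auto
    also have "\<dots> \<le> real n" using card_mono[OF _ S(1)] by simp
    finally show ?thesis .
  qed
  have near': "(\<Sum>l\<in>S. (G i l - G i' l)\<^sup>2) \<le> h\<^sup>2 / real n"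
    using near n by (simp add: field_simps)
  have cs: "\<bar>\<Sum>l\<in>S. (G i l - G i' l) * v l\<bar> \<le> h" if "(\<Sum>l\<in>S. (v l)\<^sup>2) \<le> real n" for v
    using abs_sum_mult_le[OF near' that] n h by simp
  have PQ: "\<bar>(P k i - P k j) - (Q k i - Q k j)\<bar> \<le> 2 * e"
    if "k \<in> S" "j \<in> S" "k \<noteq> i" "k \<noteq> j" for k j
    using inner[OF that(1) i that(3)] inner[OF that(1,2,4)] unfolding P_def Q_def by linarith
  \<comment> \<open>The near row plays two roles. Here it is a competitor in the minimisation, so
    its value bounds that of \<open>m\<close>; further on it stands in for \<open>i\<close> as left
    factor.\<close>
  have "f i' \<le> 2 * e + h"
  proof -
    have "\<bar>P k i - P k i'\<bar> \<le> 2 * e + h" if "k \<in> S - {i, i'}" for k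
    proof -
      have "Q k i - Q k i' = (\<Sum>l\<in>S. (G i l - G i' l) * G k l)"
        by (simp add: Q_def algebra_simps sum_subtractf)
      then have "\<bar>Q k i - Q k i'\<bar> \<le> h" using cs[OF norm1, of k] that by simp
      then show ?thesis using PQ[of k i'] that near by auto
    qed
    then show ?thesis using near ne[of i'] finS by (subst f_eq) (auto intro!: Max.boundedI)
  qed
  then have fm: "f m \<le> 2 * e + h" using marg near by (force simp: is_arg_min_def)
  have Qkm: "\<bar>Q k i - Q k m\<bar> \<le> 4 * e + h" if "k \<in> S" "k \<noteq> i" "k \<noteq> m" for k
  proof -
    have "\<bar>P k i - P k m\<bar> \<le> f m"
      using that m finS by (subst f_eq) (auto intro!: Max_ge)
    then show ?thesis using fm PQ[of k m] that m by linarith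
  qed
  \<comment> \<open>Minimality yields \<open>4 * e + h\<close> for left factor \<open>i'\<close>,
    and exchanging \<open>i'\<close> for \<open>i\<close> costs another \<open>h\<close>. If
    \<open>i'\<close> is \<open>m\<close> itself, minimality says nothing about it, but then
    \<open>m\<close> is already near \<open>i\<close>.\<close>
  have "\<bar>Q i i - Q i m\<bar> \<le> 4 * e + 2 * h"
  proof (cases "i' = m")
    case True
    have "Q i i - Q i m = (\<Sum>l\<in>S. (G i l - G i' l) * G i l)"
      by (simp add: Q_def True algebra_simps sum_subtractf)
    then show ?thesis using cs[OF norm1[OF i]] e h by simp
  next
    case False
    have "(Q i i - Q i m) - (Q i' i - Q i' m) = (\<Sum>l\<in>S. (G i l - G i' l) * (G i l - G m l))"
      by (simp add: Q_def algebra_simps sum_subtractf sum.distrib)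
    then have "\<bar>(Q i i - Q i m) - (Q i' i - Q i' m)\<bar> \<le> h" using cs[OF norm2] by simp
    then show ?thesis using Qkm[OF near(1,2) False] by linarith
  qed
  moreover have "\<bar>P i m - Q i m\<bar> \<le> e" using inner[OF i m(1)] m unfolding P_def Q_def by simp
  ultimately show "\<bar>(\<Sum>l\<in>S. A i l * A m l) - (\<Sum>l\<in>S. G i l * G i l)\<bar> \<le> 5 * e + 2 * h"
    unfolding P_def Q_def by linarith
qed

lemma abs_combine:
  fixes x y z :: real
  assumes "\<bar>x\<bar> \<le> p" "\<bar>y\<bar> \<le> p" "\<bar>z\<bar> \<le> q"
  shows "\<bar>x + y - 2 * z\<bar> \<le> 2 * p + 2 * q"
  using assms by linarith

text \<open>The squared norm of \<open>G i - G j\<close> is expanded into two diagonal terms and a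
  cross term. The diagonal terms have error \<open>5 * e + 2 * h\<close> each through the proxies,
  the cross term has error \<open>e\<close> and counts twice: in total
  \<open>12 * e + 4 * h\<close>. Truncation at 0 only helps, the true value being
  nonnegative.\<close>

lemma estimate_distance_error:
  fixes G A :: "nat \<Rightarrow> nat \<Rightarrow> real" and S :: "nat set" and n :: nat and e h :: real
  assumes S: "S \<subseteq> {1..n}" "card S \<ge> 3" and h: "0 \<le> h"
    and tie: "valid_tie_rule tie"
    and G01: "\<And>i l. i \<in> S \<Longrightarrow> l \<in> S \<Longrightarrow> 0 \<le> G i l \<and> G i l \<le> 1"
    and inner: "\<And>k l. k \<in> S \<Longrightarrow> l \<in> S \<Longrightarrow> k \<noteq> l \<Longrightarrow>
        \<bar>(\<Sum>m\<in>S. A k m * A l m) - (\<Sum>m\<in>S. G k m * G l m)\<bar> \<le> e"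
    and near: "\<And>i. i \<in> S \<Longrightarrow> \<exists>i'\<in>S. i' \<noteq> i \<and> real n * (\<Sum>m\<in>S. (G i m - G i' m)\<^sup>2) \<le> h\<^sup>2"
    and i: "i \<in> S" and j: "j \<in> S" and ij: "i \<noteq> j"
  shows "\<bar>estimate_distance n tie A S i j - sqrt (real n * (\<Sum>m\<in>S. (G i m - G j m)\<^sup>2))\<bar>
           \<le> sqrt (real n * (12 * e + 4 * h))"
proof -
  define mi where "mi = neighbour n tie A S i"
  define mj where "mj = neighbour n tie A S j"
  obtain i' where i': "i' \<in> S" "i' \<noteq> i" "real n * (\<Sum>m\<in>S. (G i m - G i' m)\<^sup>2) \<le> h\<^sup>2"
    using near[OF i] by blast
  obtain j' where j': "j' \<in> S" "j' \<noteq> j" "real n * (\<Sum>m\<in>S. (G j m - G j' m)\<^sup>2) \<le> h\<^sup>2"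
    using near[OF j] by blast
  have ni: "mi \<in> S" "\<bar>(\<Sum>l\<in>S. A i l * A mi l) - (\<Sum>l\<in>S. G i l * G i l)\<bar> \<le> 5 * e + 2 * h"
    unfolding mi_def using neighbour_inner_product[where G=G and i'=i', OF S h tie _ _ i i'] G01 inner by blast+
  have nj: "mj \<in> S" "\<bar>(\<Sum>l\<in>S. A j l * A mj l) - (\<Sum>l\<in>S. G j l * G j l)\<bar> \<le> 5 * e + 2 * h"
    unfolding mj_def using neighbour_inner_product[where G=G and i'=j', OF S h tie _ _ j j'] G01 inner by blast+
  define x where "x = real n * ((\<Sum>l\<in>S. A i l * A mi l) + (\<Sum>l\<in>S. A j l * A mj l)
                                - 2 * (\<Sum>l\<in>S. A i l * A j l))"
  define y where "y = real n * (\<Sum>m\<in>S. (G i m - G j m)\<^sup>2)"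
  have D: "estimate_distance n tie A S i j = sqrt (max 0 x)"
    unfolding estimate_distance_def Let_def x_def mi_def[symmetric] mj_def[symmetric]
    using i j ij ni(1) nj(1) S(1) by (simp add: dot_masked)
  have y0: "y \<ge> 0" by (simp add: y_def sum_nonneg)
  have y: "y = real n * ((\<Sum>l\<in>S. G i l * G i l) + (\<Sum>l\<in>S. G j l * G j l)
                                - 2 * (\<Sum>l\<in>S. G i l * G j l))"
    by (simp add: y_def power2_eq_square algebra_simps sum_subtractf sum.distrib sum_distrib_left)
  have "x - y = real n * (((\<Sum>l\<in>S. A i l * A mi l) - (\<Sum>l\<in>S. G i l * G i l))
         + ((\<Sum>l\<in>S. A j l * A mj l) - (\<Sum>l\<in>S. G j l * G j l))
         - 2 * ((\<Sum>l\<in>S. A i l * A j l) - (\<Sum>l\<in>S. G i l * G j l)))"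
    unfolding x_def y by (simp add: algebra_simps)
  then have "\<bar>x - y\<bar> = real n * \<bar>((\<Sum>l\<in>S. A i l * A mi l) - (\<Sum>l\<in>S. G i l * G i l))
         + ((\<Sum>l\<in>S. A j l * A mj l) - (\<Sum>l\<in>S. G j l * G j l))
         - 2 * ((\<Sum>l\<in>S. A i l * A j l) - (\<Sum>l\<in>S. G i l * G j l))\<bar>"
    by (simp add: abs_mult)
  also have "\<dots> \<le> real n * (12 * e + 4 * h)"
    by (intro mult_left_mono order_trans[OF abs_combine[OF ni(2) nj(2) inner[OF i j ij]]]) auto
  finally have "\<bar>max 0 x - y\<bar> \<le> real n * (12 * e + 4 * h)" using y0 by linarith
  then show ?thesis unfolding D y_def[symmetric] using y0
    by (intro abs_diff_sqrt_le) auto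
qed

section \<open>First seriation\<close>

lemma component_eq:
  assumes "sym R" "R \<subseteq> V \<times> V" "X \<in> components V R" "x \<in> X"
  shows "X = {y \<in> V. (x, y) \<in> R\<^sup>*}" "x \<in> V"
proof -
  have sym: "(y, z) \<in> R\<^sup>*" if "(z, y) \<in> R\<^sup>*" for y z
    using that sym_rtrancl[OF assms(1)] by (blast dest: symD)
  obtain z where z: "z \<in> V" "X = (R\<^sup>* \<inter> V \<times> V) `` {z}"
    using assms(3) unfolding components_def by (blast elim: quotientE)
  then show "x \<in> V" using assms(4) by auto
  show "X = {y \<in> V. (x, y) \<in> R\<^sup>*}"
    using z assms(4) sym by (auto intro: rtrancl_trans)
qed

lemma component_of:
  assumes "x \<in> V"
  shows "{y \<in> V. (x, y) \<in> R\<^sup>*} \<in> components V R"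
proof -
  have "{y \<in> V. (x, y) \<in> R\<^sup>*} = (R\<^sup>* \<inter> V \<times> V) `` {x}" using assms by auto
  then show ?thesis using assms unfolding components_def by (auto intro: quotientI)
qed

lemma is_largest_mem: "is_largest \<X> X \<Longrightarrow> \<X> \<noteq> {} \<Longrightarrow> X \<in> \<X>"
  by (auto simp: is_largest_def is_arg_max_def)

lemma is_largest_empty: "is_largest {} X \<Longrightarrow> X = {}"
  by (auto simp: is_largest_def)

text \<open>The deterministic content of the first stage: \<open>D\<close> is comparable to the gap
  of the ranks \<open>\<psi>\<close> up to an additive error \<open>\<omega>\<close>. Consecutive
  ranks satisfy the short-distance condition for an edge by \<open>steps_le\<close>;
  \<open>edges_short\<close> forbids edges across \<open>i\<close>; \<open>far_reached\<close>
  places every vertex at distance \<open>\<delta>3\<close> from \<open>i\<close> in the region where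
  distance \<open>\<delta>2\<close> is guaranteed; \<open>n_large\<close> leaves room for a
  component on some side of every index, and for large ones on both sides of the middle.\<close>

locale embedded_distance =
  fixes n :: nat and \<psi> :: "nat \<Rightarrow> nat" and D :: "nat \<Rightarrow> nat \<Rightarrow> real"
    and a b \<omega> \<delta>1 \<delta>2 \<delta>3 :: real
  assumes bij: "bij_betw \<psi> {1..n} {1..n}"
    and D_sym: "\<And>k l. D k l = D l k"
    and D_lower: "\<And>i j. i \<in> {1..n} \<Longrightarrow> j \<in> {1..n} \<Longrightarrow> i \<noteq> j \<Longrightarrow>
          a * \<bar>real (\<psi> i) - real (\<psi> j)\<bar> - \<omega> \<le> D i j"
    and D_upper: "\<And>i j. i \<in> {1..n} \<Longrightarrow> j \<in> {1..n} \<Longrightarrow> i \<noteq> j \<Longrightarrow>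
          D i j \<le> b * \<bar>real (\<psi> i) - real (\<psi> j)\<bar> + \<omega>"
    and pos: "0 < a" "0 < b" "0 \<le> \<omega>"
    and steps_le: "b + \<omega> \<le> \<delta>1"
    and edges_short: "(\<delta>1 + \<omega>) / a * b < \<delta>2 - \<omega>"
    and far_reached: "(\<delta>2 + \<omega>) / a \<le> (\<delta>3 - \<omega>) / b"
    and \<delta>_mono: "\<delta>2 \<le> \<delta>3"
    and n_large: "(\<delta>3 + \<omega>) / a + 2 * ((\<delta>2 + \<omega>) / a) + 5 \<le> real n / 2"
begin

text \<open>From a rank gap of \<open>q2\<close>, respectively \<open>q3\<close>, onwards the lower
  bound forces \<open>D\<close> to be at least \<open>\<delta>2\<close>, respectively
  \<open>\<delta>3\<close>.\<close>

definition "q2 = (\<delta>2 + \<omega>) / a"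
definition "q3 = (\<delta>3 + \<omega>) / a"
definition "left i = {k \<in> {1..n}. \<psi> k < \<psi> i}"
definition "right i = {k \<in> {1..n}. \<psi> i < \<psi> k}"
definition "far_left i = {k \<in> {1..n}. real (\<psi> k) + q2 \<le> real (\<psi> i)}"
definition "far_right i = {k \<in> {1..n}. real (\<psi> i) + q2 \<le> real (\<psi> k)}"

abbreviation "far i \<equiv> far_components n D \<delta>1 \<delta>2 \<delta>3 i"
abbreviation "E i \<equiv> graph_edges n D \<delta>1 \<delta>2 i"

lemma psi_range: "i \<in> {1..n} \<Longrightarrow> 1 \<le> \<psi> i \<and> \<psi> i \<le> n"
  using bij_betwE[OF bij] by auto

lemma psi_inj: "i \<in> {1..n} \<Longrightarrow> j \<in> {1..n} \<Longrightarrow> \<psi> i = \<psi> j \<longleftrightarrow> i = j"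
  by (rule inj_on_eq_iff[OF bij_betw_imp_inj_on[OF bij]])

lemma psi_surj: "1 \<le> x \<Longrightarrow> x \<le> n \<Longrightarrow> \<exists>k\<in>{1..n}. \<psi> k = x"
  using bij_betw_imp_surj_on[OF bij] by (metis atLeastAtMost_iff image_iff)

lemma delta_pos: "0 < \<delta>1" "0 < \<delta>2" "0 < q2" "q2 \<le> q3"
proof -
  show 1: "0 < \<delta>1" using steps_le pos by linarith
  have "0 < (\<delta>1 + \<omega>) / a * b" using 1 pos by simp
  then show 2: "0 < \<delta>2" using edges_short pos by linarith
  then show "0 < q2" using pos unfolding q2_def by simp
  show "q2 \<le> q3" using \<delta>_mono pos unfolding q2_def q3_def by (simp add: divide_right_mono)
qed

text \<open>An edge of \<open>E i\<close> is shorter than the distance of one of its ends to \<open>i\<close>, so it cannot cross \<open>i\<close>.\<close>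

lemma edge_left:
  assumes e: "(k, l) \<in> E i" and i: "i \<in> {1..n}" and k: "k \<in> left i"
  shows "l \<in> left i"
proof -
  have kl: "k \<in> {1..n}" "l \<in> {1..n}" "k \<noteq> i" "l \<noteq> i" "k \<noteq> l" "D k l \<le> \<delta>1"
    and far: "D i k \<ge> \<delta>2 \<or> D i l \<ge> \<delta>2"
    using e by (auto simp: graph_edges_def)
  define d where "d = \<bar>real (\<psi> k) - real (\<psi> l)\<bar>"
  have "a * d \<le> \<delta>1 + \<omega>" using D_lower[of k l] kl unfolding d_def by linarith
  then have "d \<le> (\<delta>1 + \<omega>) / a" using pos by (simp add: field_simps)
  then have d: "b * d < \<delta>2 - \<omega>"
    using edges_short mult_right_mono[of d "(\<delta>1 + \<omega>) / a" b] pos by (simp add: mult.commute)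
  have "b * d < b * \<bar>real (\<psi> i) - real (\<psi> k)\<bar> \<or> b * d < b * \<bar>real (\<psi> i) - real (\<psi> l)\<bar>"
    using D_upper[OF i kl(1) kl(3)[symmetric]] D_upper[OF i kl(2) kl(4)[symmetric]] far d by linarith
  then have "d < \<bar>real (\<psi> i) - real (\<psi> k)\<bar> \<or> d < \<bar>real (\<psi> i) - real (\<psi> l)\<bar>"
    using pos by simp
  then show ?thesis using k kl unfolding left_def d_def by auto
qed

lemma E_sym: "sym (E i)"
  by (auto simp: sym_def graph_edges_def D_sym max.commute)

lemma E_subset: "E i \<subseteq> ({1..n} - {i}) \<times> ({1..n} - {i})"
  by (auto simp: graph_edges_def)

lemma reach_left: "(k, l) \<in> (E i)\<^sup>* \<Longrightarrow> i \<in> {1..n} \<Longrightarrow> k \<in> left i \<Longrightarrow> l \<in> left i"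
  by (induction rule: rtrancl_induct) (auto intro: edge_left)

text \<open>\<open>far_left i\<close> is an initial segment in rank order. Two consecutive members
  are joined by an edge, since their distance is at most \<open>b + \<omega>\<close> and both are at
  distance at least \<open>\<delta>2\<close> from \<open>i\<close>; the path climbs from rank 1 one
  rank at a time.\<close>

lemma chain_left:
  assumes i: "i \<in> {1..n}" and k1: "k1 \<in> {1..n}" "\<psi> k1 = 1" and k: "k \<in> far_left i"
  shows "(k1, k) \<in> (E i)\<^sup>*"
proof -
  have D_far: "D i l \<ge> \<delta>2" if "l \<in> far_left i" for l
  proof -
    have l: "l \<in> {1..n}" "l \<noteq> i" "real (\<psi> i) - real (\<psi> l) \<ge> q2"
      using that delta_pos unfolding far_left_def by auto
    then have "a * q2 \<le> a * \<bar>real (\<psi> i) - real (\<psi> l)\<bar>" using pos by (intro mult_left_mono) auto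
    moreover have "a * q2 = \<delta>2 + \<omega>" using pos by (simp add: q2_def)
    ultimately show ?thesis using D_lower[of i l] l i by linarith
  qed
  have "\<forall>k. k \<in> far_left i \<longrightarrow> \<psi> k = x \<longrightarrow> (k1, k) \<in> (E i)\<^sup>*" if "1 \<le> x" for x
    using that
  proof (induction x rule: nat_induct_at_least)
    case base
    have "k = k1" if "k \<in> {1..n}" "\<psi> k = 1" for k using psi_inj[OF that(1) k1(1)] that k1 by simp
    then show ?case unfolding far_left_def by blast
  next
    case (Suc x)
    show ?case
    proof (intro allI impI)
      fix k assume k: "k \<in> far_left i" "\<psi> k = Suc x"
      then have kn: "k \<in> {1..n}" unfolding far_left_def by simp
      obtain l where l: "l \<in> {1..n}" "\<psi> l = x"
        using psi_surj[of x] Suc.hyps psi_range[OF kn] k by auto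
      have lf: "l \<in> far_left i" using l k unfolding far_left_def by auto
      have "k \<noteq> i" "l \<noteq> i" using k lf delta_pos unfolding far_left_def by auto
      moreover have "k \<noteq> l" using k l by auto
      moreover have "D l k \<le> \<delta>1"
        using D_upper[OF l(1) kn] k l \<open>k \<noteq> l\<close> steps_le by simp
      ultimately have "(l, k) \<in> E i"
        using D_far[OF k(1)] kn l unfolding graph_edges_def by simp
      then show "(k1, k) \<in> (E i)\<^sup>*" using Suc.IH lf l by (blast intro: rtrancl_into_rtrancl)
    qed
  qed
  then show ?thesis using k psi_range unfolding far_left_def by auto
qed

lemma n_large': "q3 + 2 * q2 + 5 \<le> real n / 2"
  using n_large unfolding q2_def q3_def .

lemma n_ge_2: "2 \<le> n"
proof -
  have "5 \<le> real n / 2" using n_large' delta_pos by linarith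
  then show ?thesis by linarith
qed

lemma far_component_left:
  assumes i: "i \<in> {1..n}" and X: "X \<in> far i" "X \<inter> left i \<noteq> {}"
  shows "X \<subseteq> left i"
proof -
  obtain k where k: "k \<in> X" "k \<in> left i" using X by auto
  show ?thesis
    using component_eq(1)[OF E_sym E_subset _ k(1), of i] X(1) reach_left[OF _ i k(2)]
    unfolding far_components_def by blast
qed

text \<open>The member at distance at least \<open>\<delta>3\<close> that makes \<open>X\<close> a
  far component lies in \<open>far_left i\<close> by \<open>far_reached\<close>, so the chain links
  it to the vertex of rank 1 and to all of \<open>far_left i\<close>. The vertices between
  \<open>far_left i\<close> and \<open>i\<close> may or may not belong to \<open>X\<close>.\<close>

lemma far_left_subset:
  assumes i: "i \<in> {1..n}" and X: "X \<in> far i" "X \<inter> left i \<noteq> {}" and k1: "k1 \<in> {1..n}" "\<psi> k1 = 1"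
  shows "far_left i \<subseteq> X" "k1 \<in> X"
proof -
  have XL: "X \<subseteq> left i" using far_component_left[OF assms(1-3)] .
  obtain k where k: "k \<in> X" "D i k \<ge> \<delta>3" using X unfolding far_components_def by auto
  have kn: "k \<in> {1..n}" "\<psi> k < \<psi> i" using XL k unfolding left_def by auto
  have "(\<delta>3 - \<omega>) / b \<le> real (\<psi> i) - real (\<psi> k)"
    using D_upper[OF i kn(1)] kn k(2) pos by (cases "i = k") (auto simp: field_simps)
  then have kf: "k \<in> far_left i" using kn far_reached unfolding q2_def far_left_def by auto
  have r: "(k1, k) \<in> (E i)\<^sup>*" by (rule chain_left[OF i k1 kf])
  have X_eq: "X = {y \<in> {1..n} - {i}. (k, y) \<in> (E i)\<^sup>*}"
    using component_eq(1)[OF E_sym E_subset _ k(1), of i] X unfolding far_components_def by blast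
  have "(k, k1) \<in> (E i)\<^sup>*" using sym_rtrancl[OF E_sym] r by (blast dest: symD)
  moreover have "k1 \<noteq> i" using kn k1 psi_range[OF kn(1)] by auto
  ultimately show "k1 \<in> X" unfolding X_eq using k1 by auto
  show "far_left i \<subseteq> X"
  proof
    fix l assume l: "l \<in> far_left i"
    then have "(k, l) \<in> (E i)\<^sup>*" using chain_left[OF i k1] \<open>(k, k1) \<in> (E i)\<^sup>*\<close>
      by (blast intro: rtrancl_trans)
    moreover have "l \<noteq> i" "l \<in> {1..n}" using l delta_pos unfolding far_left_def by auto
    ultimately show "l \<in> X" unfolding X_eq by auto
  qed
qed

text \<open>Both components contain the vertex of rank 1.\<close>

lemma far_left_unique:
  assumes i: "i \<in> {1..n}" and X: "X \<in> far i" "X \<inter> left i \<noteq> {}" and Y: "Y \<in> far i" "Y \<inter> left i \<noteq> {}"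
  shows "X = Y"
proof -
  obtain k1 where k1: "k1 \<in> {1..n}" "\<psi> k1 = 1" using psi_surj[of 1] n_ge_2 by auto
  have "k1 \<in> X" "k1 \<in> Y" using far_left_subset(2)[OF i _ _ k1] X Y by auto
  then show ?thesis
    using component_eq(1)[OF E_sym E_subset, of _ i k1] X Y unfolding far_components_def by blast
qed

text \<open>The component of the vertex of rank 1 qualifies. The gap from that vertex to
  \<open>i\<close> is \<open>\<psi> i - 1\<close>, which explains the \<open>+ 1\<close>.\<close>

lemma far_left_exists:
  assumes i: "i \<in> {1..n}" and far: "real (\<psi> i) \<ge> q3 + 1"
  shows "\<exists>X\<in>far i. X \<subseteq> left i"
proof -
  obtain k1 where k1: "k1 \<in> {1..n}" "\<psi> k1 = 1" using psi_surj[of 1] n_ge_2 by auto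
  have "k1 \<noteq> i" using far k1 delta_pos by auto
  have "a * q3 \<le> a * \<bar>real (\<psi> i) - real (\<psi> k1)\<bar>" using far k1 pos by simp
  moreover have "a * q3 = \<delta>3 + \<omega>" using pos by (simp add: q3_def)
  ultimately have D: "D i k1 \<ge> \<delta>3" using D_lower[OF i k1(1)] \<open>k1 \<noteq> i\<close> by linarith
  define X where "X = {y \<in> {1..n} - {i}. (k1, y) \<in> (E i)\<^sup>*}"
  have "X \<in> far i" "k1 \<in> X" using component_of[of k1 "{1..n} - {i}"] k1 \<open>k1 \<noteq> i\<close> D
    unfolding far_components_def X_def by auto
  moreover have "k1 \<in> left i" using k1 far delta_pos unfolding left_def by auto
  ultimately show ?thesis using far_component_left[OF i] by blast
qed

lemma card_far_left:
  assumes i: "i \<in> {1..n}"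
  shows "real (\<psi> i) - q2 - 1 \<le> real (card (far_left i))"
proof (cases "real (\<psi> i) - q2 - 1 \<le> 0")
  case False
  define m where "m = nat \<lfloor>real (\<psi> i) - q2\<rfloor>"
  have m: "real m \<le> real (\<psi> i) - q2" "real (\<psi> i) - q2 - 1 \<le> real m"
    using False unfolding m_def by linarith+
  have "{1..m} \<subseteq> \<psi> ` far_left i"
  proof
    fix x assume x: "x \<in> {1..m}"
    then have "real x \<le> real (\<psi> i) - q2" using m by auto
    moreover have "x \<le> n" using calculation psi_range[OF i] delta_pos by linarith
    ultimately show "x \<in> \<psi> ` far_left i"
      using psi_surj[of x] x unfolding far_left_def by force
  qed
  then have "card {1..m} \<le> card (\<psi> ` far_left i)"
    by (intro card_mono) (auto simp: far_left_def)
  also have "\<dots> \<le> card (far_left i)" by (intro card_image_le) (auto simp: far_left_def)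
  finally show ?thesis using m by simp
qed simp

lemma card_left_le:
  assumes i: "i \<in> {1..n}" and X: "X \<subseteq> left i" shows "card X \<le> \<psi> i - 1"
proof -
  have "card X \<le> card (left i)" using X by (intro card_mono) (auto simp: left_def)
  also have "\<dots> = card (\<psi> ` left i)"
    using psi_inj by (intro card_image[symmetric]) (auto simp: inj_on_def left_def)
  also have "\<dots> \<le> card {1..<\<psi> i}"
  proof (rule card_mono)
    show "\<psi> ` left i \<subseteq> {1..<\<psi> i}" using psi_range unfolding left_def by force
  qed simp
  finally show ?thesis by simp
qed

text \<open>All assumptions involve the ranks through their gaps only. Interpreting the locale at
  the reflected ranks turns every fact about left sides into one about right sides.\<close>

lemma reversed: "embedded_distance n (\<lambda>i. n + 1 - \<psi> i) D a b \<omega> \<delta>1 \<delta>2 \<delta>3"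
proof
  have "bij_betw (\<lambda>x. n + 1 - x) {1..n} {1..n}"
    by (rule bij_betw_byWitness[where f'="\<lambda>x. n + 1 - x"]) auto
  from bij_betw_trans[OF bij this] show "bij_betw (\<lambda>i. n + 1 - \<psi> i) {1..n} {1..n}"
    by (simp add: comp_def)
  fix i j assume ij: "i \<in> {1..n}" "j \<in> {1..n}" "i \<noteq> j"
  have *: "\<bar>real (n + 1 - \<psi> i) - real (n + 1 - \<psi> j)\<bar> = \<bar>real (\<psi> i) - real (\<psi> j)\<bar>"
    using psi_range[OF ij(1)] psi_range[OF ij(2)] by (simp add: of_nat_diff)
  show "a * \<bar>real (n + 1 - \<psi> i) - real (n + 1 - \<psi> j)\<bar> - \<omega> \<le> D i j"
    "D i j \<le> b * \<bar>real (n + 1 - \<psi> i) - real (n + 1 - \<psi> j)\<bar> + \<omega>"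
    unfolding * by (rule D_lower[OF ij] D_upper[OF ij])+
qed (rule D_sym pos steps_le edges_short far_reached \<delta>_mono n_large)+

end

section \<open>Both sides of an index, and a common orientation for all indices\<close>

context embedded_distance
begin

interpretation rev: embedded_distance n "\<lambda>i. n + 1 - \<psi> i" D a b \<omega> \<delta>1 \<delta>2 \<delta>3
  by (rule reversed)

lemma rev_left: "i \<in> {1..n} \<Longrightarrow> rev.left i = right i"
  unfolding rev.left_def right_def
proof (intro Collect_cong conj_cong refl)
  fix k assume "i \<in> {1..n}" "k \<in> {1..n}"
  then show "(n + 1 - \<psi> k < n + 1 - \<psi> i) = (\<psi> i < \<psi> k)"
    using psi_range[of i] psi_range[of k] by linarith
qed

lemma rev_far_left: "i \<in> {1..n} \<Longrightarrow> rev.far_left i = far_right i"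
  unfolding rev.far_left_def far_right_def
proof (intro Collect_cong conj_cong refl)
  fix k assume "i \<in> {1..n}" "k \<in> {1..n}"
  then show "(real (n + 1 - \<psi> k) + q2 \<le> real (n + 1 - \<psi> i)) = (real (\<psi> i) + q2 \<le> real (\<psi> k))"
    using psi_range[of i] psi_range[of k] by (simp add: of_nat_diff) linarith
qed

lemma far_component_sides:
  assumes i: "i \<in> {1..n}" and X: "X \<in> far i"
  shows "X \<noteq> {}" "X \<subseteq> left i \<or> X \<subseteq> right i" "X \<subseteq> {1..n}"
proof -
  obtain k where k: "k \<in> X" using X unfolding far_components_def by auto
  then show "X \<noteq> {}" by auto
  have Xc: "X \<in> components ({1..n} - {i}) (E i)" using X unfolding far_components_def by simp
  have "k \<in> {1..n} - {i}" using component_eq(2)[OF E_sym E_subset Xc k] .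
  then have "k \<in> left i \<or> k \<in> right i" using psi_inj[OF i, of k] unfolding left_def right_def by auto
  then show "X \<subseteq> left i \<or> X \<subseteq> right i"
    using far_component_left[OF i X] rev.far_component_left[OF i X] k unfolding rev_left[OF i] by blast
  then show "X \<subseteq> {1..n}" unfolding left_def right_def by auto
qed

lemma left_right_disjoint: "left i \<inter> right i = {}"
  by (auto simp: left_def right_def)

lemma far_nonempty: "i \<in> {1..n} \<Longrightarrow> far i \<noteq> {}"
proof -
  assume i: "i \<in> {1..n}"
  have "2 * (q3 + 1) \<le> real n + 1" using n_large' delta_pos(3) by (simp add: field_simps)
  then have "real (\<psi> i) \<ge> q3 + 1 \<or> real (n + 1 - \<psi> i) \<ge> q3 + 1"
    using psi_range[OF i] by (simp add: of_nat_diff) linarith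
  then show ?thesis using far_left_exists[OF i] rev.far_left_exists[OF i] by auto
qed

text \<open>Each side of \<open>i\<close> carries at most one far component, so \<open>X\<close> and
  \<open>Y\<close> exhaust \<open>far i\<close>. Sizes merely decide which of the two is called the
  largest.\<close>

lemma far_cases:
  assumes i: "i \<in> {1..n}"
    and G: "is_largest (far i) X" and G': "is_largest (far i - {X}) Y"
  shows "X \<in> far i"
    and "Y = {} \<Longrightarrow> far i = {X}"
    and "Y \<noteq> {} \<Longrightarrow> Y \<in> far i \<and> (X \<subseteq> left i \<and> Y \<subseteq> right i \<or> X \<subseteq> right i \<and> Y \<subseteq> left i)"
proof -
  show X: "X \<in> far i" using is_largest_mem[OF G far_nonempty[OF i]] .
  have Y: "Y \<in> far i" "Y \<noteq> X" if "far i - {X} \<noteq> {}"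
    using is_largest_mem[OF G' that] by auto
  show "far i = {X}" if "Y = {}"
    using far_component_sides(1)[OF i, of Y] Y that X by blast
  assume ne: "Y \<noteq> {}"
  then have "far i - {X} \<noteq> {}" using G' is_largest_empty by metis
  note Y = Y[OF this]
  have "\<not> (X \<subseteq> left i \<and> Y \<subseteq> left i)"
    using far_left_unique[OF i X _ Y(1)] Y(2) ne far_component_sides(1)[OF i X] by blast
  moreover have "\<not> (X \<subseteq> right i \<and> Y \<subseteq> right i)"
    using rev.far_left_unique[OF i X _ Y(1)] Y(2) ne far_component_sides(1)[OF i X]
    unfolding rev_left[OF i] by blast
  ultimately show "Y \<in> far i \<and> (X \<subseteq> left i \<and> Y \<subseteq> right i \<or> X \<subseteq> right i \<and> Y \<subseteq> left i)"
    using Y(1) far_component_sides(2)[OF i] X by blast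
qed

text \<open>The reference index maximises the smaller of the two sizes, so it inherits this bound.
  Since a component fits into its side, the reference index is then well away from both ends, which
  the orientation rule relies on.\<close>

lemma min_card_middle:
  assumes i: "i \<in> {1..n}" "\<psi> i = n div 2 + 1"
    and G: "is_largest (far i) X" and G': "is_largest (far i - {X}) Y"
  shows "q3 + q2 + 2 \<le> real (min (card X) (card Y))"
proof -
  have n2: "real n / 2 - 1 \<le> real (n div 2)" "real (n div 2) \<le> real n / 2" by linarith+
  have *: "real (\<psi> i) \<ge> q3 + 1" "real (n + 1 - \<psi> i) \<ge> q3 + 1"
    using n_large' delta_pos(3) n2 i psi_range[OF i(1)] by (simp_all add: of_nat_diff)
  obtain U where U: "U \<in> far i" "U \<subseteq> left i" using far_left_exists[OF i(1)] * by blast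
  obtain W where W: "W \<in> far i" "W \<subseteq> right i"
    using rev.far_left_exists[OF i(1)] * unfolding rev_left[OF i(1)] by blast
  have ne: "U \<noteq> {}" "W \<noteq> {}" using far_component_sides(1)[OF i(1)] U W by auto
  then have "U \<noteq> W" using U W left_right_disjoint[of i] by blast
  then have Y: "Y \<noteq> {}" using far_cases(2)[OF i(1) G G'] U W by blast
  note XY = far_cases(1)[OF i(1) G G'] conjunct1[OF far_cases(3)[OF i(1) G G' Y]]
  have card: "q3 + q2 + 2 \<le> real (card Z)" if Z: "Z \<in> far i" for Z
  proof -
    obtain k1 where k1: "k1 \<in> {1..n}" "\<psi> k1 = 1" using psi_surj[of 1] n_ge_2 by auto
    obtain kn where kn: "kn \<in> {1..n}" "\<psi> kn = n" using psi_surj[of n] n_ge_2 by auto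
    have ZV: "Z \<subseteq> {1..n}" "Z \<noteq> {}" using far_component_sides[OF i(1) Z] by auto
    consider "Z \<inter> left i \<noteq> {}" | "Z \<inter> right i \<noteq> {}"
      using far_component_sides(2)[OF i(1) Z] ZV by blast
    then show ?thesis
    proof cases
      case 1
      then have "far_left i \<subseteq> Z" using far_left_subset(1)[OF i(1) Z _ k1] by blast
      then have "card (far_left i) \<le> card Z" using ZV finite_subset by (intro card_mono) auto
      moreover have "q3 + q2 + 2 \<le> real (\<psi> i) - q2 - 1"
        using n_large' n2 i by simp
      ultimately show ?thesis using card_far_left[OF i(1)] by linarith
    next
      case 2
      have kn': "n + 1 - \<psi> kn = 1" using kn by simp
      have "far_right i \<subseteq> Z"
        using rev.far_left_subset(1)[OF i(1) Z _ kn(1) kn'] 2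
        unfolding rev_left[OF i(1)] rev_far_left[OF i(1)] by blast
      then have "card (far_right i) \<le> card Z" using ZV finite_subset by (intro card_mono) auto
      moreover have "real (n + 1 - \<psi> i) - q2 - 1 \<le> real (card (far_right i))"
        using rev.card_far_left[OF i(1)] unfolding rev_far_left[OF i(1)] .
      moreover have "q3 + q2 + 2 \<le> real (n + 1 - \<psi> i) - q2 - 1"
        using n_large' n2 i psi_range[OF i(1)] by (simp add: of_nat_diff)
      ultimately show ?thesis by linarith
    qed
  qed
  show ?thesis using card[OF XY(1)] card[OF XY(2)] by simp
qed

text \<open>Once \<open>G c\<close> is the left component of \<open>c\<close>, the rule places every
  \<open>L\<close> on the left and every \<open>R\<close> on the right of its index. A set on the
  correct side can only produce correct signs, and since \<open>L\<close> and \<open>R\<close>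
  contain the far regions whenever the respective side is long enough, every pair with a large gap
  is decided.\<close>

lemma oriented_comparison:
  assumes G: "\<And>i. i \<in> {1..n} \<Longrightarrow> is_largest (far i) (G i)"
    and G': "\<And>i. i \<in> {1..n} \<Longrightarrow> is_largest (far i - {G i}) (G' i)"
    and c: "c \<in> {1..n}" "q3 + q2 + 2 \<le> real (min (card (G c)) (card (G' c)))"
    and left_c: "G c \<subseteq> left c"
  defines "H \<equiv> first_comparison (\<lambda>k. fst (orientation G G' c k)) (\<lambda>k. snd (orientation G G' c k))"
  assumes i: "i \<in> {1..n}" and j: "j \<in> {1..n}"
  shows "H i j = 0 \<or> H i j = sgn (real (\<psi> i) - real (\<psi> j))"
    and "\<bar>real (\<psi> i) - real (\<psi> j)\<bar> \<ge> q3 + 1 \<Longrightarrow> H i j \<noteq> 0"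
    and "H i j = 0 \<longleftrightarrow> H j i = 0"
proof -
  obtain k1 where k1: "k1 \<in> {1..n}" "\<psi> k1 = 1" using psi_surj[of 1] n_ge_2 by auto
  obtain kn where kn: "kn \<in> {1..n}" "\<psi> kn = n" using psi_surj[of n] n_ge_2 by auto
  have kn': "n + 1 - \<psi> kn = 1" using kn by simp
  have leftD: "far_left k \<subseteq> X \<and> k1 \<in> X" if "k \<in> {1..n}" "X \<in> far k" "X \<subseteq> left k" for k X
    using far_left_subset[OF that(1,2) _ k1] that far_component_sides(1)[OF that(1,2)] by blast
  have rightD: "far_right k \<subseteq> X \<and> kn \<in> X" if "k \<in> {1..n}" "X \<in> far k" "X \<subseteq> right k" for k X
    using rev.far_left_subset[OF that(1,2) _ kn(1) kn'] that far_component_sides(1)[OF that(1,2)]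
    unfolding rev_left[OF that(1)] rev_far_left[OF that(1)] by blast
  have G'c: "G' c \<noteq> {}" using c delta_pos by auto
  note cc = far_cases[OF c(1) G[OF c(1)] G'[OF c(1)]]
  have c_far: "G c \<in> far c" "G' c \<in> far c" using cc G'c by auto
  have right_c: "G' c \<subseteq> right c"
    using cc(3)[OF G'c] left_c far_component_sides(1)[OF c(1) c_far(1)] left_right_disjoint[of c] by blast
  have psi_c: "q3 + q2 + 2 \<le> real (\<psi> c)" "q3 + q2 + 2 \<le> real (n + 1 - \<psi> c)"
    using card_left_le[OF c(1) left_c] rev.card_left_le[OF c(1), unfolded rev_left[OF c(1)], OF right_c] c(2)
    by linarith+
  define lr where "lr k = orientation G G' c k" for k
  have lr: "fst (lr k) \<subseteq> left k" "snd (lr k) \<subseteq> right k"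
    "real (\<psi> k) \<ge> q3 + 1 \<Longrightarrow> far_left k \<subseteq> fst (lr k)"
    "real (n + 1 - \<psi> k) \<ge> q3 + 1 \<Longrightarrow> far_right k \<subseteq> snd (lr k)"
    "lr k \<noteq> ({}, {})" if k: "k \<in> {1..n}" for k
  proof -
    note kk = far_cases[OF k G[OF k] G'[OF k]]
    note ne = far_component_sides(1)[OF k]
    have ex_l: "\<exists>X\<in>far k. X \<subseteq> left k" if "real (\<psi> k) \<ge> q3 + 1"
      using far_left_exists[OF k that] .
    have ex_r: "\<exists>X\<in>far k. X \<subseteq> right k" if "real (n + 1 - \<psi> k) \<ge> q3 + 1"
      using rev.far_left_exists[OF k that] unfolding rev_left[OF k] .
    have two: "fst (lr k) \<subseteq> left k \<and> snd (lr k) \<subseteq> right k \<and> far_left k \<subseteq> fst (lr k)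
        \<and> far_right k \<subseteq> snd (lr k) \<and> lr k \<noteq> ({}, {})"
      if "lr k = (X, Y)" "X \<in> far k" "Y \<in> far k" "X \<subseteq> left k" "Y \<subseteq> right k" for X Y
      using that leftD[OF k that(2,4)] rightD[OF k that(3,5)] by auto
    have "fst (lr k) \<subseteq> left k \<and> snd (lr k) \<subseteq> right k
      \<and> (real (\<psi> k) \<ge> q3 + 1 \<longrightarrow> far_left k \<subseteq> fst (lr k))
      \<and> (real (n + 1 - \<psi> k) \<ge> q3 + 1 \<longrightarrow> far_right k \<subseteq> snd (lr k)) \<and> lr k \<noteq> ({}, {})"
    proof (cases "k = c")
      case True
      then have "lr k = (G c, G' c)" unfolding lr_def orientation_def by simp
      then show ?thesis using two[of "G c" "G' c"] c_far left_c right_c True by simp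
    next
      case kc: False
      show ?thesis
      proof (cases "G' k = {}")
        case True
        note single = kk(2)[OF True]
        show ?thesis
        proof (cases "k \<in> G c")
          case kGc: True
          then have lrk: "lr k = ({}, G k)" using kc True unfolding lr_def orientation_def by simp
          \<comment> \<open>Left of \<open>c\<close>, which is far from the right end,
            \<open>k\<close> has enough room on its right for a far component there; being the only
            one, it is \<open>G k\<close>.\<close>
          have "\<psi> k < \<psi> c" using kGc left_c unfolding left_def by auto
          then have "real (n + 1 - \<psi> k) \<ge> q3 + 1"
            using psi_c delta_pos by linarith
          then have Gk: "G k \<subseteq> right k" using ex_r single by auto
          have "\<not> real (\<psi> k) \<ge> q3 + 1"
            using ex_l single Gk ne[OF kk(1)] left_right_disjoint[of k] by blast
          then show ?thesis using lrk Gk rightD[OF k kk(1) Gk] ne[OF kk(1)] by auto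
        next
          case kGc: False
          then have lrk: "lr k = (G k, {})" using kc True unfolding lr_def orientation_def by simp
          \<comment> \<open>Outside \<open>far_left c\<close> the rank of \<open>k\<close> exceeds
            \<open>\<psi> c - q2\<close>, so \<open>k\<close> has enough room on its left and its
            only far component lies there.\<close>
          have "k \<notin> far_left c" using leftD[OF c(1) c_far(1) left_c] kGc by auto
          then have "real (\<psi> k) \<ge> q3 + 1"
            using psi_c k unfolding far_left_def by auto
          then have Gk: "G k \<subseteq> left k" using ex_l single by auto
          have "\<not> real (n + 1 - \<psi> k) \<ge> q3 + 1"
            using ex_r single Gk ne[OF kk(1)] left_right_disjoint[of k] by blast
          then show ?thesis using lrk Gk leftD[OF k kk(1) Gk] ne[OF kk(1)] by auto
        qed
      next
        case False
        note both = kk(3)[OF False]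
        show ?thesis
        proof (cases "G k \<subseteq> left k \<and> G' k \<subseteq> right k")
          case True
          \<comment> \<open>The two extreme vertices belong to the corresponding components of both
            \<open>k\<close> and \<open>c\<close>, so neither intersection tested by the rule is
            empty.\<close>
          then have "k1 \<in> G k" "kn \<in> G' k" using leftD[OF k kk(1)] rightD[OF k] both by auto
          moreover have "k1 \<in> G c" "kn \<in> G' c"
            using leftD[OF c(1) c_far(1) left_c] rightD[OF c(1) c_far(2) right_c] by auto
          ultimately have "lr k = (G k, G' k)"
            using kc False unfolding lr_def orientation_def by auto
          then show ?thesis using two[of "G k" "G' k"] both kk(1) True by simp
        next
          case nT: False
          then have sw: "G k \<subseteq> right k" "G' k \<subseteq> left k" using both by auto
          \<comment> \<open>\<open>G k\<close> lies right of \<open>k\<close> and \<open>G c\<close>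
            left of \<open>c\<close>, so they are disjoint unless \<open>k\<close> is left of
            \<open>c\<close>; in that case the other two sets are.\<close>
          have "G k \<inter> G c = {} \<or> G' k \<inter> G' c = {}"
          proof (cases "\<psi> c \<le> \<psi> k")
            case True
            then have "right k \<inter> left c = {}" unfolding right_def left_def by auto
            then show ?thesis using sw left_c by blast
          next
            case False
            then have "left k \<inter> right c = {}" unfolding right_def left_def by auto
            then show ?thesis using sw right_c by blast
          qed
          then have "lr k = (G' k, G k)"
            using kc False unfolding lr_def orientation_def by auto
          then show ?thesis using two[of "G' k" "G k"] both kk(1) sw by simp
        qed
      qed
    qed
    then show "fst (lr k) \<subseteq> left k" "snd (lr k) \<subseteq> right k"
      "real (\<psi> k) \<ge> q3 + 1 \<Longrightarrow> far_left k \<subseteq> fst (lr k)"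
      "real (n + 1 - \<psi> k) \<ge> q3 + 1 \<Longrightarrow> far_right k \<subseteq> snd (lr k)"
      "lr k \<noteq> ({}, {})" by blast+
  qed
  \<comment> \<open>The default 0 for an empty pair never applies, by \<open>lr(5)\<close>. What
    remains is antisymmetric in its conditions, which makes the zero pattern symmetric.\<close>
  have H: "H i j = (if i = j then 0 else if i \<in> fst (lr j) \<or> j \<in> snd (lr i) then -1
      else if i \<in> snd (lr j) \<or> j \<in> fst (lr i) then 1 else 0)" if "i \<in> {1..n}" for i j
  proof -
    have "(fst (orientation G G' c i), snd (orientation G G' c i)) \<noteq> ({}, {})"
      using lr(5)[OF that] unfolding lr_def by simp
    then show ?thesis unfolding H_def first_comparison_def lr_def by simp
  qed
  have sL: "\<psi> k < \<psi> l" if "k \<in> fst (lr l)" "l \<in> {1..n}" for k l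
    using that lr(1) unfolding left_def by auto
  have sR: "\<psi> l < \<psi> k" if "k \<in> snd (lr l)" "l \<in> {1..n}" for k l
    using that lr(2) unfolding right_def by auto
  show "H i j = 0 \<or> H i j = sgn (real (\<psi> i) - real (\<psi> j))"
    unfolding H[OF i] using sL[of i j] sL[of j i] sR[of i j] sR[of j i] i j by (auto simp: sgn_if)
  show "H i j = 0 \<longleftrightarrow> H j i = 0"
    unfolding H[OF i] H[OF j] by auto
  assume d: "\<bar>real (\<psi> i) - real (\<psi> j)\<bar> \<ge> q3 + 1"
  have *: "i \<in> fst (lr j)" if "real (\<psi> i) + (q3 + 1) \<le> real (\<psi> j)" "i \<in> {1..n}" "j \<in> {1..n}" for i j
  proof -
    have "i \<in> far_left j" using that delta_pos unfolding far_left_def by auto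
    then show ?thesis using lr(3)[OF that(3)] that(1) by (meson le_add_same_cancel2 of_nat_0_le_iff order_trans subsetD)
  qed
  have "i \<noteq> j" using d delta_pos by auto
  moreover have "i \<in> fst (lr j) \<or> j \<in> fst (lr i)" using *[of i j] *[of j i] d i j by argo
  ultimately show "H i j \<noteq> 0" unfolding H[OF i] by auto
qed

end

context embedded_distance
begin

interpretation rev: embedded_distance n "\<lambda>i. n + 1 - \<psi> i" D a b \<omega> \<delta>1 \<delta>2 \<delta>3
  by (rule reversed)

text \<open>Distances determine the order only up to reflection. The name given to the two
  components of the reference index selects the order that is recovered; if \<open>G c\<close> is
  the right component, the argument is run at the reflected ranks.\<close>

lemma first_seriation_correct:
  assumes "first_seriation n D \<delta>1 \<delta>2 \<delta>3 H"
  shows "\<exists>\<phi>\<in>{\<psi>, \<lambda>i. n + 1 - \<psi> i}. \<forall>i\<in>{1..n}. \<forall>j\<in>{1..n}.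
    (H i j = 0 \<or> H i j = sgn (real (\<phi> i) - real (\<phi> j))) \<and>
    (\<bar>real (\<phi> i) - real (\<phi> j)\<bar> \<ge> (\<delta>3 + \<omega>) / a + 1 \<longrightarrow> H i j \<noteq> 0) \<and>
    (H i j = 0 \<longleftrightarrow> H j i = 0)"
proof -
  define Q where "Q G G' c \<longleftrightarrow>
    (\<forall>i\<in>{1..n}. is_largest (far i) (G i) \<and> is_largest (far i - {G i}) (G' i)) \<and>
      is_arg_max (\<lambda>i. min (card (G i)) (card (G' i))) (\<lambda>i. i \<in> {1..n}) c \<and>
      (\<forall>i\<in>{1..n}. \<forall>j\<in>{1..n}. H i j = first_comparison (\<lambda>k. fst (orientation G G' c k))
                                    (\<lambda>k. snd (orientation G G' c k)) i j)" for G G' c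
  have "\<exists>G G' c. Q G G' c" using assms unfolding first_seriation_def Q_def .
  then obtain G G' c where "Q G G' c" by blast
  note * = this[unfolded Q_def]
  have G: "is_largest (far i) (G i)" and G': "is_largest (far i - {G i}) (G' i)"
    if "i \<in> {1..n}" for i using * that by simp_all
  have c: "is_arg_max (\<lambda>i. min (card (G i)) (card (G' i))) (\<lambda>i. i \<in> {1..n}) c"
    using * by (elim conjE)
  have H: "H i j = first_comparison (\<lambda>k. fst (orientation G G' c k))
                                    (\<lambda>k. snd (orientation G G' c k)) i j"
    if "i \<in> {1..n}" "j \<in> {1..n}" for i j using * that by simp
  have cn: "c \<in> {1..n}" using c by (simp add: is_arg_max_def)
  obtain m where m: "m \<in> {1..n}" "\<psi> m = n div 2 + 1"
  proof -
    have "n div 2 + 1 \<le> n" using n_ge_2 by presburger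
    then show ?thesis using psi_surj[of "n div 2 + 1"] that by auto
  qed
  have "min (card (G m)) (card (G' m)) \<le> min (card (G c)) (card (G' c))"
    using c m(1) unfolding is_arg_max_def by (meson not_le_imp_less)
  then have cc: "q3 + q2 + 2 \<le> real (min (card (G c)) (card (G' c)))"
    using min_card_middle[OF m G G'] m(1) by linarith
  consider "G c \<subseteq> left c" | "G c \<subseteq> right c"
    using far_component_sides(2)[OF cn far_cases(1)[OF cn G[OF cn] G'[OF cn]]] by blast
  then show ?thesis
  proof cases
    case 1
    show ?thesis
      using oriented_comparison[OF G G' cn cc 1] H unfolding q3_def by (intro bexI[of _ \<psi>]) auto
  next
    case 2
    then have "G c \<subseteq> rev.left c" unfolding rev_left[OF cn] .
    from rev.oriented_comparison[OF G G' cn cc this] H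
    show ?thesis unfolding q3_def by (intro bexI[of _ "\<lambda>i. n + 1 - \<psi> i"]) auto
  qed
qed

end

section \<open>Kendall's tau\<close>

text \<open>There are \<open>x - 1\<close> smaller and \<open>n - x\<close> larger ranks. Hence the
  affine map in the output returns the exact rank when applied to a row sum of the exact comparison
  matrix.\<close>

lemma sum_sgn_rank:
  assumes "x \<in> {1..n}"
  shows "(\<Sum>y\<in>{1..n}. sgn (real x - real y)) = 2 * real x - real n - 1"
proof -
  have "{1..n} = {1..<x} \<union> {x} \<union> {x<..n}" using assms by auto
  then have "(\<Sum>y\<in>{1..n}. sgn (real x - real y)) =
      (\<Sum>y\<in>{1..<x} \<union> {x} \<union> {x<..n}. sgn (real x - real y))" by simp
  also have "\<dots> = (\<Sum>y\<in>{1..<x}. sgn (real x - real y)) + sgn (real x - real x)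
      + (\<Sum>y\<in>{x<..n}. sgn (real x - real y))"
  proof -
    have "({1..<x} \<union> {x}) \<inter> {x<..n} = {}" "{1..<x} \<inter> {x} = {}" by auto
    then show ?thesis by (simp add: sum.union_disjoint)
  qed
  also have "(\<Sum>y\<in>{1..<x}. sgn (real x - real y)) = (\<Sum>y\<in>{1..<x}. 1)"
    by (intro sum.cong) auto
  also have "(\<Sum>y\<in>{x<..n}. sgn (real x - real y)) = (\<Sum>y\<in>{x<..n}. -1)"
    by (intro sum.cong) auto
  finally show ?thesis using assms by (simp add: of_nat_diff)
qed

context
  fixes n :: nat and \<psi> :: "nat \<Rightarrow> nat"
  assumes bij: "bij_betw \<psi> {1..n} {1..n}"
begin

lemma card_above:
  assumes "0 \<le> B"
  shows "real (card {j \<in> {1..n}. x < \<psi> j \<and> real (\<psi> j) - real x \<le> B}) \<le> B"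
proof -
  let ?J = "{j \<in> {1..n}. x < \<psi> j \<and> real (\<psi> j) - real x \<le> B}"
  have "card ?J = card (\<psi> ` ?J)"
    using bij_betw_imp_inj_on[OF bij] by (intro card_image[symmetric]) (rule inj_on_subset, auto)
  also have "\<dots> \<le> card {x<..x + nat \<lfloor>B\<rfloor>}"
  proof (intro card_mono subsetI)
    fix y assume "y \<in> \<psi> ` ?J"
    then show "y \<in> {x<..x + nat \<lfloor>B\<rfloor>}" using assms by (auto, linarith)
  qed simp
  finally show ?thesis using assms by simp linarith
qed

lemma card_below:
  assumes "0 \<le> B"
  shows "real (card {j \<in> {1..n}. \<psi> j < x \<and> real x - real (\<psi> j) \<le> B}) \<le> B"
proof -
  let ?J = "{j \<in> {1..n}. \<psi> j < x \<and> real x - real (\<psi> j) \<le> B}"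
  have "card ?J = card (\<psi> ` ?J)"
    using bij_betw_imp_inj_on[OF bij] by (intro card_image[symmetric]) (rule inj_on_subset, auto)
  also have "\<dots> \<le> card {x - nat \<lfloor>B\<rfloor>..<x}"
  proof (intro card_mono subsetI)
    fix y assume "y \<in> \<psi> ` ?J"
    then show "y \<in> {x - nat \<lfloor>B\<rfloor>..<x}" using assms by (auto, linarith)
  qed simp
  finally show ?thesis using assms by simp linarith
qed

text \<open>Undecided ranks above \<open>\<psi> i\<close> raise the row sum and those below lower
  it, at most \<open>B\<close> of each kind. The two effects have opposite signs, so the row sum is
  off by at most \<open>B\<close> rather than \<open>2 * B\<close>, and the estimate by
  \<open>B / 2\<close>. An inverted pair therefore has gap at most \<open>B\<close>.\<close>

lemma kendall_tau_le:
  fixes K :: "nat \<Rightarrow> nat \<Rightarrow> real"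
  assumes B: "0 \<le> B"
    and K: "\<And>i j. i \<in> {1..n} \<Longrightarrow> j \<in> {1..n} \<Longrightarrow> K i j = 0 \<or> K i j = sgn (real (\<psi> i) - real (\<psi> j))"
    and K0: "\<And>i j. i \<in> {1..n} \<Longrightarrow> j \<in> {1..n} \<Longrightarrow> K i j = 0 \<Longrightarrow> \<bar>real (\<psi> i) - real (\<psi> j)\<bar> \<le> B"
    and p: "\<And>i. i \<in> {1..n} \<Longrightarrow> p i = ((\<Sum>j\<in>{1..n}. K i j) + real n + 1) / 2"
  shows "kendall_tau n p (\<lambda>i. real (\<psi> i)) \<le> B"
proof -
  have range: "\<psi> i \<in> {1..n}" if "i \<in> {1..n}" for i using bij_betwE[OF bij] that by blast
  have inj: "i = j" if "\<psi> i = \<psi> j" "i \<in> {1..n}" "j \<in> {1..n}" for i j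
    using inj_onD[OF bij_betw_imp_inj_on[OF bij]] that by blast
  have close: "\<bar>p i - real (\<psi> i)\<bar> \<le> B / 2" if i: "i \<in> {1..n}" for i
  proof -
    have "(\<Sum>j\<in>{1..n}. sgn (real (\<psi> i) - real (\<psi> j))) = (\<Sum>y\<in>{1..n}. sgn (real (\<psi> i) - real y))"
      by (rule sum.reindex_bij_betw[OF bij])
    also have "\<dots> = 2 * real (\<psi> i) - real n - 1" by (rule sum_sgn_rank[OF range[OF i]])
    finally have "2 * (p i - real (\<psi> i)) = (\<Sum>j\<in>{1..n}. K i j - sgn (real (\<psi> i) - real (\<psi> j)))"
      unfolding p[OF i] by (simp add: sum_subtractf)
    moreover have "(\<Sum>j\<in>{1..n}. K i j - sgn (real (\<psi> i) - real (\<psi> j)))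
        \<le> (\<Sum>j\<in>{1..n}. of_bool (\<psi> i < \<psi> j \<and> real (\<psi> j) - real (\<psi> i) \<le> B))"
    proof (intro sum_mono)
      fix j assume "j \<in> {1..n}"
      then show "K i j - sgn (real (\<psi> i) - real (\<psi> j)) \<le> of_bool (\<psi> i < \<psi> j \<and> real (\<psi> j) - real (\<psi> i) \<le> B)"
        using K[OF i, of j] K0[OF i, of j] by (cases "K i j = 0") (auto simp: sgn_if)
    qed
    moreover have "\<dots> = real (card {j \<in> {1..n}. \<psi> i < \<psi> j \<and> real (\<psi> j) - real (\<psi> i) \<le> B})"
      by (simp add: of_bool_def sum.If_cases Int_def)
    moreover have "(\<Sum>j\<in>{1..n}. K i j - sgn (real (\<psi> i) - real (\<psi> j)))
        \<ge> (\<Sum>j\<in>{1..n}. - of_bool (\<psi> j < \<psi> i \<and> real (\<psi> i) - real (\<psi> j) \<le> B))"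
    proof (intro sum_mono)
      fix j assume "j \<in> {1..n}"
      then show "K i j - sgn (real (\<psi> i) - real (\<psi> j)) \<ge> - of_bool (\<psi> j < \<psi> i \<and> real (\<psi> i) - real (\<psi> j) \<le> B)"
        using K[OF i, of j] K0[OF i, of j] by (cases "K i j = 0") (auto simp: sgn_if)
    qed
    moreover have "(\<Sum>j\<in>{1..n}. - of_bool (\<psi> j < \<psi> i \<and> real (\<psi> i) - real (\<psi> j) \<le> B))
        = - real (card {j \<in> {1..n}. \<psi> j < \<psi> i \<and> real (\<psi> i) - real (\<psi> j) \<le> B})"
      by (simp add: of_bool_def sum.If_cases Int_def sum_negf)
    ultimately have "2 * (p i - real (\<psi> i)) \<le> B" "- B \<le> 2 * (p i - real (\<psi> i))"
      using card_above[OF B, of "\<psi> i"] card_below[OF B, of "\<psi> i"] by linarith+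
    then show ?thesis by (intro abs_leI) simp_all
  qed
  define Q where "Q = {(i, j). 1 \<le> i \<and> i < j \<and> j \<le> n}"
  define Z where "Z = {(i, j) \<in> Q. sgn (real (\<psi> i) - real (\<psi> j)) * sgn (p i - p j) < 0}"
  have Qsub: "Q \<subseteq> {1..n} \<times> {1..n}" by (auto simp: Q_def)
  then have finQ: "finite Q" by (rule finite_subset) simp
  have "(\<Sum>(i, j)\<in>Q. of_bool (sgn (real (\<psi> i) - real (\<psi> j)) * sgn (p i - p j) < 0)) = real (card Z)"
    using finQ unfolding Z_def
    by (simp add: of_bool_def sum.If_cases Int_def case_prod_unfold)
  then have tau: "kendall_tau n p (\<lambda>i. real (\<psi> i)) = real (card Z) / real n"
    unfolding kendall_tau_def Q_def[symmetric] by simp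
  \<comment> \<open>Inverted pairs are counted by smaller rank and gap. This code determines the
    unordered pair of ranks, and \<open>i < j\<close> then fixes the pair; the gap takes at most
    \<open>B\<close> values, and the factor \<open>n\<close> is removed by the
    normalisation.\<close>
  define g where "g = (\<lambda>(i, j). (min (\<psi> i) (\<psi> j), nat \<bar>int (\<psi> i) - int (\<psi> j)\<bar>))"
  have inj_g: "inj_on g Z"
  proof (rule inj_onI)
    fix z z' assume z: "z \<in> Z" "z' \<in> Z" and eq: "g z = g z'"
    obtain i j i' j' where ij: "z = (i, j)" "z' = (i', j')" by fastforce
    have r: "i \<in> {1..n}" "j \<in> {1..n}" "i' \<in> {1..n}" "j' \<in> {1..n}" "i < j" "i' < j'"
      using z ij by (auto simp: Z_def Q_def)
    have "\<psi> i = \<psi> i' \<and> \<psi> j = \<psi> j' \<or> \<psi> i = \<psi> j' \<and> \<psi> j = \<psi> i'"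
      using eq ij unfolding g_def by (auto simp: min_def split: if_splits)
    then show "z = z'" using inj[of i i'] inj[of j j'] inj[of i j'] inj[of j i'] r ij by auto
  qed
  have "g ` Z \<subseteq> {1..n} \<times> {1..nat \<lfloor>B\<rfloor>}"
  proof
    fix y assume "y \<in> g ` Z"
    then obtain i j where ij: "(i, j) \<in> Z" "y = g (i, j)" by auto
    have r: "i \<in> {1..n}" "j \<in> {1..n}" "i \<noteq> j" using ij by (auto simp: Z_def Q_def)
    have "sgn (real (\<psi> i) - real (\<psi> j)) * sgn (p i - p j) < 0" using ij by (simp add: Z_def)
    then have "(\<psi> i < \<psi> j \<and> p j < p i) \<or> (\<psi> j < \<psi> i \<and> p i < p j)"
      by (auto simp: sgn_if split: if_splits)
    then have "real (\<psi> i) < real (\<psi> j) \<and> p j < p i \<or> real (\<psi> j) < real (\<psi> i) \<and> p i < p j" by simp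
    then have "\<bar>real (\<psi> i) - real (\<psi> j)\<bar> \<le> B"
      using close[OF r(1)] close[OF r(2)] unfolding abs_le_iff by (elim disjE conjE) (simp_all add: field_simps)
    then have "nat \<bar>int (\<psi> i) - int (\<psi> j)\<bar> \<le> nat \<lfloor>B\<rfloor>" by linarith
    moreover have "nat \<bar>int (\<psi> i) - int (\<psi> j)\<bar> \<ge> 1" using inj[OF _ r(1,2)] r(3) by linarith
    moreover have "min (\<psi> i) (\<psi> j) \<in> {1..n}" using range[OF r(1)] range[OF r(2)] by (auto simp: min_def)
    ultimately show "y \<in> {1..n} \<times> {1..nat \<lfloor>B\<rfloor>}" using ij unfolding g_def by simp
  qed
  then have "card (g ` Z) \<le> card ({1..n} \<times> {1..nat \<lfloor>B\<rfloor>})" by (intro card_mono) auto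
  then have "card Z \<le> n * nat \<lfloor>B\<rfloor>" using card_image[OF inj_g] by simp
  then have "real (card Z) \<le> real n * real (nat \<lfloor>B\<rfloor>)" by (metis of_nat_le_iff of_nat_mult)
  also have "\<dots> \<le> real n * B" using B by (intro mult_left_mono) linarith+
  finally show ?thesis unfolding tau using B by (cases "n = 0") (auto simp: field_simps)
qed

end

lemma kendall_loss_le:
  assumes "bij_betw \<pi> {1..n} {1..n}" "\<psi> \<in> {\<pi>, \<lambda>i. n + 1 - \<pi> i}"
    and "kendall_tau n p (\<lambda>i. real (\<psi> i)) \<le> B"
  shows "kendall_loss n p \<pi> \<le> B"
proof (cases "\<psi> = \<pi>")
  case False
  then have \<psi>: "\<psi> = (\<lambda>i. n + 1 - \<pi> i)" using assms(2) by auto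
  have *: "real (\<psi> i) = real n + 1 - real (\<pi> i)" if "i \<in> {1..n}" for i
  proof -
    have "\<pi> i \<le> n" using bij_betwE[OF assms(1)] that by auto
    then show ?thesis unfolding \<psi> by (simp add: of_nat_diff)
  qed
  have "kendall_tau n p (\<lambda>i. real n + 1 - real (\<pi> i)) = kendall_tau n p (\<lambda>i. real (\<psi> i))"
    unfolding kendall_tau_def
    by (intro arg_cong[where f="\<lambda>x. 1 / real n * x"] sum.cong refl) (auto simp: *)
  then show ?thesis using assms(3) by (simp add: kendall_loss_def)
qed (use assms in \<open>simp add: kendall_loss_def\<close>)

section \<open>Refined comparisons\<close>

text \<open>The column sets are symmetric in the two indices and the row differences change sign.
  This allows the pair to be ordered by rank although the algorithm orders it by index, but it
  leaves the proxy unchanged.\<close>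

lemma refined_comparison_swap:
  "refined_comparison n tie A \<sigma> \<delta>4 H T p j i = - refined_comparison n tie A \<sigma> \<delta>4 H T p i j"
proof -
  have "(\<Sum>k\<in>X. A j k - A i k) = - (\<Sum>k\<in>X. A i k - A j k)" for X
    by (simp add: sum_subtractf)
  then show ?thesis unfolding refined_comparison_def Let_def
    by (simp add: sgn_minus conj_commute)
qed

text \<open>By monotonicity both noiseless sums push towards the correct sign, so a wrong decision
  would need noise of size at least \<open>\<tau>\<close>, while the noise stays below
  \<open>\<tau>' \<le> \<tau>\<close>. If neither test fires, both noiseless sums are below
  \<open>\<tau> + \<tau>'\<close>, and they dominate the signal because the signal columns are among
  the far ones.\<close>

lemma refined_comparison_less:
  fixes A G N H :: "nat \<Rightarrow> nat \<Rightarrow> real" and \<psi> :: "nat \<Rightarrow> nat"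
  defines "d \<equiv> \<lambda>i j. real (\<psi> i) - real (\<psi> j)"
  assumes T: "T \<subseteq> {1..n}" and p: "p \<in> T"
    and ij: "i \<in> {1..n}" "j \<in> {1..n}" "\<psi> i < \<psi> j"
    and close: "\<bar>d p i\<bar> \<le> W" "\<bar>d p j\<bar> \<le> W" and q: "0 < q"
    and H: "\<And>i j. i \<in> {1..n} \<Longrightarrow> j \<in> {1..n} \<Longrightarrow> H i j = 0 \<or> H i j = sgn (d i j)"
    and H0: "\<And>i j. i \<in> {1..n} \<Longrightarrow> j \<in> {1..n} \<Longrightarrow> \<bar>d i j\<bar> \<ge> q \<Longrightarrow> H i j \<noteq> 0"
    and far: "\<And>k. k \<in> T \<Longrightarrow> estimate_distance n tie A T p k \<ge> \<delta>4 \<Longrightarrow> \<bar>d p k\<bar> \<ge> W + q"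
    and far': "\<And>k. k \<in> T \<Longrightarrow> \<bar>d p k\<bar> \<ge> real n / 32 - W \<Longrightarrow> estimate_distance n tie A T p k \<ge> \<delta>4"
    and large: "2 * W < real n / 32"
    and A: "\<And>k l. k \<in> {1..n} \<Longrightarrow> l \<in> {1..n} \<Longrightarrow> A k l = G k l + N k l"
    and noise: "\<And>Q. Q \<in> {{k. \<psi> k < \<psi> p}, {k. \<psi> p < \<psi> k}} \<Longrightarrow>
        \<bar>\<Sum>k | k \<in> T \<and> estimate_distance n tie A T p k \<ge> \<delta>4 \<and> k \<in> Q. N i k - N j k\<bar> < \<tau>'"
    and mono: "\<And>k. k \<in> T \<Longrightarrow> \<psi> k \<le> \<psi> i \<Longrightarrow> G j k \<le> G i k"
              "\<And>k. k \<in> T \<Longrightarrow> \<psi> j \<le> \<psi> k \<Longrightarrow> G i k \<le> G j k"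
    and signal: "s \<le> max (\<Sum>k | k \<in> T \<and> real (\<psi> k) < real (\<psi> i) - real n / 32. G i k - G j k)
                         (\<Sum>k | k \<in> T \<and> real (\<psi> k) > real (\<psi> j) + real n / 32. G j k - G i k)"
    and \<tau>: "\<tau> = 5 * \<sigma> * sqrt (real n * ln (real n))" "\<tau>' \<le> \<tau>"
  defines "C \<equiv> refined_comparison n tie A \<sigma> \<delta>4 H T p i j"
  shows "C = 0 \<or> C = - 1" "C = 0 \<Longrightarrow> s < \<tau> + \<tau>'"
proof -
  define far_set where "far_set = {k \<in> T. estimate_distance n tie A T p k \<ge> \<delta>4}"
  have finT: "finite T" using T finite_subset by blast
  have side: "\<psi> k < \<psi> p \<longrightarrow> \<psi> k < \<psi> i \<and> \<psi> k < \<psi> j \<and> H i k = 1 \<and> H j k = 1"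
    "\<not> \<psi> k < \<psi> p \<longrightarrow> \<psi> p < \<psi> k \<and> \<psi> i < \<psi> k \<and> \<psi> j < \<psi> k \<and> H i k = -1 \<and> H j k = -1"
    if k: "k \<in> far_set" for k
  proof -
    have kT: "k \<in> T" "k \<in> {1..n}" and f: "\<bar>d p k\<bar> \<ge> W + q"
      using k far T unfolding far_set_def by auto
    \<comment> \<open>Both compared indices are within \<open>W\<close> of the proxy, so a gap of
      \<open>W + q\<close> to the proxy leaves a gap of \<open>q\<close> to each of them, where
      \<open>H\<close> is known to decide.\<close>
    have "\<bar>d i k\<bar> \<ge> q" "\<bar>d j k\<bar> \<ge> q" using f close unfolding d_def by linarith+
    then have Hs: "H i k = sgn (d i k)" "H j k = sgn (d j k)" using H H0 ij kT by metis+
    show "\<psi> k < \<psi> p \<longrightarrow> \<psi> k < \<psi> i \<and> \<psi> k < \<psi> j \<and> H i k = 1 \<and> H j k = 1"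
    proof
      assume "\<psi> k < \<psi> p"
      then have "d i k > 0" "d j k > 0" using f close q unfolding d_def by linarith+
      then show "\<psi> k < \<psi> i \<and> \<psi> k < \<psi> j \<and> H i k = 1 \<and> H j k = 1" using Hs unfolding d_def by simp
    qed
    show "\<not> \<psi> k < \<psi> p \<longrightarrow> \<psi> p < \<psi> k \<and> \<psi> i < \<psi> k \<and> \<psi> j < \<psi> k \<and> H i k = -1 \<and> H j k = -1"
    proof
      assume *: "\<not> \<psi> k < \<psi> p"
      then have "d i k < 0" "d j k < 0" "d p k < 0" using f close q unfolding d_def by linarith+
      then show "\<psi> p < \<psi> k \<and> \<psi> i < \<psi> k \<and> \<psi> j < \<psi> k \<and> H i k = -1 \<and> H j k = -1"
        using Hs unfolding d_def by simp
    qed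
  qed
  define X where "X = {k. k \<in> T \<and> estimate_distance n tie A T p k \<ge> \<delta>4 \<and> k \<in> {k. \<psi> k < \<psi> p}}"
  define Y where "Y = {k. k \<in> T \<and> estimate_distance n tie A T p k \<ge> \<delta>4 \<and> k \<in> {k. \<psi> p < \<psi> k}}"
  have fin: "finite X" "finite Y" using finT unfolding X_def Y_def by auto
  \<comment> \<open>The matrix \<open>H\<close> disappears here: among far columns, its condition is
    equivalent to being left of the proxy.\<close>
  have X: "{k \<in> {1..n}. H i k = 1 \<and> H j k = 1} \<inter> far_set = X"
  proof (intro set_eqI iffI)
    fix k assume "k \<in> {k \<in> {1..n}. H i k = 1 \<and> H j k = 1} \<inter> far_set"
    then show "k \<in> X" using side[of k] unfolding X_def far_set_def by auto
  next
    fix k assume "k \<in> X"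
    then have "k \<in> far_set" "\<psi> k < \<psi> p" "k \<in> {1..n}" using T unfolding X_def far_set_def by auto
    then show "k \<in> {k \<in> {1..n}. H i k = 1 \<and> H j k = 1} \<inter> far_set" using side(1)[of k] by simp
  qed
  have Y: "{k \<in> {1..n}. H i k = -1 \<and> H j k = -1} \<inter> far_set = Y"
  proof (intro set_eqI iffI)
    fix k assume "k \<in> {k \<in> {1..n}. H i k = -1 \<and> H j k = -1} \<inter> far_set"
    then show "k \<in> Y" using side[of k] unfolding Y_def far_set_def by auto
  next
    fix k assume "k \<in> Y"
    then have "k \<in> far_set" "\<psi> p < \<psi> k" "k \<in> {1..n}" using T unfolding Y_def far_set_def by auto
    then show "k \<in> {k \<in> {1..n}. H i k = -1 \<and> H j k = -1} \<inter> far_set" using side(2)[of k] by simp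
  qed
  define l where "l = (\<Sum>k\<in>X. A i k - A j k)"
  define \<rho> where "\<rho> = (\<Sum>k\<in>Y. A i k - A j k)"
  have C: "C = (if \<bar>l\<bar> \<ge> \<tau> then - sgn l else if \<bar>\<rho>\<bar> \<ge> \<tau> then sgn \<rho> else 0)"
    unfolding C_def refined_comparison_def Let_def l_def \<rho>_def X[symmetric] Y[symmetric] far_set_def \<tau>(1) ..
  define lG where "lG = (\<Sum>k\<in>X. G i k - G j k)"
  define rG where "rG = (\<Sum>k\<in>Y. G j k - G i k)"
  have XT: "X \<subseteq> T" "Y \<subseteq> T" unfolding X_def Y_def by auto
  have l: "l = lG + (\<Sum>k\<in>X. N i k - N j k)"
  proof -
    have "l = (\<Sum>k\<in>X. (G i k - G j k) + (N i k - N j k))"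
      unfolding l_def using A ij XT T by (intro sum.cong) auto
    then show ?thesis by (simp add: lG_def sum.distrib)
  qed
  have r: "\<rho> = - rG + (\<Sum>k\<in>Y. N i k - N j k)"
  proof -
    have "\<rho> = (\<Sum>k\<in>Y. - (G j k - G i k) + (N i k - N j k))"
      unfolding \<rho>_def using A ij XT T by (intro sum.cong) auto
    also have "\<dots> = (\<Sum>k\<in>Y. - (G j k - G i k)) + (\<Sum>k\<in>Y. N i k - N j k)" by (rule sum.distrib)
    finally show ?thesis by (simp only: rG_def sum_negf)
  qed
  have nl: "\<bar>\<Sum>k\<in>X. N i k - N j k\<bar> < \<tau>'" using noise[of "{k. \<psi> k < \<psi> p}"] unfolding X_def by simp
  have nr: "\<bar>\<Sum>k\<in>Y. N i k - N j k\<bar> < \<tau>'" using noise[of "{k. \<psi> p < \<psi> k}"] unfolding Y_def by simp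
  have Xpos: "G i k - G j k \<ge> 0" if "k \<in> X" for k
    using mono(1)[of k] side(1)[of k] that unfolding X_def far_set_def by auto
  have Ypos: "G j k - G i k \<ge> 0" if "k \<in> Y" for k
    using mono(2)[of k] side(2)[of k] that unfolding Y_def far_set_def by auto
  have pos: "lG \<ge> 0" "rG \<ge> 0" unfolding lG_def rG_def using Xpos Ypos by (auto intro!: sum_nonneg)
  show "C = 0 \<or> C = - 1"
    unfolding C using l r nl nr pos \<tau>(2) by (auto simp: sgn_if)
  have Xsig: "(\<Sum>k | k \<in> T \<and> real (\<psi> k) < real (\<psi> i) - real n / 32. G i k - G j k) \<le> lG"
    unfolding lG_def
  proof (rule sum_mono2[OF fin(1)])
    \<comment> \<open>A gap above \<open>n / 32\<close> to \<open>i\<close> leaves more than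
      \<open>n / 32 - W\<close> to the proxy. This suffices for the estimated distance to reach
      \<open>\<delta>4\<close>, and \<open>2 * W < n / 32\<close> keeps the column on the same side
      of the proxy.\<close>
    show "{k \<in> T. real (\<psi> k) < real (\<psi> i) - real n / 32} \<subseteq> X"
    proof
      fix k assume "k \<in> {k \<in> T. real (\<psi> k) < real (\<psi> i) - real n / 32}"
      then have k: "k \<in> T" "d i k > real n / 32" unfolding d_def by auto
      have *: "d p k > real n / 32 - W" using k(2) close(1) unfolding d_def by linarith
      then have "estimate_distance n tie A T p k \<ge> \<delta>4" using far'[OF k(1)] by linarith
      moreover have "d p k > 0" using * large close(1) by linarith
      ultimately show "k \<in> X" using k unfolding X_def d_def by simp
    qed
  qed (use Xpos in auto)
  have Ysig: "(\<Sum>k | k \<in> T \<and> real (\<psi> k) > real (\<psi> j) + real n / 32. G j k - G i k) \<le> rG"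
    unfolding rG_def
  proof (rule sum_mono2[OF fin(2)])
    show "{k \<in> T. real (\<psi> k) > real (\<psi> j) + real n / 32} \<subseteq> Y"
    proof
      fix k assume "k \<in> {k \<in> T. real (\<psi> k) > real (\<psi> j) + real n / 32}"
      then have k: "k \<in> T" "d j k < - (real n / 32)" unfolding d_def by auto
      have *: "d p k < - (real n / 32 - W)" using k(2) close(2) unfolding d_def by linarith
      then have "estimate_distance n tie A T p k \<ge> \<delta>4" using far'[OF k(1)] by linarith
      moreover have "d p k < 0" using * large close(1) by linarith
      ultimately show "k \<in> Y" using k unfolding Y_def d_def by simp
    qed
  qed (use Ypos in auto)
  assume C0: "C = 0"
  have \<tau>pos: "\<tau> > 0" using nl \<tau>(2) by linarith
  then have "\<bar>l\<bar> < \<tau>" "\<bar>\<rho>\<bar> < \<tau>" using C0 unfolding C by (auto simp: sgn_if split: if_splits)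
  then show "s < \<tau> + \<tau>'" using signal Xsig Ysig l r nl nr unfolding max_def by (auto split: if_splits)
qed

section \<open>Uniform random partitions\<close>

text \<open>Multiplied over three factors whose arguments have a fixed sum, this shows that trinomial
  coefficients are largest when the three parts are balanced.\<close>

lemma fact_tangent: "fact q * (q + 1) ^ a \<le> fact a * (q + 1 :: nat) ^ q"
proof (cases "q \<le> a")
  case True
  then show ?thesis
  proof (induction rule: dec_induct)
    case (step m)
    have "fact q * (q + 1) ^ Suc m = (q + 1) * (fact q * (q + 1) ^ m)"
      by (simp only: power_Suc mult.left_commute)
    also have "\<dots> \<le> (m + 1) * (fact m * (q + 1) ^ q)"
      using step by (intro mult_le_mono[of "q + 1" "m + 1"]) simp_all
    also have "\<dots> = fact (Suc m) * (q + 1) ^ q" by (simp add: algebra_simps)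
    finally show ?case .
  qed simp
next
  case False
  then have "a \<le> q" by simp
  then show ?thesis
  proof (induction rule: inc_induct)
    case (step m)
    have "(m + 1) * (fact q * (q + 1) ^ m) \<le> (q + 1) * (fact q * (q + 1) ^ m)"
      using step by (intro mult_le_mono1) simp
    also have "\<dots> = fact q * (q + 1) ^ Suc m" by (simp only: power_Suc mult.left_commute)
    also have "\<dots> \<le> fact (Suc m) * (q + 1) ^ q" using step by simp
    also have "\<dots> = (m + 1) * (fact m * (q + 1) ^ q)"
      by (simp add: algebra_simps)
    finally show ?case by (simp only: mult_le_cancel1)
  qed simp
qed

section \<open>Counting balanced partitions by trinomial coefficients\<close>

lemma trinomial:
  assumes "a + b + c = n"
  shows "(n choose a) * (n - a choose b) * (fact a * fact b * fact c) = (fact n :: nat)"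
proof -
  have 1: "fact a * fact (n - a) * (n choose a) = (fact n :: nat)"
    using assms by (intro binomial_fact_lemma) simp
  have "fact b * fact (n - a - b) * (n - a choose b) = (fact (n - a) :: nat)"
    using assms by (intro binomial_fact_lemma) simp
  moreover have "n - a - b = c" using assms by simp
  ultimately have 2: "fact b * fact c * (n - a choose b) = (fact (n - a) :: nat)" by simp
  show ?thesis unfolding 1[symmetric] 2[symmetric] by (simp add: ac_simps)
qed

text \<open>The sizes of the first two parts in a most even split. The third part has size
  \<open>n div 3\<close>, so a remainder goes to the first two.\<close>

definition thirds :: "nat \<Rightarrow> nat \<times> nat" where
  "thirds n = (n div 3 + of_bool (n mod 3 \<ge> 1), n div 3 + of_bool (n mod 3 \<ge> 2))"

text \<open>Multiplying \<open>fact_tangent\<close> at \<open>a\<close>, \<open>b\<close> and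
  \<open>c\<close> shows that the product of factorials is smallest for the even split: there it
  equals \<open>fact q ^ 3 * (q + 1) ^ m\<close>, where \<open>m\<close> is the remainder.
  Coefficient times factorials is always \<open>fact n\<close>, so the coefficient is largest
  there.\<close>

lemma trinomial_le_thirds:
  assumes "a + b + c = n" "thirds n = (q1, q2)"
  shows "(n choose a) * (n - a choose b) \<le> (n choose q1) * (n - q1 choose q2)"
proof -
  define q where "q = n div 3"
  define m where "m = n mod 3"
  have n: "n = 3 * q + m" "m < 3" unfolding q_def m_def by simp_all
  have q12: "q1 = q + of_bool (m \<ge> 1)" "q2 = q + of_bool (m \<ge> 2)"
    using assms(2) unfolding thirds_def q_def m_def by auto
  have sum: "q1 + q2 + q = n" using n unfolding q12 by (auto simp: of_bool_def)
  have "fact q ^ 3 * (q + 1) ^ n = (fact q * (q + 1) ^ a) * (fact q * (q + 1) ^ b) * (fact q * (q + 1) ^ c)"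
    unfolding assms(1)[symmetric] by (simp add: power_add power3_eq_cube ac_simps)
  also have "\<dots> \<le> (fact a * (q + 1) ^ q) * (fact b * (q + 1) ^ q) * (fact c * (q + 1) ^ q)"
    by (intro mult_mono fact_tangent) auto
  also have "\<dots> = fact a * fact b * fact c * (q + 1) ^ (3 * q)"
    by (simp add: power_add[symmetric] ac_simps flip: mult_2)
  finally have "(fact q ^ 3 * (q + 1) ^ m) * (q + 1) ^ (3 * q) \<le> fact a * fact b * fact c * (q + 1) ^ (3 * q)"
    unfolding n by (simp add: power_add ac_simps)
  then have "fact q ^ 3 * (q + 1) ^ m \<le> fact a * fact b * (fact c :: nat)" by simp
  moreover have "fact q1 * fact q2 * fact q = (fact q ^ 3 * (q + 1) ^ m :: nat)"
  proof -
    consider "m = 0" | "m = 1" | "m = 2" using n by linarith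
    then show ?thesis unfolding q12 by cases (simp_all add: power3_eq_cube power2_eq_square algebra_simps)
  qed
  ultimately have le: "fact q1 * fact q2 * fact q \<le> fact a * fact b * (fact c :: nat)" by simp
  show ?thesis
  proof (rule ccontr)
    assume "\<not> ?thesis"
    then have lt: "(n choose q1) * (n - q1 choose q2) < (n choose a) * (n - a choose b)" by simp
    have "(n choose q1) * (n - q1 choose q2) * (fact q1 * fact q2 * fact q)
        < (n choose a) * (n - a choose b) * (fact a * fact b * (fact c :: nat))"
      by (rule mult_less_le_imp_less[OF lt le]) simp_all
    then show False using trinomial[OF assms(1)] trinomial[OF sum] by simp
  qed
qed

text \<open>\<open>3 ^ n\<close> is the sum of all trinomial coefficients, of which there are at
  most \<open>(n + 1)\<^sup>2\<close>, each bounded by the one of the even split.\<close>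

lemma three_power_le:
  assumes "thirds n = (q1, q2)"
  shows "3 ^ n \<le> (n + 1)\<^sup>2 * ((n choose q1) * (n - q1 choose q2))"
proof -
  let ?Y = "(n choose q1) * (n - q1 choose q2)"
  have "(3::nat) ^ n = (\<Sum>a\<le>n. (n choose a) * 2 ^ (n - a))"
    using binomial[of 1 2 n] by (simp add: numeral_eq_Suc)
  also have "\<dots> = (\<Sum>a\<le>n. \<Sum>b\<le>n - a. (n choose a) * (n - a choose b))"
    by (simp add: choose_row_sum flip: sum_distrib_left)
  also have "\<dots> \<le> (\<Sum>a\<le>n. (n + 1) * ?Y)"
  proof (rule sum_mono)
    fix a assume a: "a \<in> {..n}"
    have "(\<Sum>b\<le>n - a. (n choose a) * (n - a choose b)) \<le> (\<Sum>b\<le>n - a. ?Y)"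
    proof (rule sum_mono)
      fix b assume "b \<in> {..n - a}"
      then show "(n choose a) * (n - a choose b) \<le> ?Y"
        using trinomial_le_thirds[OF _ assms, of a b "n - a - b"] a by simp
    qed
    also have "\<dots> = (n - a + 1) * ?Y" by simp
    also have "\<dots> \<le> (n + 1) * ?Y" by (rule mult_le_mono1) simp
    finally show "(\<Sum>b\<le>n - a. (n choose a) * (n - a choose b)) \<le> (n + 1) * ?Y" .
  qed
  also have "\<dots> = (n + 1)\<^sup>2 * ?Y" by (simp only: sum_constant card_atMost power2_eq_square Suc_eq_plus1 of_nat_id mult.assoc)
  finally show ?thesis .
qed

lemma finite_balanced_partitions: "finite (balanced_partitions n)"
proof (rule finite_subset)
  show "balanced_partitions n \<subseteq> Pow {1..n} \<times> Pow {1..n} \<times> Pow {1..n}"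
    unfolding balanced_partitions_def by auto
qed simp

text \<open>Balanced partitions are a fraction of at least \<open>1 / (n + 1)\<^sup>2\<close> of all
  labellings with three labels. A tail bound for independent labels thus passes to a uniform
  balanced partition at a polynomial cost, so no concentration theory for dependent labels is
  required. Counting one order of the part sizes is enough.\<close>

lemma card_balanced_partitions_ge: "3 ^ n \<le> (n + 1)\<^sup>2 * card (balanced_partitions n)"
proof -
  obtain q1 q2 where q: "thirds n = (q1, q2)" by fastforce
  define Z where "Z = Sigma {S. S \<subseteq> {1..n} \<and> card S = q1} (\<lambda>S. {S'. S' \<subseteq> {1..n} - S \<and> card S' = q2})"
  define g where "g = (\<lambda>(S, S'). (S, S', {1..n} - S - S'))"
  have fin: "finite {S. S \<subseteq> {1..n} \<and> card S = q1}" by (rule finite_subset[of _ "Pow {1..n}"]) auto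
  have "card Z = (\<Sum>S\<in>{S. S \<subseteq> {1..n} \<and> card S = q1}. card {S'. S' \<subseteq> {1..n} - S \<and> card S' = q2})"
    unfolding Z_def using fin by (intro card_SigmaI) (auto intro: finite_subset[of _ "Pow {1..n}"])
  also have "\<dots> = (\<Sum>S\<in>{S. S \<subseteq> {1..n} \<and> card S = q1}. n - q1 choose q2)"
  proof (intro sum.cong refl)
    fix S assume S: "S \<in> {S. S \<subseteq> {1..n} \<and> card S = q1}"
    then have "card ({1..n} - S) = n - q1" by (subst card_Diff_subset) (auto intro: finite_subset)
    then show "card {S'. S' \<subseteq> {1..n} - S \<and> card S' = q2} = n - q1 choose q2"
      by (subst n_subsets) auto
  qed
  also have "\<dots> = (n choose q1) * (n - q1 choose q2)" by (simp add: n_subsets)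
  finally have cZ: "card Z = (n choose q1) * (n - q1 choose q2)" .
  have sizes: "\<lfloor>real n / 3\<rfloor> \<le> int x" "int x \<le> \<lceil>real n / 3\<rceil>" if "x \<in> {q1, q2, n - q1 - q2}" for x
  proof -
    define q m where "q = n div 3" and "m = n mod 3"
    have n: "n = 3 * q + m" "m < 3" unfolding q_def m_def by simp_all
    have q12: "q1 = q + of_bool (m \<ge> 1)" "q2 = q + of_bool (m \<ge> 2)"
      using q unfolding thirds_def q_def m_def by auto
    have "x = q \<or> x = q + 1 \<and> m \<ge> 1" using that n q12 by (auto simp: of_bool_def split: if_splits)
    moreover have "\<lfloor>real n / 3\<rfloor> = int q" using n by (intro floor_unique) (auto simp: field_simps)
    moreover have "\<lceil>real n / 3\<rceil> \<ge> int q" unfolding n by (simp add: le_ceiling_iff)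
    moreover have "\<lceil>real n / 3\<rceil> \<ge> int q + 1" if "m \<ge> 1"
      using that unfolding n by (simp add: le_ceiling_iff)
    ultimately show "\<lfloor>real n / 3\<rfloor> \<le> int x" "int x \<le> \<lceil>real n / 3\<rceil>" by auto
  qed
  have "g ` Z \<subseteq> balanced_partitions n"
  proof
    fix P assume "P \<in> g ` Z"
    then obtain S S' where S: "S \<subseteq> {1..n}" "card S = q1" "S' \<subseteq> {1..n} - S" "card S' = q2"
      and P: "P = (S, S', {1..n} - S - S')" unfolding g_def Z_def by auto
    have "card ({1..n} - S - S') = n - q1 - q2"
      using S by (subst card_Diff_subset, auto intro: finite_subset)+
    then show "P \<in> balanced_partitions n"
      unfolding P balanced_partitions_def using S sizes by auto
  qed
  then have "card (g ` Z) \<le> card (balanced_partitions n)"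
    by (intro card_mono finite_balanced_partitions)
  moreover have "card (g ` Z) = card Z" by (intro card_image) (auto simp: inj_on_def g_def)
  ultimately have "(n + 1)\<^sup>2 * ((n choose q1) * (n - q1 choose q2)) \<le> (n + 1)\<^sup>2 * card (balanced_partitions n)"
    unfolding cZ by (intro mult_left_mono) auto
  then show ?thesis using three_power_le[OF q] by linarith
qed

section \<open>Chernoff bound for independent uniform labels and its transfer to balanced
  partitions\<close>

lemma exp_minus_le_quadratic:
  fixes y :: real
  assumes "0 \<le> y"
  shows "exp (- y) \<le> 1 - y + y\<^sup>2 / 2"
proof -
  have "1 \<le> (1 + y + y\<^sup>2 / 2) * (1 - y + y\<^sup>2 / 2)"
  proof -
    have "(1 + y + y\<^sup>2 / 2) * (1 - y + y\<^sup>2 / 2) = 1 + (y\<^sup>2)\<^sup>2 / 4"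
      by (simp add: field_simps power2_eq_square)
    then show ?thesis by simp
  qed
  also have "\<dots> \<le> exp y * (1 - y + y\<^sup>2 / 2)"
  proof (rule mult_right_mono)
    show "1 + y + y\<^sup>2 / 2 \<le> exp y" using exp_lower_Taylor_quadratic[OF assms] .
    have "0 \<le> ((1 - y)\<^sup>2 + 1) / 2" by simp
    also have "\<dots> = 1 - y + y\<^sup>2 / 2" by (simp add: power2_eq_square field_simps)
    finally show "0 \<le> 1 - y + y\<^sup>2 / 2" .
  qed
  finally show ?thesis by (simp add: exp_minus field_simps)
qed

text \<open>A Chernoff bound written as a count: the exponential sum over all labellings factorises
  over the indices. A label receives \<open>X / 3\<close> on average, and the margin
  \<open>X / 3 - X / 5\<close> produces the exponent. For nonnegative weights the quadratic bound on
  \<open>exp (- y)\<close> holds without any cap on the weights, so only \<open>V\<close>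
  enters.\<close>

lemma assignment_tail:
  fixes x :: "nat \<Rightarrow> real" and t :: nat
  assumes x: "\<And>k. k \<in> I \<Longrightarrow> 0 \<le> x k" and fin: "finite I" and t: "t < 3"
    and V: "0 < (\<Sum>k\<in>I. (x k)\<^sup>2)"
  defines "X \<equiv> (\<Sum>k\<in>I. x k)" and "V \<equiv> (\<Sum>k\<in>I. (x k)\<^sup>2)"
  shows "real (card {f \<in> I \<rightarrow>\<^sub>E {..<3}. (\<Sum>k | k \<in> I \<and> f k = t. x k) < X / 5})
    \<le> 3 ^ card I * exp (- 2 * X\<^sup>2 / (75 * V))"
proof -
  define s where "s = 2 * X / (5 * V)" \<comment> \<open>the minimiser of the exponent \<open>s X / 5 - s X / 3 + s\<^sup>2 V / 6\<close>\<close>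
  have V': "V > 0" using V by (simp add: V_def)
  have s: "0 \<le> s" using x V' unfolding s_def X_def by (simp add: sum_nonneg)
  let ?\<Omega> = "I \<rightarrow>\<^sub>E {..<3::nat}"
  have finO: "finite ?\<Omega>" using fin by (intro finite_PiE) auto
  have "real (card {f \<in> ?\<Omega>. (\<Sum>k | k \<in> I \<and> f k = t. x k) < X / 5})
      = (\<Sum>f\<in>{f \<in> ?\<Omega>. (\<Sum>k | k \<in> I \<and> f k = t. x k) < X / 5}. 1)" by simp
  also have "\<dots> \<le> (\<Sum>f\<in>{f \<in> ?\<Omega>. (\<Sum>k | k \<in> I \<and> f k = t. x k) < X / 5}.
        exp (s * X / 5) * (\<Prod>k\<in>I. if f k = t then exp (- s * x k) else 1))"
  proof (intro sum_mono)
    fix f assume f: "f \<in> {f \<in> ?\<Omega>. (\<Sum>k | k \<in> I \<and> f k = t. x k) < X / 5}"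
    have "(\<Prod>k\<in>I. if f k = t then exp (- s * x k) else 1) = (\<Prod>k | k \<in> I \<and> f k = t. exp (- s * x k))"
      using fin by (intro prod.inter_filter[symmetric])
    also have "\<dots> = exp (- s * (\<Sum>k | k \<in> I \<and> f k = t. x k))"
      using fin by (simp add: exp_sum[symmetric] sum_distrib_left sum_negf)
    finally have "exp (s * X / 5) * (\<Prod>k\<in>I. if f k = t then exp (- s * x k) else 1)
        = exp (s * (X / 5 - (\<Sum>k | k \<in> I \<and> f k = t. x k)))"
      by (simp add: exp_add[symmetric] algebra_simps)
    also have "\<dots> \<ge> 1" using f s by simp
    finally show "1 \<le> exp (s * X / 5) * (\<Prod>k\<in>I. if f k = t then exp (- s * x k) else 1)" .
  qed
  also have "\<dots> \<le> (\<Sum>f\<in>?\<Omega>. exp (s * X / 5) * (\<Prod>k\<in>I. if f k = t then exp (- s * x k) else 1))"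
    using finO by (intro sum_mono2 mult_nonneg_nonneg prod_nonneg) auto
  also have "\<dots> = exp (s * X / 5) * (\<Sum>f\<in>?\<Omega>. \<Prod>k\<in>I. if f k = t then exp (- s * x k) else 1)"
    by (simp add: sum_distrib_left)
  also have "(\<Sum>f\<in>?\<Omega>. \<Prod>k\<in>I. if f k = t then exp (- s * x k) else 1)
      = (\<Prod>k\<in>I. \<Sum>y\<in>{..<3}. if y = t then exp (- s * x k) else 1)"
    using fin by (intro prod_sum_PiE[symmetric]) auto
  also have "\<dots> \<le> (\<Prod>k\<in>I. 3 * exp (- (s * x k) / 3 + (s * x k)\<^sup>2 / 6))"
  proof (intro prod_mono conjI)
    fix k assume k: "k \<in> I"
    have "t = 0 \<or> t = 1 \<or> t = 2" using t by linarith
    then have "(\<Sum>y\<in>{..<3}. if y = t then exp (- s * x k) else 1) = 2 + exp (- (s * x k))"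
      by (auto simp: numeral_3_eq_3)
    also have "\<dots> \<le> 3 * (1 + (- (s * x k) / 3 + (s * x k)\<^sup>2 / 6))"
      using exp_minus_le_quadratic[of "s * x k"] x[OF k] s by simp
    also have "\<dots> \<le> 3 * exp (- (s * x k) / 3 + (s * x k)\<^sup>2 / 6)"
      by (intro mult_left_mono exp_ge_add_one_self) auto
    finally show "(\<Sum>y\<in>{..<3}. if y = t then exp (- s * x k) else 1)
      \<le> 3 * exp (- (s * x k) / 3 + (s * x k)\<^sup>2 / 6)" .
  qed (auto intro!: sum_nonneg)
  also have "\<dots> = 3 ^ card I * exp (\<Sum>k\<in>I. - (s * x k) / 3 + (s * x k)\<^sup>2 / 6)"
    using fin by (simp add: prod.distrib exp_sum)
  also have "(\<Sum>k\<in>I. - (s * x k) / 3 + (s * x k)\<^sup>2 / 6) = - (s * X) / 3 + s\<^sup>2 * V / 6"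
    unfolding X_def V_def
    by (simp add: sum.distrib sum_negf sum_subtractf sum_divide_distrib sum_distrib_left power_mult_distrib)
  also have "exp (s * X / 5) * (3 ^ card I * exp (- (s * X) / 3 + s\<^sup>2 * V / 6))
      = 3 ^ card I * exp (- 2 * X\<^sup>2 / (75 * V))"
  proof -
    have "s * X / 5 + (- (s * X) / 3 + s\<^sup>2 * V / 6) = - 2 * X\<^sup>2 / (75 * V)"
      unfolding s_def using V' by (simp add: field_simps power2_eq_square)
    then show ?thesis by (simp flip: exp_add)
  qed
  finally show ?thesis by simp
qed

definition parts :: "nat set \<times> nat set \<times> nat set \<Rightarrow> nat set set" where
  "parts P = (case P of (S1, S2, S3) \<Rightarrow> {S1, S2, S3})"

text \<open>A partition is encoded by its labelling, so the bad partitions inject into the union,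
  over three labels, of the bad labellings. The lower bound on the number of balanced partitions
  converts the count into a fraction.\<close>

lemma balanced_partitions_tail:
  fixes x :: "nat \<Rightarrow> real"
  assumes x: "\<And>k. k \<in> {1..n} \<Longrightarrow> 0 \<le> x k"
    and V: "0 < (\<Sum>k\<in>{1..n}. (x k)\<^sup>2)"
  defines "X \<equiv> (\<Sum>k\<in>{1..n}. x k)" and "V \<equiv> (\<Sum>k\<in>{1..n}. (x k)\<^sup>2)"
  shows "real (card {P \<in> balanced_partitions n. \<exists>T\<in>parts P. (\<Sum>k\<in>T. x k) < X / 5})
    \<le> 3 * (real n + 1)\<^sup>2 * exp (- 2 * X\<^sup>2 / (75 * V)) * real (card (balanced_partitions n))"
proof -
  define g where "g = (\<lambda>(S1, S2, S3 :: nat set). \<lambda>k\<in>{1..n}. if k \<in> S1 then 0 else if k \<in> S2 then 1 else (2::nat))"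
  define U where "U t = {f \<in> {1..n} \<rightarrow>\<^sub>E {..<3::nat}. (\<Sum>k | k \<in> {1..n} \<and> f k = t. x k) < X / 5}" for t
  define Bad where "Bad = {P \<in> balanced_partitions n. \<exists>T\<in>parts P. (\<Sum>k\<in>T. x k) < X / 5}"
  have part: "S1 = {k \<in> {1..n}. g (S1, S2, S3) k = 0}" "S2 = {k \<in> {1..n}. g (S1, S2, S3) k = 1}"
     "S3 = {k \<in> {1..n}. g (S1, S2, S3) k = 2}"
    if "(S1, S2, S3) \<in> balanced_partitions n" for S1 S2 S3
    using that unfolding balanced_partitions_def g_def by (auto split: if_splits)
  have inj: "inj_on g Bad"
  proof (rule inj_onI)
    fix P P' assume P: "P \<in> Bad" "P' \<in> Bad" "g P = g P'"
    obtain S1 S2 S3 T1 T2 T3 where eq: "P = (S1, S2, S3)" "P' = (T1, T2, T3)" by (metis prod_cases3)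
    have "(S1, S2, S3) \<in> balanced_partitions n" "(T1, T2, T3) \<in> balanced_partitions n"
      using P eq unfolding Bad_def by auto
    from part[OF this(1)] part[OF this(2)] P(3) show "P = P'" unfolding eq by metis
  qed
  have "g ` Bad \<subseteq> U 0 \<union> U 1 \<union> U 2"
  proof
    fix f assume "f \<in> g ` Bad"
    then obtain S1 S2 S3 T where P: "(S1, S2, S3) \<in> balanced_partitions n" "f = g (S1, S2, S3)"
       "T \<in> {S1, S2, S3}" "(\<Sum>k\<in>T. x k) < X / 5"
      unfolding Bad_def parts_def by auto
    have f: "f \<in> {1..n} \<rightarrow>\<^sub>E {..<3::nat}" unfolding P(2) g_def by auto
    obtain t where "t \<in> {0, 1, 2}" "T = {k \<in> {1..n}. f k = t}"
      using P(3) part[OF P(1)] unfolding P(2) by blast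
    then show "f \<in> U 0 \<union> U 1 \<union> U 2" using f P(4) unfolding U_def by auto
  qed
  moreover have fin: "finite (U t)" for t
    unfolding U_def by (rule finite_subset[of _ "{1..n} \<rightarrow>\<^sub>E {..<3::nat}"]) (auto intro: finite_PiE)
  ultimately have "card (g ` Bad) \<le> card (U 0 \<union> U 1 \<union> U 2)" by (intro card_mono) auto
  also have "\<dots> \<le> card (U 0) + card (U 1) + card (U 2)"
    by (meson add_le_mono1 card_Un_le order_trans)
  finally have "real (card Bad) \<le> real (card (U 0)) + real (card (U 1)) + real (card (U 2))"
    unfolding card_image[OF inj] by linarith
  also have "real (card (U t)) \<le> 3 ^ n * exp (- 2 * X\<^sup>2 / (75 * V))" if "t < 3" for t
    using assignment_tail[OF x _ that V] unfolding U_def X_def V_def by simp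
  from this[of 0] this[of 1] this[of 2]
  have "real (card (U 0)) + real (card (U 1)) + real (card (U 2)) \<le> 3 * (3 ^ n * exp (- 2 * X\<^sup>2 / (75 * V)))"
    by simp
  also have "\<dots> \<le> 3 * (((real n + 1)\<^sup>2 * real (card (balanced_partitions n))) * exp (- 2 * X\<^sup>2 / (75 * V)))"
  proof (intro mult_left_mono mult_right_mono)
    have "real (3 ^ n) \<le> real ((n + 1)\<^sup>2 * card (balanced_partitions n))"
      using card_balanced_partitions_ge[of n] of_nat_le_iff by blast
    then show "3 ^ n \<le> (real n + 1)\<^sup>2 * real (card (balanced_partitions n))" by (simp add: add.commute)
  qed auto
  finally show ?thesis unfolding Bad_def by (simp add: ac_simps)
qed

section \<open>Sub-Gaussian linear and bilinear forms\<close>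

context prob_space
begin

definition subgaussian :: "('a \<Rightarrow> real) \<Rightarrow> real \<Rightarrow> bool" where
  "subgaussian X v \<longleftrightarrow> X \<in> borel_measurable M \<and>
     (\<forall>s. integrable M (\<lambda>\<omega>. exp (s * X \<omega>)) \<and> expectation (\<lambda>\<omega>. exp (s * X \<omega>)) \<le> exp (s\<^sup>2 * v / 2))"

lemma subgaussian_upper_tail:
  assumes X: "subgaussian X v" and v: "0 < v" and t: "0 \<le> t"
  shows "prob {\<omega> \<in> space M. X \<omega> \<ge> t} \<le> exp (- t\<^sup>2 / (2 * v))"
proof -
  \<comment> \<open>The minimiser of \<open>s\<^sup>2 * v / 2 - s * t\<close>.\<close>
  define s where "s = t / v"
  have s: "0 \<le> s" using v t unfolding s_def by simp
  have [measurable]: "X \<in> borel_measurable M" using X unfolding subgaussian_def by simp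
  have int: "integrable M (\<lambda>\<omega>. exp (s * X \<omega>))" using X unfolding subgaussian_def by simp
  have "{\<omega> \<in> space M. X \<omega> \<ge> t} \<subseteq> {\<omega> \<in> space M. exp (s * X \<omega>) \<ge> exp (s * t)}"
    using s by (auto intro: mult_left_mono)
  then have "prob {\<omega> \<in> space M. X \<omega> \<ge> t} \<le> prob {\<omega> \<in> space M. exp (s * X \<omega>) \<ge> exp (s * t)}"
    by (intro finite_measure_mono) auto
  also have "\<dots> \<le> expectation (\<lambda>\<omega>. exp (s * X \<omega>)) / exp (s * t)"
    by (rule integral_Markov_inequality_measure[OF int, of "space M"]) auto
  also have "\<dots> \<le> exp (s\<^sup>2 * v / 2) / exp (s * t)"
    using X unfolding subgaussian_def by (intro divide_right_mono) auto
  also have "\<dots> = exp (- t\<^sup>2 / (2 * v))"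
    using v unfolding s_def by (simp flip: exp_diff) (simp add: field_simps power2_eq_square)
  finally show ?thesis .
qed

lemma subgaussian_tail:
  assumes X: "subgaussian X v" and v: "0 < v" and t: "0 \<le> t"
  shows "prob {\<omega> \<in> space M. \<bar>X \<omega>\<bar> \<ge> t} \<le> 2 * exp (- t\<^sup>2 / (2 * v))"
proof -
  have [measurable]: "X \<in> borel_measurable M" using X unfolding subgaussian_def by simp
  have neg: "subgaussian (\<lambda>\<omega>. - X \<omega>) v"
  proof -
    have "integrable M (\<lambda>\<omega>. exp (s * - X \<omega>)) \<and> expectation (\<lambda>\<omega>. exp (s * - X \<omega>)) \<le> exp (s\<^sup>2 * v / 2)" for s
      using X[unfolded subgaussian_def, THEN conjunct2, rule_format, of "- s"] by simp
    then show ?thesis unfolding subgaussian_def by simp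
  qed
  have "prob {\<omega> \<in> space M. \<bar>X \<omega>\<bar> \<ge> t}
      \<le> prob ({\<omega> \<in> space M. X \<omega> \<ge> t} \<union> {\<omega> \<in> space M. - X \<omega> \<ge> t})"
    by (intro finite_measure_mono) auto
  also have "\<dots> \<le> prob {\<omega> \<in> space M. X \<omega> \<ge> t} + prob {\<omega> \<in> space M. - X \<omega> \<ge> t}"
    by (intro measure_Un_le) auto
  finally show ?thesis
    using subgaussian_upper_tail[OF X v t] subgaussian_upper_tail[OF neg v t] by simp
qed

text \<open>Agreement is asked on \<open>space M\<close> only: the symmetry of the noise matrix is
  given there, so sums along rows and sums over upper-triangular entries agree only there.\<close>

lemma subgaussian_cong:
  assumes eq: "\<And>\<omega>. \<omega> \<in> space M \<Longrightarrow> X \<omega> = Y \<omega>" and v: "v = w"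
  shows "subgaussian X v = subgaussian Y w"
proof -
  have "integrable M (\<lambda>\<omega>. exp (s * X \<omega>)) = integrable M (\<lambda>\<omega>. exp (s * Y \<omega>))" for s
    using eq by (intro Bochner_Integration.integrable_cong) auto
  moreover have "expectation (\<lambda>\<omega>. exp (s * X \<omega>)) = expectation (\<lambda>\<omega>. exp (s * Y \<omega>))" for s
    using eq by (intro Bochner_Integration.integral_cong) auto
  moreover have "X \<in> borel_measurable M \<longleftrightarrow> Y \<in> borel_measurable M"
    using eq by (intro measurable_cong) auto
  ultimately show ?thesis unfolding subgaussian_def v by simp
qed

lemma subgaussian_mono: "subgaussian X v \<Longrightarrow> v \<le> w \<Longrightarrow> subgaussian X w"
  unfolding subgaussian_def
  by (meson exp_le_cancel_iff divide_right_mono mult_left_mono order_trans zero_le_power2 zero_le_numeral)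

text \<open>A product of two independent factors, one bounded and one sub-Gaussian: by convexity of the
  exponential in the bounded factor only the two extreme values of that factor matter.\<close>

lemma bounded_times_subgaussian:
  assumes ind: "indep_var borel X borel Y" and Y: "subgaussian Y 1"
    and X: "\<And>\<omega>. \<omega> \<in> space M \<Longrightarrow> \<bar>X \<omega>\<bar> \<le> b" and b: "0 < b"
  shows "subgaussian (\<lambda>\<omega>. X \<omega> * Y \<omega>) (b\<^sup>2)"
proof -
  have [measurable]: "X \<in> borel_measurable M" "Y \<in> borel_measurable M"
    using ind by (auto dest: indep_var_rv1 indep_var_rv2)
  have mgf: "integrable M (\<lambda>\<omega>. exp (s * Y \<omega>))" "expectation (\<lambda>\<omega>. exp (s * Y \<omega>)) \<le> exp (s\<^sup>2 / 2)" for s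
    using Y unfolding subgaussian_def by auto
  have main: "integrable M (\<lambda>\<omega>. exp (s * (X \<omega> * Y \<omega>))) \<and>
      expectation (\<lambda>\<omega>. exp (s * (X \<omega> * Y \<omega>))) \<le> exp (s\<^sup>2 * b\<^sup>2 / 2)" for s
  proof -
    \<comment> \<open>The weight of \<open>b\<close> when \<open>X\<close> is written as a convex
      combination of \<open>b\<close> and \<open>- b\<close>. It depends on \<open>X\<close> alone,
      hence is independent of \<open>Y\<close>.\<close>
    define p where "p \<omega> = (b + X \<omega>) / (2 * b)" for \<omega>
    define u where "u \<omega> = exp (s * b * Y \<omega>)" for \<omega>
    define w where "w \<omega> = exp (- (s * b) * Y \<omega>)" for \<omega>
    have p01: "0 \<le> p \<omega>" "p \<omega> \<le> 1" if "\<omega> \<in> space M" for \<omega>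
      using X[OF that] b unfolding p_def by (auto simp: field_simps)
    have [measurable]: "p \<in> borel_measurable M" "u \<in> borel_measurable M" "w \<in> borel_measurable M"
      unfolding p_def u_def w_def by measurable
    have int_p: "integrable M p"
      using p01 by (intro integrable_const_bound[where B=1]) auto
    have int_q: "integrable M (\<lambda>\<omega>. 1 - p \<omega>)" using int_p by simp
    have uw: "integrable M u" "expectation u \<le> exp (s\<^sup>2 * b\<^sup>2 / 2)"
        "integrable M w" "expectation w \<le> exp (s\<^sup>2 * b\<^sup>2 / 2)"
      using mgf[of "s * b"] mgf[of "- (s * b)"] unfolding u_def w_def by (auto simp: power_mult_distrib)
    have ind1: "indep_var borel p borel u"
      using indep_var_compose[OF ind, of "\<lambda>x. (b + x) / (2 * b)" borel "\<lambda>y. exp (s * b * y)" borel]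
      unfolding p_def u_def by (simp add: comp_def)
    have ind2: "indep_var borel (\<lambda>\<omega>. 1 - p \<omega>) borel w"
      using indep_var_compose[OF ind, of "\<lambda>x. 1 - (b + x) / (2 * b)" borel "\<lambda>y. exp (- (s * b) * y)" borel]
      unfolding p_def w_def by (simp add: comp_def)
    note E1 = indep_var_lebesgue_integral[OF ind1 int_p uw(1)] and I1 = indep_var_integrable[OF ind1 int_p uw(1)]
    note E2 = indep_var_lebesgue_integral[OF ind2 int_q uw(3)] and I2 = indep_var_integrable[OF ind2 int_q uw(3)]
    have le: "exp (s * (X \<omega> * Y \<omega>)) \<le> p \<omega> * u \<omega> + (1 - p \<omega>) * w \<omega>" if "\<omega> \<in> space M" for \<omega>
    proof -
      have "convex_on UNIV (exp :: real \<Rightarrow> real)" by (rule exp_convex)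
      from convex_onD[OF this p01[OF that], of "- (s * b) * Y \<omega>" "s * b * Y \<omega>"]
      have "exp ((1 - p \<omega>) * (- (s * b) * Y \<omega>) + p \<omega> * (s * b * Y \<omega>)) \<le> (1 - p \<omega>) * w \<omega> + p \<omega> * u \<omega>"
        unfolding u_def w_def by simp
      moreover have "(1 - p \<omega>) * (- (s * b) * Y \<omega>) + p \<omega> * (s * b * Y \<omega>) = s * (X \<omega> * Y \<omega>)"
        unfolding p_def using b by (simp add: field_simps)
      ultimately show ?thesis by simp
    qed
    have int: "integrable M (\<lambda>\<omega>. exp (s * (X \<omega> * Y \<omega>)))"
      using le by (intro Bochner_Integration.integrable_bound[OF Bochner_Integration.integrable_add[OF I1 I2]])
         (auto intro!: AE_I2 order_trans[OF _ abs_ge_self])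
    have "expectation (\<lambda>\<omega>. exp (s * (X \<omega> * Y \<omega>))) \<le> expectation (\<lambda>\<omega>. p \<omega> * u \<omega> + (1 - p \<omega>) * w \<omega>)"
      using le I1 I2 int by (intro integral_mono) auto
    also have "\<dots> = expectation p * expectation u + (1 - expectation p) * expectation w"
      using I1 I2 E1 E2 int_p by (simp add: prob_space)
    also have "\<dots> \<le> expectation p * exp (s\<^sup>2 * b\<^sup>2 / 2) + (1 - expectation p) * exp (s\<^sup>2 * b\<^sup>2 / 2)"
    proof -
      have "0 \<le> expectation p" using p01 by (intro integral_nonneg_AE) auto
      moreover have "expectation p \<le> 1" using p01 int_p by (intro integral_le_const) auto
      ultimately show ?thesis using uw by (intro add_mono mult_left_mono) auto
    qed
    also have "\<dots> = exp (s\<^sup>2 * b\<^sup>2 / 2)" by (simp add: algebra_simps)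
    finally show ?thesis using int by simp
  qed
  then show ?thesis unfolding subgaussian_def by simp
qed

lemma subgaussian_scale:
  assumes "subgaussian X v"
  shows "subgaussian (\<lambda>\<omega>. c * X \<omega>) (c\<^sup>2 * v)"
proof -
  have "integrable M (\<lambda>\<omega>. exp (s * (c * X \<omega>))) \<and> expectation (\<lambda>\<omega>. exp (s * (c * X \<omega>))) \<le> exp (s\<^sup>2 * (c\<^sup>2 * v) / 2)" for s
    using assms[unfolded subgaussian_def, THEN conjunct2, rule_format, of "s * c"]
    by (simp add: power_mult_distrib mult.assoc)
  moreover have "(\<lambda>\<omega>. c * X \<omega>) \<in> borel_measurable M"
    using assms unfolding subgaussian_def by (intro borel_measurable_times) auto
  ultimately show ?thesis unfolding subgaussian_def by simp
qed

lemma subgaussian_sum: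
  assumes ind: "indep_vars (\<lambda>_. borel) X J" and J: "finite J"
    and X: "\<And>u. u \<in> J \<Longrightarrow> subgaussian (X u) (v u)"
  shows "subgaussian (\<lambda>\<omega>. \<Sum>u\<in>J. X u \<omega>) (\<Sum>u\<in>J. v u)"
proof -
  have main: "integrable M (\<lambda>\<omega>. exp (s * (\<Sum>u\<in>J. X u \<omega>))) \<and>
      expectation (\<lambda>\<omega>. exp (s * (\<Sum>u\<in>J. X u \<omega>))) \<le> exp (s\<^sup>2 * (\<Sum>u\<in>J. v u) / 2)" for s
  proof -
    have eq: "exp (s * (\<Sum>u\<in>J. X u \<omega>)) = (\<Prod>u\<in>J. exp (s * X u \<omega>))" for \<omega>
      using J by (simp add: sum_distrib_left exp_sum)
    have ind': "indep_vars (\<lambda>_. borel) (\<lambda>u \<omega>. exp (s * X u \<omega>)) J"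
      by (rule indep_vars_compose2[OF ind]) measurable
    have int: "integrable M (\<lambda>\<omega>. exp (s * X u \<omega>))" if "u \<in> J" for u
      using X[OF that] unfolding subgaussian_def by auto
    have "(\<Prod>u\<in>J. expectation (\<lambda>\<omega>. exp (s * X u \<omega>))) \<le> (\<Prod>u\<in>J. exp (s\<^sup>2 * v u / 2))"
      using X unfolding subgaussian_def by (intro prod_mono) (auto intro: integral_nonneg_AE)
    also have "\<dots> = exp (s\<^sup>2 * (\<Sum>u\<in>J. v u) / 2)"
      using J by (simp add: exp_sum[symmetric] sum_distrib_left sum_divide_distrib)
    finally show ?thesis unfolding eq
      using indep_vars_lebesgue_integral[OF J ind' int] indep_vars_integrable[OF J ind' int] by simp
  qed
  have "(\<lambda>\<omega>. \<Sum>u\<in>J. X u \<omega>) \<in> borel_measurable M"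
    using X unfolding subgaussian_def by (intro borel_measurable_sum) auto
  then show ?thesis using main unfolding subgaussian_def by simp
qed

end

text \<open>Entries at mirrored positions are the same variable; the representative lies in the
  upper triangle, where independence is given.\<close>

definition unordered :: "nat \<Rightarrow> nat \<Rightarrow> nat \<times> nat" where
  "unordered i j = (min i j, max i j)"

lemma unordered_eq_iff: "unordered i j = unordered k l \<longleftrightarrow> i = k \<and> j = l \<or> i = l \<and> j = k"
  unfolding unordered_def by (auto simp: min_def max_def)

section \<open>Linear and bilinear forms in the noise entries\<close>

locale noise = prob_space M for M :: "'w measure" +
  fixes n :: nat and E :: "'w \<Rightarrow> nat \<Rightarrow> nat \<Rightarrow> real"
  assumes noise: "subgaussian_noise n M E"
begin

definition entry :: "nat \<times> nat \<Rightarrow> 'w \<Rightarrow> real" where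
  "entry u \<omega> = E \<omega> (fst u) (snd u)"

definition pairs :: "(nat \<times> nat) set" where
  "pairs = {(i, j). 1 \<le> i \<and> i \<le> j \<and> j \<le> n}"

lemma indep_entries: "indep_vars (\<lambda>_. borel) entry pairs"
proof -
  have "entry = (\<lambda>(i, j) \<omega>. E \<omega> i j)" by (auto simp: entry_def fun_eq_iff)
  then show ?thesis using noise unfolding subgaussian_noise_def pairs_def by simp
qed

lemma unordered_pairs: "i \<in> {1..n} \<Longrightarrow> j \<in> {1..n} \<Longrightarrow> unordered i j \<in> pairs"
  unfolding unordered_def pairs_def by auto

lemma entry_unordered:
  "\<omega> \<in> space M \<Longrightarrow> i \<in> {1..n} \<Longrightarrow> j \<in> {1..n} \<Longrightarrow> entry (unordered i j) \<omega> = E \<omega> i j"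
  using noise unfolding subgaussian_noise_def entry_def unordered_def by (auto simp: min_def max_def)

lemma entry_subgaussian: "u \<in> pairs \<Longrightarrow> subgaussian (entry u) 1"
proof -
  assume u: "u \<in> pairs"
  then obtain i j where ij: "u = (i, j)" "1 \<le> i \<and> i \<le> j \<and> j \<le> n" unfolding pairs_def by auto
  have eq: "entry u = (\<lambda>\<omega>. E \<omega> i j)" unfolding ij entry_def by simp
  have "integrable M (\<lambda>\<omega>. E \<omega> i j) \<and> (\<forall>s. integrable M (\<lambda>\<omega>. exp (s * E \<omega> i j)) \<and>
             (\<integral>\<omega>. exp (s * E \<omega> i j) \<partial>M) \<le> exp (s\<^sup>2 / 2))"
    using noise ij(2) unfolding subgaussian_noise_def by blast
  then show ?thesis unfolding subgaussian_def eq by (auto dest: borel_measurable_integrable)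
qed

lemma E_measurable: "i \<in> {1..n} \<Longrightarrow> j \<in> {1..n} \<Longrightarrow> (\<lambda>\<omega>. E \<omega> i j) \<in> borel_measurable M"
  using entry_subgaussian[OF unordered_pairs, of i j] entry_unordered[of _ i j]
  unfolding subgaussian_def by (simp cong: measurable_cong)

lemma linear_form_subgaussian:
  assumes J: "finite J" "inj_on e J" "e ` J \<subseteq> pairs"
  shows "subgaussian (\<lambda>\<omega>. \<Sum>m\<in>J. c m * entry (e m) \<omega>) (\<Sum>m\<in>J. (c m)\<^sup>2)"
proof -
  define c' where "c' u = c (the_inv_into J e u)" for u
  have c': "c' (e m) = c m" if "m \<in> J" for m
    unfolding c'_def using the_inv_into_f_f[OF J(2) that] by simp
  have "indep_vars (\<lambda>_. borel) (\<lambda>u \<omega>. c' u * entry u \<omega>) (e ` J)"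
    by (rule indep_vars_compose2[OF indep_vars_subset[OF indep_entries J(3)]]) measurable
  then have "subgaussian (\<lambda>\<omega>. \<Sum>u\<in>e ` J. c' u * entry u \<omega>) (\<Sum>u\<in>e ` J. (c' u)\<^sup>2 * 1)"
    using J by (intro subgaussian_sum subgaussian_scale entry_subgaussian) auto
  then show ?thesis using c' by (simp add: sum.reindex[OF J(2)])
qed

lemma row_form_subgaussian:
  assumes l: "l \<in> {1..n}" and J: "J \<subseteq> {1..n}"
  shows "subgaussian (\<lambda>\<omega>. \<Sum>m\<in>J. c m * E \<omega> l m) (\<Sum>m\<in>J. (c m)\<^sup>2)"
proof -
  have "subgaussian (\<lambda>\<omega>. \<Sum>m\<in>J. c m * entry (unordered l m) \<omega>) (\<Sum>m\<in>J. (c m)\<^sup>2)"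
  proof (rule linear_form_subgaussian)
    show "finite J" using J finite_subset by blast
    show "inj_on (unordered l) J" by (auto simp: inj_on_def unordered_eq_iff)
    show "unordered l ` J \<subseteq> pairs" using unordered_pairs l J by auto
  qed
  moreover have "(\<Sum>m\<in>J. c m * entry (unordered l m) \<omega>) = (\<Sum>m\<in>J. c m * E \<omega> l m)" if "\<omega> \<in> space M" for \<omega>
    using entry_unordered[OF that l] J by (intro sum.cong) auto
  ultimately show ?thesis by - (rule subgaussian_cong[THEN iffD1, rotated 2], assumption, simp_all)
qed

text \<open>Excluding \<open>i\<close> and \<open>j\<close> from the columns avoids the entry shared
  by the two rows. What is left are \<open>2 * card J\<close> distinct independent entries with
  coefficients 1 and -1.\<close>

lemma row_difference_subgaussian:
  assumes ij: "i \<in> {1..n}" "j \<in> {1..n}" "i \<noteq> j" and J: "J \<subseteq> {1..n}" "i \<notin> J" "j \<notin> J"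
  shows "subgaussian (\<lambda>\<omega>. \<Sum>m\<in>J. E \<omega> i m - E \<omega> j m) (2 * real (card J))"
proof -
  have finJ: "finite J" using J finite_subset by blast
  let ?e = "\<lambda>(b, m). unordered (if b then i else j) m"
  let ?c = "\<lambda>(b, m). if b then 1 else - 1 :: real"
  have "subgaussian (\<lambda>\<omega>. \<Sum>u\<in>UNIV \<times> J. ?c u * entry (?e u) \<omega>) (\<Sum>u\<in>UNIV \<times> J. (?c u)\<^sup>2)"
  proof (rule linear_form_subgaussian)
    show "finite (UNIV \<times> J :: (bool \<times> nat) set)" using finJ by simp
    show "inj_on ?e (UNIV \<times> J)" using ij J by (auto simp: inj_on_def unordered_eq_iff)
    show "?e ` (UNIV \<times> J) \<subseteq> pairs" using unordered_pairs ij J by auto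
  qed
  moreover have "(\<Sum>u\<in>UNIV \<times> J. (?c u)\<^sup>2) = 2 * real (card J)"
  proof -
    have "(\<Sum>u\<in>UNIV \<times> J. (?c u)\<^sup>2) = (\<Sum>u\<in>(UNIV :: bool set) \<times> J. 1)" by (intro sum.cong) auto
    then show ?thesis by (simp add: card_cartesian_product)
  qed
  moreover have "(\<Sum>u\<in>UNIV \<times> J. ?c u * entry (?e u) \<omega>) = (\<Sum>m\<in>J. E \<omega> i m - E \<omega> j m)"
    if "\<omega> \<in> space M" for \<omega>
  proof -
    have "(\<Sum>u\<in>UNIV \<times> J. ?c u * entry (?e u) \<omega>) = (\<Sum>b\<in>UNIV. \<Sum>m\<in>J. ?c (b, m) * entry (?e (b, m)) \<omega>)"
      by (simp only: sum.cartesian_product) (rule sum.cong, auto)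
    also have "\<dots> = (\<Sum>m\<in>J. entry (unordered i m) \<omega> - entry (unordered j m) \<omega>)"
      by (simp add: UNIV_bool sum_subtractf sum_negf)
    also have "\<dots> = (\<Sum>m\<in>J. E \<omega> i m - E \<omega> j m)"
      using entry_unordered[OF that] ij J by (intro sum.cong) auto
    finally show ?thesis .
  qed
  ultimately show ?thesis by - (rule subgaussian_cong[THEN iffD1, rotated 2], assumption, simp_all)
qed

text \<open>On the event that all entries are bounded by \<open>b\<close> this is the identity on
  the noise, so clipped products are then the true ones.\<close>

definition clip :: "real \<Rightarrow> real \<Rightarrow> real" where
  "clip b x = (if \<bar>x\<bar> \<le> b then x else 0)"

lemma clip_measurable [measurable]: "clip b \<in> borel_measurable borel"
  unfolding clip_def[abs_def] by measurable

text \<open>Clipping costs a logarithmic factor in the final bound but avoids sub-exponential estimates.\<close>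

lemma row_product_subgaussian:
  assumes kl: "k \<in> {1..n}" "l \<in> {1..n}" "k \<noteq> l" and J: "J \<subseteq> {1..n}" "k \<notin> J" "l \<notin> J" and b: "0 < b"
  shows "subgaussian (\<lambda>\<omega>. \<Sum>m\<in>J. clip b (E \<omega> k m) * E \<omega> l m) (real (card J) * b\<^sup>2)"
proof -
  have finJ: "finite J" using J finite_subset by blast
  \<comment> \<open>For different columns outside \<open>{k, l}\<close> these sets of entries are
    disjoint, so the products in different columns are independent.\<close>
  define K where "K m = {unordered k m, unordered l m}" for m
  have K: "K m \<subseteq> pairs" if "m \<in> J" for m using that unordered_pairs kl J unfolding K_def by auto
  have disj: "disjoint_family_on K J"
    using kl J unfolding disjoint_family_on_def K_def by (auto simp: unordered_eq_iff)
  define Y where "Y m x = clip b (x (unordered k m)) * x (unordered l m)" for m and x :: "nat \<times> nat \<Rightarrow> real"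
  have "indep_vars (\<lambda>_. borel) (\<lambda>m \<omega>. Y m (\<lambda>u\<in>K m. entry u \<omega>)) J"
  proof (rule indep_vars_compose2[OF indep_vars_restrict[OF indep_entries K disj]])
    fix m assume "m \<in> J"
    have "unordered k m \<in> K m" "unordered l m \<in> K m" unfolding K_def by auto
    then show "Y m \<in> borel_measurable (PiM (K m) (\<lambda>_. borel))"
      unfolding Y_def by measurable
  qed auto
  then have ind: "indep_vars (\<lambda>_. borel) (\<lambda>m \<omega>. clip b (entry (unordered k m) \<omega>) * entry (unordered l m) \<omega>) J"
    unfolding Y_def K_def by simp
  have "subgaussian (\<lambda>\<omega>. \<Sum>m\<in>J. clip b (entry (unordered k m) \<omega>) * entry (unordered l m) \<omega>) (\<Sum>m\<in>J. b\<^sup>2)"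
  proof (intro subgaussian_sum[OF ind finJ] bounded_times_subgaussian)
    fix m assume m: "m \<in> J"
    have p: "unordered k m \<in> pairs" "unordered l m \<in> pairs" using K[OF m] unfolding K_def by auto
    then show "subgaussian (entry (unordered l m)) 1" by (intro entry_subgaussian)
    have ne: "{unordered k m} \<inter> {unordered l m} = {}" using kl J m by (auto simp: unordered_eq_iff)
    have "indep_var borel ((\<lambda>x. clip b (x (unordered k m))) \<circ> (\<lambda>\<omega>. \<lambda>u\<in>{unordered k m}. entry u \<omega>))
        borel ((\<lambda>x. x (unordered l m)) \<circ> (\<lambda>\<omega>. \<lambda>u\<in>{unordered l m}. entry u \<omega>))"
      by (rule indep_var_compose[OF indep_var_restrict[OF indep_entries ne]]) (use p in auto)
    then show "indep_var borel (\<lambda>\<omega>. clip b (entry (unordered k m) \<omega>)) borel (entry (unordered l m))"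
      by (simp add: comp_def)
  qed (use b in \<open>auto simp: clip_def\<close>)
  moreover have "(\<Sum>m\<in>J. clip b (entry (unordered k m) \<omega>) * entry (unordered l m) \<omega>)
      = (\<Sum>m\<in>J. clip b (E \<omega> k m) * E \<omega> l m)" if "\<omega> \<in> space M" for \<omega>
    using entry_unordered[OF that] kl J by (intro sum.cong) auto
  ultimately show ?thesis by - (rule subgaussian_cong[THEN iffD1, rotated 2], assumption, simp_all)
qed

end

section \<open>Measurability of the distance estimate, and the split-sample bound\<close>

lemma estimate_distance_cong:
  assumes "\<And>k l. k \<in> T \<Longrightarrow> l \<in> T \<Longrightarrow> A k l = B k l"
  shows "estimate_distance n tie A T i j = estimate_distance n tie B T i j"
proof -
  have "masked A T = masked B T" using assms by (intro ext) (auto simp: masked_def)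
  then show ?thesis unfolding estimate_distance_def neighbour_def by simp
qed

text \<open>The tie rule is an arbitrary function, yet it acts on the set of minimisers, which is a
  measurable map into the finite power set of \<open>T\<close>. Any function of a measurable map
  into a discrete space is measurable.\<close>

lemma estimate_distance_measurable:
  fixes a :: "'x \<Rightarrow> nat \<Rightarrow> nat \<Rightarrow> real"
  assumes a: "\<And>k l. k \<in> T \<Longrightarrow> l \<in> T \<Longrightarrow> (\<lambda>\<omega>. a \<omega> k l) \<in> borel_measurable N" and T: "finite T"
  shows "(\<lambda>\<omega>. estimate_distance n tie (a \<omega>) T i j) \<in> borel_measurable N"
proof -
  have B [measurable]: "(\<lambda>\<omega>. masked (a \<omega>) T k l) \<in> borel_measurable N" for k l
    using a by (cases "k \<in> T \<and> l \<in> T") (auto simp: masked_def)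
  have dot [measurable]: "(\<lambda>\<omega>. dot n (masked (a \<omega>) T k) (masked (a \<omega>) T l)) \<in> borel_measurable N" for k l
    unfolding dot_def by measurable
  define f where "f i \<omega> j = (MAX k\<in>T - {i, j}. \<bar>dot n (masked (a \<omega>) T k)
       (\<lambda>l. masked (a \<omega>) T i l - masked (a \<omega>) T j l)\<bar>)" for i \<omega> j
  have f [measurable]: "(\<lambda>\<omega>. f i \<omega> j) \<in> borel_measurable N" for i j
    unfolding f_def dot_def using T by (intro borel_measurable_Max) auto
  define argset where "argset i \<omega> = {m. is_arg_min (f i \<omega>) (\<lambda>j. j \<in> T \<and> j \<noteq> i) m}" for i \<omega>
  have argset_iff: "m \<in> argset i \<omega> \<longleftrightarrow> m \<in> T \<and> m \<noteq> i \<and> (\<forall>j\<in>T. j \<noteq> i \<longrightarrow> f i \<omega> m \<le> f i \<omega> j)" for m i \<omega>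
    unfolding argset_def is_arg_min_def by (auto simp: not_less)
  have argset_meas: "argset i \<in> measurable N (count_space (Pow T))" for i
  proof (subst measurable_count_space_eq2)
    show "finite (Pow T)" using T by simp
    show "argset i \<in> space N \<rightarrow> Pow T \<and> (\<forall>U\<in>Pow T. argset i -` {U} \<inter> space N \<in> sets N)"
    proof (intro conjI ballI)
      show "argset i \<in> space N \<rightarrow> Pow T" using argset_iff by auto
      fix U assume U: "U \<in> Pow T"
      have "argset i -` {U} \<inter> space N =
        {\<omega> \<in> space N. \<forall>m\<in>T. (m \<noteq> i \<and> (\<forall>j\<in>T. j \<noteq> i \<longrightarrow> f i \<omega> m \<le> f i \<omega> j)) = (m \<in> U)}"
        using U argset_iff by (auto simp: set_eq_iff)
      also have "\<dots> \<in> sets N" using T by measurable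
      finally show "argset i -` {U} \<inter> space N \<in> sets N" .
    qed
  qed
  have nb: "neighbour n tie (a \<omega>) T i = tie T i (argset i \<omega>)" for i \<omega>
    unfolding neighbour_def argset_def f_def Let_def ..
  have nb_meas [measurable]: "(\<lambda>\<omega>. neighbour n tie (a \<omega>) T i) \<in> measurable N (count_space UNIV)" for i
    unfolding nb by (rule measurable_compose[OF argset_meas]) simp
  have [measurable]: "(\<lambda>\<omega>. dot n (masked (a \<omega>) T k) (masked (a \<omega>) T (neighbour n tie (a \<omega>) T k))) \<in> borel_measurable N" for k
    by (rule measurable_compose_countable[OF dot nb_meas])
  show ?thesis unfolding estimate_distance_def Let_def by measurable
qed

context noise
begin

text \<open>The random index set depends only on the block of the noise on \<open>T\<close>, the summands only on the
  rows \<open>i\<close> and \<open>j\<close> outside \<open>T\<close>.\<close>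

lemma split_sample_tail:
  fixes G :: "nat \<Rightarrow> nat \<Rightarrow> real" and Q :: "nat set" and p :: nat and tie :: tie_rule and \<delta> \<sigma> :: real
    and A :: "'w \<Rightarrow> nat \<Rightarrow> nat \<Rightarrow> real"
  assumes T: "T \<subseteq> {1..n}" "T \<noteq> {}" and ij: "i \<in> {1..n} - T" "j \<in> {1..n} - T" "i \<noteq> j" and t: "0 \<le> t"
    and A: "\<And>\<omega> k l. A \<omega> k l = G k l + \<sigma> * E \<omega> k l"
  defines "F \<equiv> \<lambda>\<omega>. {k. k \<in> T \<and> estimate_distance n tie (A \<omega>) T p k \<ge> \<delta> \<and> k \<in> Q}"
  shows "prob {\<omega> \<in> space M. \<bar>\<Sum>k\<in>F \<omega>. E \<omega> i k - E \<omega> j k\<bar> \<ge> t} \<le> 2 * exp (- t\<^sup>2 / (4 * real (card T)))"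
proof -
  have finT: "finite T" using T finite_subset by blast
  define K1 where "K1 = (\<lambda>(k, l). unordered k l) ` (T \<times> T)"
  define K2 where "K2 = unordered i ` T \<union> unordered j ` T"
  have Tn: "k \<in> {1..n}" if "k \<in> T" for k using T(1) that by blast
  have K: "K1 \<subseteq> pairs" "K2 \<subseteq> pairs"
    using ij unordered_pairs[OF Tn Tn] unordered_pairs[OF _ Tn] unfolding K1_def K2_def by auto
  have disj: "K1 \<inter> K2 = {}" using ij unfolding K1_def K2_def by (auto simp: unordered_eq_iff)
  have K1I: "unordered k l \<in> K1" if "k \<in> T" "l \<in> T" for k l using that unfolding K1_def by auto
  have K2I: "unordered i k \<in> K2" "unordered j k \<in> K2" if "k \<in> T" for k using that unfolding K2_def by auto
  let ?N1 = "PiM K1 (\<lambda>_. borel :: real measure)" and ?N2 = "PiM K2 (\<lambda>_. borel :: real measure)"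
  define X1 where "X1 \<omega> = (\<lambda>u\<in>K1. entry u \<omega>)" for \<omega>
  define X2 where "X2 \<omega> = (\<lambda>u\<in>K2. entry u \<omega>)" for \<omega>
  have ind: "indep_var ?N1 X1 ?N2 X2"
    unfolding X1_def X2_def by (rule indep_var_restrict[OF indep_entries disj K])
  \<comment> \<open>The block of \<open>A\<close> on \<open>T\<close> rebuilt from the entries in
    \<open>K1\<close>; this exhibits the index set as a function of \<open>X1\<close>.\<close>
  define a where "a x k l = G k l + \<sigma> * x (unordered k l)" for x :: "nat \<times> nat \<Rightarrow> real" and k l
  define F1 where "F1 x = {k. k \<in> T \<and> estimate_distance n tie (a x) T p k \<ge> \<delta> \<and> k \<in> Q}" for x
  have F: "F \<omega> = F1 (X1 \<omega>)" if \<omega>: "\<omega> \<in> space M" for \<omega>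
  proof -
    have "A \<omega> k l = a (X1 \<omega>) k l" if "k \<in> T" "l \<in> T" for k l
      using K1I[OF that] entry_unordered[OF \<omega> Tn[OF that(1)] Tn[OF that(2)]] unfolding A a_def X1_def by simp
    then have "estimate_distance n tie (A \<omega>) T p k = estimate_distance n tie (a (X1 \<omega>)) T p k" for k
      by (rule estimate_distance_cong)
    then show ?thesis unfolding F_def F1_def by simp
  qed
  define S where "S Z y = (\<Sum>k\<in>Z. y (unordered i k) - y (unordered j k))" for Z and y :: "nat \<times> nat \<Rightarrow> real"
  have S: "S Z (X2 \<omega>) = (\<Sum>k\<in>Z. E \<omega> i k - E \<omega> j k)" if \<omega>: "\<omega> \<in> space M" and Z: "Z \<subseteq> T" for \<omega> Z
    using K2I entry_unordered[OF \<omega>] ij T Z unfolding S_def X2_def by (intro sum.cong) auto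
  have meas1: "{x \<in> space ?N1. F1 x = Z} \<in> sets ?N1" if Z: "Z \<subseteq> T" for Z
  proof -
    have [measurable]: "(\<lambda>x. estimate_distance n tie (a x) T p k) \<in> borel_measurable ?N1" for k
    proof (rule estimate_distance_measurable[OF _ finT])
      fix k l assume "k \<in> T" "l \<in> T"
      from K1I[OF this] show "(\<lambda>x. a x k l) \<in> borel_measurable ?N1" unfolding a_def by measurable
    qed
    have "{x \<in> space ?N1. F1 x = Z} =
        {x \<in> space ?N1. \<forall>k\<in>T. (estimate_distance n tie (a x) T p k \<ge> \<delta> \<and> k \<in> Q) = (k \<in> Z)}"
      using Z unfolding F1_def by (auto simp: set_eq_iff)
    also have "\<dots> \<in> sets ?N1" using finT by measurable
    finally show ?thesis .
  qed
  have meas2: "{y \<in> space ?N2. \<bar>S Z y\<bar> \<ge> t} \<in> sets ?N2" if Z: "Z \<subseteq> T" for Z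
  proof -
    have [measurable]: "(\<lambda>y. S Z y) \<in> borel_measurable ?N2"
      unfolding S_def
    proof (intro borel_measurable_sum borel_measurable_diff)
      fix k assume "k \<in> Z"
      then have "unordered i k \<in> K2" "unordered j k \<in> K2" using K2I Z by auto
      then show "(\<lambda>y. y (unordered i k)) \<in> borel_measurable ?N2" "(\<lambda>y. y (unordered j k)) \<in> borel_measurable ?N2"
        by measurable
    qed
    show ?thesis by measurable
  qed
  have rv: "X1 \<in> measurable M ?N1" "X2 \<in> measurable M ?N2"
    using indep_var_rv1[OF ind] indep_var_rv2[OF ind] .
  define B1 where "B1 Z = X1 -` {x \<in> space ?N1. F1 x = Z} \<inter> space M" for Z
  define B2 where "B2 Z = X2 -` {y \<in> space ?N2. \<bar>S Z y\<bar> \<ge> t} \<inter> space M" for Z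
  have B_sets: "B1 Z \<in> sets M" "B2 Z \<in> sets M" if "Z \<subseteq> T" for Z
    unfolding B1_def B2_def using measurable_sets[OF rv(1) meas1[OF that]] measurable_sets[OF rv(2) meas2[OF that]] .
  have B2_le: "prob (B2 Z) \<le> 2 * exp (- t\<^sup>2 / (4 * real (card T)))" if Z: "Z \<subseteq> T" for Z
  proof -
    have "B2 Z = {\<omega> \<in> space M. \<bar>\<Sum>k\<in>Z. E \<omega> i k - E \<omega> j k\<bar> \<ge> t}"
      unfolding B2_def using S[OF _ Z] measurable_space[OF rv(2)] by auto
    moreover have "subgaussian (\<lambda>\<omega>. \<Sum>k\<in>Z. E \<omega> i k - E \<omega> j k) (2 * real (card T))"
    proof (rule subgaussian_mono)
      show "subgaussian (\<lambda>\<omega>. \<Sum>k\<in>Z. E \<omega> i k - E \<omega> j k) (2 * real (card Z))"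
        using ij Z T by (intro row_difference_subgaussian) blast+
      show "2 * real (card Z) \<le> 2 * real (card T)" using card_mono[OF finT Z] by simp
    qed
    moreover have "0 < card T" using T finT by (simp add: card_gt_0_iff)
    ultimately show ?thesis using subgaussian_tail[OF _ _ t, of _ "2 * real (card T)"] by simp
  qed
  have prod: "prob (B1 Z \<inter> B2 Z) = prob (B1 Z) * prob (B2 Z)" if Z: "Z \<subseteq> T" for Z
  proof -
    have "B1 Z \<inter> B2 Z = (\<lambda>\<omega>. (X1 \<omega>, X2 \<omega>)) -` ({x \<in> space ?N1. F1 x = Z} \<times> {y \<in> space ?N2. \<bar>S Z y\<bar> \<ge> t}) \<inter> space M"
      unfolding B1_def B2_def by auto
    then show ?thesis using indep_varD[OF ind meas1[OF Z] meas2[OF Z]] unfolding B1_def B2_def by simp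
  qed
  have sub: "{\<omega> \<in> space M. \<bar>\<Sum>k\<in>F \<omega>. E \<omega> i k - E \<omega> j k\<bar> \<ge> t} \<subseteq> (\<Union>Z\<in>Pow T. B1 Z \<inter> B2 Z)"
  proof
    fix \<omega> assume "\<omega> \<in> {\<omega> \<in> space M. \<bar>\<Sum>k\<in>F \<omega>. E \<omega> i k - E \<omega> j k\<bar> \<ge> t}"
    then have \<omega>: "\<omega> \<in> space M" "\<bar>\<Sum>k\<in>F \<omega>. E \<omega> i k - E \<omega> j k\<bar> \<ge> t" by auto
    have FT: "F \<omega> \<subseteq> T" unfolding F_def by auto
    have "\<omega> \<in> B1 (F \<omega>) \<inter> B2 (F \<omega>)"
      unfolding B1_def B2_def using \<omega> F[OF \<omega>(1)] S[OF \<omega>(1) FT] measurable_space[OF rv(1) \<omega>(1)]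
        measurable_space[OF rv(2) \<omega>(1)] by auto
    then show "\<omega> \<in> (\<Union>Z\<in>Pow T. B1 Z \<inter> B2 Z)" using FT by blast
  qed
  have "prob {\<omega> \<in> space M. \<bar>\<Sum>k\<in>F \<omega>. E \<omega> i k - E \<omega> j k\<bar> \<ge> t} \<le> prob (\<Union>Z\<in>Pow T. B1 Z \<inter> B2 Z)"
    using finT B_sets by (intro finite_measure_mono[OF sub]) (auto intro!: sets.finite_UN)
  also have "\<dots> \<le> (\<Sum>Z\<in>Pow T. prob (B1 Z \<inter> B2 Z))"
    using finT B_sets by (intro measure_UNION_le) auto
  also have "\<dots> = (\<Sum>Z\<in>Pow T. prob (B1 Z) * prob (B2 Z))"
    using prod by (intro sum.cong) auto
  also have "\<dots> \<le> (\<Sum>Z\<in>Pow T. prob (B1 Z) * (2 * exp (- t\<^sup>2 / (4 * real (card T)))))"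
    using B2_le by (intro sum_mono mult_left_mono) auto
  also have "\<dots> = (\<Sum>Z\<in>Pow T. prob (B1 Z)) * (2 * exp (- t\<^sup>2 / (4 * real (card T))))"
    by (simp add: sum_distrib_right)
  \<comment> \<open>The events \<open>B1 Z\<close> are disjoint, being indexed by the value of the
    random set. Their probabilities sum to at most 1, so the exponential number of possible sets
    costs nothing.\<close>
  also have "(\<Sum>Z\<in>Pow T. prob (B1 Z)) = prob (\<Union>Z\<in>Pow T. B1 Z)"
    using finT B_sets by (intro finite_measure_finite_Union[symmetric]) (auto simp: disjoint_family_on_def B1_def)
  also have "\<dots> * (2 * exp (- t\<^sup>2 / (4 * real (card T)))) \<le> 1 * (2 * exp (- t\<^sup>2 / (4 * real (card T))))"
    by (intro mult_right_mono) auto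
  finally show ?thesis by simp
qed

end

section \<open>Noise events\<close>

definition inner_good :: "(nat \<Rightarrow> nat \<Rightarrow> real) \<Rightarrow> real \<Rightarrow> nat set \<Rightarrow> (nat \<Rightarrow> nat \<Rightarrow> real) \<Rightarrow> bool" where
  "inner_good G e S A \<longleftrightarrow> (\<forall>k\<in>S. \<forall>l\<in>S. k \<noteq> l \<longrightarrow>
     \<bar>(\<Sum>m\<in>S. A k m * A l m) - (\<Sum>m\<in>S. G k m * G l m)\<bar> \<le> e)"

text \<open>The proxy used by the algorithm depends on the rows outside \<open>T\<close>, so the
  bound is required for every \<open>p\<close>. The noise is written as \<open>A - G\<close> so that
  the event is a function of \<open>A\<close>, since the partition is independent of
  \<open>A\<close> in that form.\<close>

definition split_good ::
  "nat \<Rightarrow> tie_rule \<Rightarrow> (nat \<Rightarrow> nat \<Rightarrow> real) \<Rightarrow> (nat \<Rightarrow> nat) \<Rightarrow> real \<Rightarrow> real \<Rightarrow> nat set \<Rightarrow> (nat \<Rightarrow> nat \<Rightarrow> real) \<Rightarrow> bool" where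
  "split_good n tie G \<psi> \<delta> \<tau> T A \<longleftrightarrow>
     (\<forall>p\<in>T. \<forall>i\<in>{1..n} - T. \<forall>j\<in>{1..n} - T. \<forall>Q\<in>{{k. \<psi> k < \<psi> p}, {k. \<psi> p < \<psi> k}}.
        \<bar>\<Sum>k | k \<in> T \<and> estimate_distance n tie A T p k \<ge> \<delta> \<and> k \<in> Q. (A i k - G i k) - (A j k - G j k)\<bar> < \<tau>)"

definition noise_good ::
  "nat \<Rightarrow> tie_rule \<Rightarrow> (nat \<Rightarrow> nat \<Rightarrow> real) \<Rightarrow> (nat \<Rightarrow> nat) \<Rightarrow> real \<Rightarrow> real \<Rightarrow> real \<Rightarrow>
    nat set \<times> nat set \<times> nat set \<Rightarrow> (nat \<Rightarrow> nat \<Rightarrow> real) \<Rightarrow> bool" where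
  "noise_good n tie G \<psi> \<delta> e \<tau> P A \<longleftrightarrow>
     (\<forall>S\<in>insert {1..n} (parts P). inner_good G e S A) \<and> (\<forall>T\<in>parts P. split_good n tie G \<psi> \<delta> \<tau> T A)"

lemma inner_good_measurable:
  fixes a :: "'x \<Rightarrow> nat \<Rightarrow> nat \<Rightarrow> real"
  assumes a: "\<And>k l. k \<in> {1..n} \<Longrightarrow> l \<in> {1..n} \<Longrightarrow> (\<lambda>\<omega>. a \<omega> k l) \<in> borel_measurable N" and S: "S \<subseteq> {1..n}"
  shows "{\<omega> \<in> space N. inner_good G e S (a \<omega>)} \<in> sets N"
proof -
  have fin: "finite S" using S finite_subset by blast
  have [measurable]: "(\<lambda>\<omega>. \<Sum>m\<in>S. a \<omega> k m * a \<omega> l m) \<in> borel_measurable N" if "k \<in> S" "l \<in> S" for k l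
    using that S by (intro borel_measurable_sum borel_measurable_times a) auto
  have "{\<omega> \<in> space N. k \<noteq> l \<longrightarrow> \<bar>(\<Sum>m\<in>S. a \<omega> k m * a \<omega> l m) - (\<Sum>m\<in>S. G k m * G l m)\<bar> \<le> e} \<in> sets N"
    if "k \<in> S" "l \<in> S" for k l
    using that by measurable
  then show ?thesis unfolding inner_good_def using fin
    by (intro sets.sets_Collect_finite_All) auto
qed

lemma split_good_measurable:
  fixes a :: "'x \<Rightarrow> nat \<Rightarrow> nat \<Rightarrow> real"
  assumes a: "\<And>k l. k \<in> {1..n} \<Longrightarrow> l \<in> {1..n} \<Longrightarrow> (\<lambda>\<omega>. a \<omega> k l) \<in> borel_measurable N" and T: "T \<subseteq> {1..n}"
  shows "{\<omega> \<in> space N. split_good n tie G \<psi> \<delta> \<tau> T (a \<omega>)} \<in> sets N"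
proof -
  have fin: "finite T" using T finite_subset by blast
  have ed [measurable]: "(\<lambda>\<omega>. estimate_distance n tie (a \<omega>) T p k) \<in> borel_measurable N" for p k
    using T by (intro estimate_distance_measurable fin a) auto
  have "{\<omega> \<in> space N. \<bar>\<Sum>k | k \<in> T \<and> estimate_distance n tie (a \<omega>) T p k \<ge> \<delta> \<and> k \<in> Q.
      (a \<omega> i k - G i k) - (a \<omega> j k - G j k)\<bar> < \<tau>} \<in> sets N"
    if ij: "i \<in> {1..n}" "j \<in> {1..n}" for p i j Q
  proof -
    have eq: "(\<Sum>k | k \<in> T \<and> estimate_distance n tie (a \<omega>) T p k \<ge> \<delta> \<and> k \<in> Q.
        (a \<omega> i k - G i k) - (a \<omega> j k - G j k)) =
      (\<Sum>k\<in>T. if estimate_distance n tie (a \<omega>) T p k \<ge> \<delta> \<and> k \<in> Q then (a \<omega> i k - G i k) - (a \<omega> j k - G j k) else 0)" for \<omega>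
      by (rule sum.inter_filter[OF fin])
    have "(\<lambda>\<omega>. \<Sum>k\<in>T. if estimate_distance n tie (a \<omega>) T p k \<ge> \<delta> \<and> k \<in> Q
        then (a \<omega> i k - G i k) - (a \<omega> j k - G j k) else 0) \<in> borel_measurable N"
    proof (intro borel_measurable_sum)
      fix k assume "k \<in> T"
      then have "k \<in> {1..n}" using T by blast
      then have [measurable]: "(\<lambda>\<omega>. a \<omega> i k) \<in> borel_measurable N" "(\<lambda>\<omega>. a \<omega> j k) \<in> borel_measurable N"
        using ij by (auto intro: a)
      show "(\<lambda>\<omega>. if estimate_distance n tie (a \<omega>) T p k \<ge> \<delta> \<and> k \<in> Q
        then (a \<omega> i k - G i k) - (a \<omega> j k - G j k) else 0) \<in> borel_measurable N" by measurable
    qed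
    then show ?thesis unfolding eq by measurable
  qed
  then show ?thesis unfolding split_good_def using fin
    by (intro sets.sets_Collect_finite_All) auto
qed

lemma parts_subset: "P \<in> balanced_partitions n \<Longrightarrow> T \<in> parts P \<Longrightarrow> T \<subseteq> {1..n}"
  unfolding balanced_partitions_def parts_def by (cases P) auto

lemma finite_parts: "finite (parts P)"
  unfolding parts_def by (cases P) auto

lemma card_parts_le: "card (parts P) \<le> 3"
proof -
  obtain S1 S2 S3 where "P = (S1, S2, S3)" by (metis prod_cases3)
  then have "card (parts P) = card (set [S1, S2, S3])" unfolding parts_def by simp
  also have "\<dots> \<le> length [S1, S2, S3]" by (rule card_length)
  finally show ?thesis by simp
qed

lemma noise_good_measurable:
  fixes a :: "'x \<Rightarrow> nat \<Rightarrow> nat \<Rightarrow> real"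
  assumes a: "\<And>k l. k \<in> {1..n} \<Longrightarrow> l \<in> {1..n} \<Longrightarrow> (\<lambda>\<omega>. a \<omega> k l) \<in> borel_measurable N"
    and P: "P \<in> balanced_partitions n"
  shows "{\<omega> \<in> space N. noise_good n tie G \<psi> \<delta> e \<tau> P (a \<omega>)} \<in> sets N"
  unfolding noise_good_def
  using inner_good_measurable[OF a] split_good_measurable[OF a] parts_subset[OF P] finite_parts[of P]
  by (intro sets.sets_Collect_conj sets.sets_Collect_finite_All) auto

lemma part_card:
  assumes "P \<in> balanced_partitions n" "T \<in> parts P"
  shows "real n / 3 - 1 \<le> real (card T)" "real (card T) \<le> real n / 3 + 1"
proof -
  have "\<lfloor>real n / 3\<rfloor> \<le> int (card T) \<and> int (card T) \<le> \<lceil>real n / 3\<rceil>"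
    using assms unfolding balanced_partitions_def parts_def by (cases P) auto
  then show "real n / 3 - 1 \<le> real (card T)" "real (card T) \<le> real n / 3 + 1" by linarith+
qed

section \<open>Union bounds and the probabilities of the noise events\<close>

context prob_space
begin

lemma prob_Ex_le:
  assumes fin: "finite I" and R: "\<And>u. u \<in> I \<Longrightarrow> {\<omega> \<in> space M. R u \<omega>} \<in> sets M"
    and le: "\<And>u. u \<in> I \<Longrightarrow> prob {\<omega> \<in> space M. R u \<omega>} \<le> c" and card: "real (card I) \<le> d" and c: "0 \<le> c"
  shows "prob {\<omega> \<in> space M. \<exists>u\<in>I. R u \<omega>} \<le> d * c"
proof -
  have "{\<omega> \<in> space M. \<exists>u\<in>I. R u \<omega>} = (\<Union>u\<in>I. {\<omega> \<in> space M. R u \<omega>})" by auto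
  then have "prob {\<omega> \<in> space M. \<exists>u\<in>I. R u \<omega>} \<le> (\<Sum>u\<in>I. prob {\<omega> \<in> space M. R u \<omega>})"
    using fin R by (simp add: measure_UNION_le)
  also have "\<dots> \<le> (\<Sum>u\<in>I. c)" using le by (rule sum_mono)
  also have "\<dots> = real (card I) * c" by simp
  also have "\<dots> \<le> d * c" using card c by (rule mult_right_mono)
  finally show ?thesis .
qed

end

lemma exp_minus_mult_ln: "0 < n \<Longrightarrow> exp (- (real m * ln (real n))) = 1 / real n ^ m"
  by (simp add: exp_minus exp_of_nat_mult inverse_eq_divide)

context noise
begin

definition bounded_noise :: "real \<Rightarrow> 'w \<Rightarrow> bool" where
  "bounded_noise b \<omega> \<longleftrightarrow> (\<forall>u\<in>{1..n} \<times> {1..n}. \<not> b \<le> \<bar>E \<omega> (fst u) (snd u)\<bar>)"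

lemma single_entry_subgaussian: "i \<in> {1..n} \<Longrightarrow> j \<in> {1..n} \<Longrightarrow> subgaussian (\<lambda>\<omega>. E \<omega> i j) 1"
  using row_form_subgaussian[of i "{j}" "\<lambda>_. 1"] by simp

lemma bounded_noise_sets: "{\<omega> \<in> space M. bounded_noise b \<omega>} \<in> sets M"
  unfolding bounded_noise_def
proof (intro sets.sets_Collect_finite_All)
  fix u assume "u \<in> {1..n} \<times> {1..n}"
  then have [measurable]: "(\<lambda>\<omega>. E \<omega> (fst u) (snd u)) \<in> borel_measurable M" by (intro E_measurable) auto
  show "{\<omega> \<in> space M. \<not> b \<le> \<bar>E \<omega> (fst u) (snd u)\<bar>} \<in> sets M" by measurable
qed simp

text \<open>At level \<open>4 * sqrt (ln n)\<close> a single entry fails with probability at most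
  \<open>2 / n ^ 8\<close>; there are \<open>n\<^sup>2\<close> entries.\<close>

lemma bounded_noise_prob:
  assumes n: "2 \<le> n"
  shows "prob {\<omega> \<in> space M. \<not> bounded_noise (4 * sqrt (ln n)) \<omega>} \<le> 2 / real n ^ 6"
proof -
  have L: "0 < ln (real n)" using n by simp
  have "prob {\<omega> \<in> space M. \<exists>u\<in>{1..n} \<times> {1..n}. 4 * sqrt (ln n) \<le> \<bar>E \<omega> (fst u) (snd u)\<bar>}
      \<le> (real n)\<^sup>2 * (2 / real n ^ 8)"
  proof (intro prob_Ex_le)
    fix u assume u: "u \<in> {1..n} \<times> {1..n}"
    then have [measurable]: "(\<lambda>\<omega>. E \<omega> (fst u) (snd u)) \<in> borel_measurable M" by (intro E_measurable) auto
    show "{\<omega> \<in> space M. 4 * sqrt (ln n) \<le> \<bar>E \<omega> (fst u) (snd u)\<bar>} \<in> sets M" by measurable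
    have "prob {\<omega> \<in> space M. \<bar>E \<omega> (fst u) (snd u)\<bar> \<ge> 4 * sqrt (ln n)} \<le> 2 * exp (- (4 * sqrt (ln n))\<^sup>2 / (2 * 1))"
      using u L by (intro subgaussian_tail single_entry_subgaussian) auto
    also have "- (4 * sqrt (ln n))\<^sup>2 / (2 * 1) = - (real 8 * ln n)" using L by (simp add: power_mult_distrib)
    finally show "prob {\<omega> \<in> space M. 4 * sqrt (ln n) \<le> \<bar>E \<omega> (fst u) (snd u)\<bar>} \<le> 2 / real n ^ 8"
      using exp_minus_mult_ln[of n 8] n by simp
  qed (auto simp: power2_eq_square)
  also have "\<dots> = 2 / real n ^ 6" using n by (simp add: field_simps flip: power_add)
  finally show ?thesis unfolding bounded_noise_def by simp
qed

text \<open>For \<open>k \<noteq> l\<close> the error is the sum of two linear forms times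
  \<open>\<sigma>\<close> and one bilinear form times \<open>\<sigma>\<^sup>2\<close>. Each linear
  form contributes \<open>4\<close>, the clipped bilinear form \<open>16\<close>, and the two
  columns \<open>k\<close> and \<open>l\<close> together \<open>32\<close> after \<open>ln n\<close>
  is bounded by \<open>sqrt n * ln n\<close>. This is the origin of
  \<open>8 * \<sigma> + 48 * \<sigma>\<^sup>2\<close>.\<close>

lemma inner_good_prob:
  fixes G :: "nat \<Rightarrow> nat \<Rightarrow> real"
  assumes n: "24 \<le> n" and S: "S \<subseteq> {1..n}" and \<sigma>: "0 < \<sigma>"
    and G: "\<And>k l. k \<in> {1..n} \<Longrightarrow> l \<in> {1..n} \<Longrightarrow> 0 \<le> G k l \<and> G k l \<le> 1"
    and A: "\<And>\<omega> k l. A \<omega> k l = G k l + \<sigma> * E \<omega> k l"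
  shows "prob {\<omega> \<in> space M. bounded_noise (4 * sqrt (ln n)) \<omega> \<and>
      \<not> inner_good G ((8 * \<sigma> + 48 * \<sigma>\<^sup>2) * sqrt n * ln n) S (A \<omega>)} \<le> 6 / real n ^ 6"
proof -
  have fin: "finite S" using S finite_subset by blast
  have "exp 1 < real n" using n exp_le order_le_less_trans[of "exp 1" 3 "real n"] by simp
  then have L: "1 < ln (real n)" using n ln_less_cancel_iff[of "exp 1" "real n"] by simp
  \<comment> \<open>Both levels \<open>t\<close> and \<open>w\<close> are set so that the
    sub-Gaussian exponent is exactly \<open>8 * ln n\<close>.\<close>
  define t where "t = 4 * sqrt (real n * ln n)"
  define w where "w = 16 * sqrt n * ln n"
  define b where "b = 4 * sqrt (ln n)"
  have b: "0 < b" using L by (simp add: b_def)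
  have pos: "0 \<le> t" "0 \<le> w" using L by (auto simp: t_def w_def)
  have Gsq: "(\<Sum>m\<in>S. (G k m)\<^sup>2) \<le> real n" if "k \<in> S" for k
  proof -
    have "(\<Sum>m\<in>S. (G k m)\<^sup>2) \<le> (\<Sum>m\<in>S. 1)"
      using G S that by (intro sum_mono) (auto simp: power_le_one subset_iff)
    also have "\<dots> \<le> real n" using card_mono[OF _ S] by simp
    finally show ?thesis .
  qed
  have lin: "prob {\<omega> \<in> space M. t \<le> \<bar>\<Sum>m\<in>S. G k m * E \<omega> l m\<bar>} \<le> 2 / real n ^ 8" if "k \<in> S" "l \<in> S" for k l
  proof -
    have "subgaussian (\<lambda>\<omega>. \<Sum>m\<in>S. G k m * E \<omega> l m) (real n)"
      using subgaussian_mono[OF row_form_subgaussian Gsq] that S by auto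
    then have "prob {\<omega> \<in> space M. t \<le> \<bar>\<Sum>m\<in>S. G k m * E \<omega> l m\<bar>} \<le> 2 * exp (- t\<^sup>2 / (2 * real n))"
      using n pos by (intro subgaussian_tail) auto
    also have "- t\<^sup>2 / (2 * real n) = - (real 8 * ln n)"
      using L n by (simp add: power_mult_distrib t_def)
    finally show ?thesis using exp_minus_mult_ln[of n 8] n by simp
  qed
  have prd: "prob {\<omega> \<in> space M. w \<le> \<bar>\<Sum>m\<in>S - {k, l}. clip b (E \<omega> k m) * E \<omega> l m\<bar>} \<le> 2 / real n ^ 8"
    if "k \<in> S" "l \<in> S" "k \<noteq> l" for k l
  proof -
    have "card (S - {k, l}) \<le> n" using card_mono[of "{1..n}" "S - {k, l}"] S by auto
    then have "subgaussian (\<lambda>\<omega>. \<Sum>m\<in>S - {k, l}. clip b (E \<omega> k m) * E \<omega> l m) (real n * b\<^sup>2)"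
      using that S b by (intro subgaussian_mono[OF row_product_subgaussian]) auto
    then have "prob {\<omega> \<in> space M. w \<le> \<bar>\<Sum>m\<in>S - {k, l}. clip b (E \<omega> k m) * E \<omega> l m\<bar>}
        \<le> 2 * exp (- w\<^sup>2 / (2 * (real n * b\<^sup>2)))"
      using n b pos by (intro subgaussian_tail) auto
    also have "- w\<^sup>2 / (2 * (real n * b\<^sup>2)) = - (real 8 * ln n)"
      using L n by (simp add: power_mult_distrib w_def b_def field_simps power2_eq_square)
    finally show ?thesis using exp_minus_mult_ln[of n 8] n by simp
  qed
  define R where "R u \<omega> \<longleftrightarrow> (case u of (k, l) \<Rightarrow> k \<noteq> l \<and>
      (t \<le> \<bar>\<Sum>m\<in>S. G k m * E \<omega> l m\<bar> \<or> t \<le> \<bar>\<Sum>m\<in>S. G l m * E \<omega> k m\<bar> \<or>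
       w \<le> \<bar>\<Sum>m\<in>S - {k, l}. clip b (E \<omega> k m) * E \<omega> l m\<bar>))" for u \<omega>
  have Em: "(\<lambda>\<omega>. E \<omega> k m) \<in> borel_measurable M" if "k \<in> S" "m \<in> S" for k m
    using that S by (intro E_measurable) auto
  have [measurable]: "(\<lambda>\<omega>. \<Sum>m\<in>S. G k m * E \<omega> l m) \<in> borel_measurable M" if "l \<in> S" for k l
    using Em[OF that] by (intro borel_measurable_sum) auto
  have [measurable]: "(\<lambda>\<omega>. \<Sum>m\<in>S - {k, l}. clip b (E \<omega> k m) * E \<omega> l m) \<in> borel_measurable M" if "k \<in> S" "l \<in> S" for k l
    using that by (intro borel_measurable_sum borel_measurable_times measurable_compose[OF Em clip_measurable] Em) auto
  have R_sets: "{\<omega> \<in> space M. R u \<omega>} \<in> sets M" if "u \<in> S \<times> S" for u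
    using that unfolding R_def by (cases u) (simp, measurable)
  have "prob {\<omega> \<in> space M. \<exists>u\<in>S \<times> S. R u \<omega>} \<le> (real n)\<^sup>2 * (6 / real n ^ 8)"
  proof (rule prob_Ex_le)
    fix u assume u: "u \<in> S \<times> S"
    obtain k l where kl: "u = (k, l)" "k \<in> S" "l \<in> S" using u by auto
    show "prob {\<omega> \<in> space M. R u \<omega>} \<le> 6 / real n ^ 8"
    proof (cases "k = l")
      case False
      let ?A = "{\<omega> \<in> space M. t \<le> \<bar>\<Sum>m\<in>S. G k m * E \<omega> l m\<bar>}"
      let ?B = "{\<omega> \<in> space M. t \<le> \<bar>\<Sum>m\<in>S. G l m * E \<omega> k m\<bar>}"
      let ?C = "{\<omega> \<in> space M. w \<le> \<bar>\<Sum>m\<in>S - {k, l}. clip b (E \<omega> k m) * E \<omega> l m\<bar>}"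
      have sets: "?A \<in> sets M" "?B \<in> sets M" "?C \<in> sets M" using kl by measurable
      have "{\<omega> \<in> space M. R u \<omega>} = ?A \<union> ?B \<union> ?C" using False kl unfolding R_def by auto
      then have "prob {\<omega> \<in> space M. R u \<omega>} \<le> prob (?A \<union> ?B) + prob ?C"
        using sets by (simp add: measure_Un_le)
      also have "prob (?A \<union> ?B) \<le> prob ?A + prob ?B" using sets by (simp add: measure_Un_le)
      finally show ?thesis using lin[OF kl(2,3)] lin[OF kl(3,2)] prd[OF kl(2,3) False] by simp
    qed (auto simp: kl R_def)
  next
    have "card S \<le> n" using card_mono[OF _ S] by simp
    then have "card (S \<times> S) \<le> n * n" by (simp add: card_cartesian_product mult_le_mono)
    then show "real (card (S \<times> S)) \<le> (real n)\<^sup>2" by (simp add: power2_eq_square flip: of_nat_mult)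
  qed (use fin R_sets in auto)
  also have "\<dots> = 6 / real n ^ 6" using n by (simp add: field_simps flip: power_add)
  finally have bad: "prob {\<omega> \<in> space M. \<exists>u\<in>S \<times> S. R u \<omega>} \<le> 6 / real n ^ 6" .
  have sub: "{\<omega> \<in> space M. bounded_noise (4 * sqrt (ln n)) \<omega> \<and>
      \<not> inner_good G ((8 * \<sigma> + 48 * \<sigma>\<^sup>2) * sqrt n * ln n) S (A \<omega>)} \<subseteq> {\<omega> \<in> space M. \<exists>u\<in>S \<times> S. R u \<omega>}"
  proof (rule subsetI, rule ccontr)
    fix \<omega> assume "\<omega> \<in> {\<omega> \<in> space M. bounded_noise (4 * sqrt (ln n)) \<omega> \<and>
      \<not> inner_good G ((8 * \<sigma> + 48 * \<sigma>\<^sup>2) * sqrt n * ln n) S (A \<omega>)}"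
      and notR: "\<omega> \<notin> {\<omega> \<in> space M. \<exists>u\<in>S \<times> S. R u \<omega>}"
    then have \<omega>: "\<omega> \<in> space M" "bounded_noise b \<omega>"
      and bad: "\<not> inner_good G ((8 * \<sigma> + 48 * \<sigma>\<^sup>2) * sqrt n * ln n) S (A \<omega>)" by (auto simp: b_def)
    have "inner_good G ((8 * \<sigma> + 48 * \<sigma>\<^sup>2) * sqrt n * ln n) S (A \<omega>)"
      unfolding inner_good_def
    proof (intro ballI impI)
      fix k l assume kl: "k \<in> S" "l \<in> S" "k \<noteq> l"
      have nR: "\<not> R (k, l) \<omega>" using notR \<omega> kl by auto
      have Eb: "\<bar>E \<omega> i j\<bar> \<le> b" if "i \<in> S" "j \<in> S" for i j
        using \<omega>(2) that S unfolding bounded_noise_def by force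
      have "(\<Sum>m\<in>S. A \<omega> k m * A \<omega> l m) - (\<Sum>m\<in>S. G k m * G l m)
        = \<sigma> * (\<Sum>m\<in>S. G k m * E \<omega> l m) + \<sigma> * (\<Sum>m\<in>S. G l m * E \<omega> k m) + \<sigma>\<^sup>2 * (\<Sum>m\<in>S. E \<omega> k m * E \<omega> l m)"
        unfolding A by (simp add: algebra_simps sum.distrib sum_distrib_left power2_eq_square)
      \<comment> \<open>In the columns \<open>k\<close> and \<open>l\<close> the entry shared by the
        two rows occurs, which would break the independence between columns; these two terms are
        bounded through the size of the entries instead.\<close>
      also have "(\<Sum>m\<in>S. E \<omega> k m * E \<omega> l m) = (\<Sum>m\<in>S - {k, l}. clip b (E \<omega> k m) * E \<omega> l m)
          + (E \<omega> k k * E \<omega> l k + E \<omega> k l * E \<omega> l l)"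
      proof -
        have "(\<Sum>m\<in>S. E \<omega> k m * E \<omega> l m) = (\<Sum>m\<in>S - {k, l}. E \<omega> k m * E \<omega> l m) + (\<Sum>m\<in>{k, l}. E \<omega> k m * E \<omega> l m)"
          using kl fin by (intro sum.subset_diff) auto
        also have "(\<Sum>m\<in>S - {k, l}. E \<omega> k m * E \<omega> l m) = (\<Sum>m\<in>S - {k, l}. clip b (E \<omega> k m) * E \<omega> l m)"
          using Eb kl by (intro sum.cong) (auto simp: clip_def)
        finally show ?thesis using kl by simp
      qed
      finally have eq: "(\<Sum>m\<in>S. A \<omega> k m * A \<omega> l m) - (\<Sum>m\<in>S. G k m * G l m)
        = \<sigma> * (\<Sum>m\<in>S. G k m * E \<omega> l m) + \<sigma> * (\<Sum>m\<in>S. G l m * E \<omega> k m)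
          + \<sigma>\<^sup>2 * ((\<Sum>m\<in>S - {k, l}. clip b (E \<omega> k m) * E \<omega> l m) + (E \<omega> k k * E \<omega> l k + E \<omega> k l * E \<omega> l l))" .
      have prodb: "\<bar>E \<omega> x y * E \<omega> u v\<bar> \<le> 16 * ln n" if "x \<in> S" "y \<in> S" "u \<in> S" "v \<in> S" for x y u v
      proof -
        have "\<bar>E \<omega> x y * E \<omega> u v\<bar> \<le> b * b"
          unfolding abs_mult using Eb that by (intro mult_mono) (auto intro: order_trans[OF abs_ge_zero])
        also have "b * b = 16 * ln n" using L by (simp add: b_def)
        finally show ?thesis .
      qed
      have third: "\<bar>(\<Sum>m\<in>S - {k, l}. clip b (E \<omega> k m) * E \<omega> l m) + (E \<omega> k k * E \<omega> l k + E \<omega> k l * E \<omega> l l)\<bar>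
          \<le> w + 32 * ln n"
        using nR kl prodb[of k k l k] prodb[of k l l l] unfolding R_def by auto
      have lin12: "\<bar>\<Sum>m\<in>S. G k m * E \<omega> l m\<bar> \<le> t" "\<bar>\<Sum>m\<in>S. G l m * E \<omega> k m\<bar> \<le> t"
        using nR kl unfolding R_def by auto
      have "\<bar>(\<Sum>m\<in>S. A \<omega> k m * A \<omega> l m) - (\<Sum>m\<in>S. G k m * G l m)\<bar> \<le> \<sigma> * t + \<sigma> * t + \<sigma>\<^sup>2 * (w + 32 * ln n)"
        unfolding eq using lin12 third \<sigma>
        by (intro abs_triangle_ineq[THEN order_trans] add_mono) (auto simp: abs_mult intro!: mult_left_mono)
      also have "\<dots> \<le> (8 * \<sigma> + 48 * \<sigma>\<^sup>2) * sqrt n * ln n"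
      proof -
        have "sqrt (ln n) \<le> ln n" using L by (simp add: real_sqrt_le_iff' real_le_lsqrt power2_eq_square)
        then have "t \<le> 4 * (sqrt n * ln n)" unfolding t_def by (simp add: real_sqrt_mult mult_left_mono)
        moreover have "1 * ln n \<le> sqrt n * ln n" using n L by (intro mult_right_mono) auto
        ultimately have "\<sigma> * t + \<sigma> * t + \<sigma>\<^sup>2 * (w + 32 * ln n)
          \<le> \<sigma> * (4 * (sqrt n * ln n)) + \<sigma> * (4 * (sqrt n * ln n)) + \<sigma>\<^sup>2 * (16 * (sqrt n * ln n) + 32 * (sqrt n * ln n))"
          using \<sigma> unfolding w_def by (intro add_mono mult_left_mono) auto
        then show ?thesis by (simp add: algebra_simps)
      qed
      finally show "\<bar>(\<Sum>m\<in>S. A \<omega> k m * A \<omega> l m) - (\<Sum>m\<in>S. G k m * G l m)\<bar> \<le> (8 * \<sigma> + 48 * \<sigma>\<^sup>2) * sqrt n * ln n" .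
    qed
    then show False using bad by simp
  qed
  have "{\<omega> \<in> space M. \<exists>u\<in>S \<times> S. R u \<omega>} \<in> sets M"
    using R_sets fin by (intro sets.sets_Collect_finite_Ex) auto
  then show ?thesis using finite_measure_mono[OF sub] bad by linarith
qed

text \<open>A part has at most \<open>n / 3 + 1\<close> elements, so level
  \<open>3 * sqrt (n * ln n)\<close> suffices: for \<open>24 \<le> n\<close> one has
  \<open>24 * card T \<le> 8 * n + 24 \<le> 9 * n\<close>, and the exponent is at least
  \<open>6 * ln n\<close>. There are at most \<open>2 * n ^ 3\<close> choices of proxy, pair and
  side.\<close>

lemma split_good_prob:
  fixes G :: "nat \<Rightarrow> nat \<Rightarrow> real"
  assumes n: "24 \<le> n" and T: "T \<subseteq> {1..n}" "real (card T) \<le> real n / 3 + 1" "T \<noteq> {}" and \<sigma>: "0 < \<sigma>"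
    and A: "\<And>\<omega> k l. A \<omega> k l = G k l + \<sigma> * E \<omega> k l"
  shows "prob {\<omega> \<in> space M. \<not> split_good n tie G \<psi> \<delta> (3 * \<sigma> * sqrt (n * ln n)) T (A \<omega>)} \<le> 4 / real n ^ 3"
proof -
  have finT: "finite T" using T finite_subset by blast
  have L: "0 < ln (real n)" using n by simp
  define t where "t = 3 * sqrt (real n * ln n)"
  have t: "0 < t" using L n by (simp add: t_def)
  define Q where "Q p c = (if c then {k. \<psi> k < \<psi> p} else {k. \<psi> p < \<psi> k})" for p c
  define F where "F p c \<omega> = {k. k \<in> T \<and> estimate_distance n tie (A \<omega>) T p k \<ge> \<delta> \<and> k \<in> Q p c}" for p c \<omega>
  define R where "R u \<omega> \<longleftrightarrow> (case u of (p, i, j, c) \<Rightarrow> t \<le> \<bar>\<Sum>k\<in>F p c \<omega>. E \<omega> i k - E \<omega> j k\<bar>)" for u \<omega>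
  define I where "I = T \<times> ({1..n} - T) \<times> ({1..n} - T) \<times> (UNIV :: bool set)"
  have Am: "(\<lambda>\<omega>. A \<omega> k l) \<in> borel_measurable M" if "k \<in> {1..n}" "l \<in> {1..n}" for k l
    unfolding A using E_measurable[OF that] by measurable
  have R_sets: "{\<omega> \<in> space M. R u \<omega>} \<in> sets M" if u: "u \<in> I" for u
  proof -
    obtain p i j c where u: "u = (p, i, j, c)" "i \<in> {1..n}" "j \<in> {1..n}" using u unfolding I_def by auto
    have [measurable]: "(\<lambda>\<omega>. estimate_distance n tie (A \<omega>) T p k) \<in> borel_measurable M" for p k
      using T by (intro estimate_distance_measurable finT Am) auto
    have "(\<lambda>\<omega>. \<Sum>k\<in>T. if estimate_distance n tie (A \<omega>) T p k \<ge> \<delta> \<and> k \<in> Q p c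
        then E \<omega> i k - E \<omega> j k else 0) \<in> borel_measurable M"
    proof (intro borel_measurable_sum)
      fix k assume "k \<in> T"
      then have "k \<in> {1..n}" using T by blast
      then have [measurable]: "(\<lambda>\<omega>. E \<omega> i k) \<in> borel_measurable M" "(\<lambda>\<omega>. E \<omega> j k) \<in> borel_measurable M"
        using u by (auto intro: E_measurable)
      show "(\<lambda>\<omega>. if estimate_distance n tie (A \<omega>) T p k \<ge> \<delta> \<and> k \<in> Q p c
        then E \<omega> i k - E \<omega> j k else 0) \<in> borel_measurable M" by measurable
    qed
    moreover have "(\<Sum>k\<in>T. if estimate_distance n tie (A \<omega>) T p k \<ge> \<delta> \<and> k \<in> Q p c
        then E \<omega> i k - E \<omega> j k else 0) = (\<Sum>k\<in>F p c \<omega>. E \<omega> i k - E \<omega> j k)" for \<omega>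
      unfolding F_def by (rule sum.inter_filter[OF finT, symmetric])
    ultimately have "(\<lambda>\<omega>. \<Sum>k\<in>F p c \<omega>. E \<omega> i k - E \<omega> j k) \<in> borel_measurable M" by simp
    then show ?thesis unfolding R_def u by simp
  qed
  have "prob {\<omega> \<in> space M. \<exists>u\<in>I. R u \<omega>} \<le> (2 * real n ^ 3) * (2 / real n ^ 6)"
  proof (rule prob_Ex_le)
    show "finite I" unfolding I_def using finT by simp
    have "card I = card T * (card ({1..n} - T) * (card ({1..n} - T) * 2))"
      unfolding I_def by (simp add: card_cartesian_product)
    also have "\<dots> \<le> n * (n * (n * 2))"
      using card_mono[OF _ T(1)] card_mono[of "{1..n}" "{1..n} - T"] by (intro mult_le_mono) auto
    finally have "real (card I) \<le> real (n * (n * (n * 2)))" by (simp only: of_nat_le_iff)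
    also have "\<dots> = 2 * real n ^ 3" by (simp add: power3_eq_cube)
    finally show "real (card I) \<le> 2 * real n ^ 3" .
  next
    fix u assume u: "u \<in> I"
    obtain p i j c where u: "u = (p, i, j, c)" "i \<in> {1..n} - T" "j \<in> {1..n} - T" using u unfolding I_def by auto
    show "prob {\<omega> \<in> space M. R u \<omega>} \<le> 2 / real n ^ 6"
    proof (cases "i = j")
      case False
      have "prob {\<omega> \<in> space M. R u \<omega>} \<le> 2 * exp (- t\<^sup>2 / (4 * real (card T)))"
        using split_sample_tail[OF T(1,3) u(2,3) False _ A, of t] t unfolding R_def u F_def by simp
      also have "- t\<^sup>2 / (4 * real (card T)) \<le> - (real 6 * ln n)"
      proof -
        have c: "0 < card T" using T finT by (simp add: card_gt_0_iff)
        have "24 * real (card T) \<le> 9 * real n" using T(2) n by simp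
        then have "24 * real (card T) * ln n \<le> 9 * real n * ln n" using L by (intro mult_right_mono) auto
        moreover have "t\<^sup>2 = 9 * real n * ln n" using L by (simp add: t_def power_mult_distrib)
        ultimately show ?thesis using c by (simp add: field_simps)
      qed
      finally show ?thesis using exp_minus_mult_ln[of n 6] n by simp
    qed (use t in \<open>simp add: R_def u\<close>)
  qed (use R_sets in auto)
  also have "\<dots> = 4 / real n ^ 3" using n by (simp add: field_simps flip: power_add)
  finally have bad: "prob {\<omega> \<in> space M. \<exists>u\<in>I. R u \<omega>} \<le> 4 / real n ^ 3" .
  have sub: "{\<omega> \<in> space M. \<not> split_good n tie G \<psi> \<delta> (3 * \<sigma> * sqrt (n * ln n)) T (A \<omega>)}
      \<subseteq> {\<omega> \<in> space M. \<exists>u\<in>I. R u \<omega>}"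
  proof (rule subsetI, rule ccontr)
    fix \<omega> assume "\<omega> \<in> {\<omega> \<in> space M. \<not> split_good n tie G \<psi> \<delta> (3 * \<sigma> * sqrt (n * ln n)) T (A \<omega>)}"
      and notR: "\<omega> \<notin> {\<omega> \<in> space M. \<exists>u\<in>I. R u \<omega>}"
    then have \<omega>: "\<omega> \<in> space M" and nsplit: "\<not> split_good n tie G \<psi> \<delta> (3 * \<sigma> * sqrt (n * ln n)) T (A \<omega>)" by auto
    have "split_good n tie G \<psi> \<delta> (3 * \<sigma> * sqrt (n * ln n)) T (A \<omega>)"
      unfolding split_good_def
    proof (intro ballI)
      fix p i j X assume p: "p \<in> T" and ij: "i \<in> {1..n} - T" "j \<in> {1..n} - T"
        and X: "X \<in> {{k. \<psi> k < \<psi> p}, {k. \<psi> p < \<psi> k}}"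
      obtain c where c: "X = Q p c"
      proof (cases "X = {k. \<psi> k < \<psi> p}")
        case True
        then show ?thesis using that[of True] unfolding Q_def by simp
      next
        case False
        then show ?thesis using that[of False] X unfolding Q_def by simp
      qed
      have "\<not> R (p, i, j, c) \<omega>" using notR \<omega> p ij unfolding I_def by auto
      then have lt: "\<bar>\<Sum>k\<in>F p c \<omega>. E \<omega> i k - E \<omega> j k\<bar> < t" unfolding R_def by simp
      have "(\<Sum>k | k \<in> T \<and> estimate_distance n tie (A \<omega>) T p k \<ge> \<delta> \<and> k \<in> X. (A \<omega> i k - G i k) - (A \<omega> j k - G j k))
          = \<sigma> * (\<Sum>k\<in>F p c \<omega>. E \<omega> i k - E \<omega> j k)"
        unfolding F_def c A by (simp add: sum_distrib_left right_diff_distrib)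
      then show "\<bar>\<Sum>k | k \<in> T \<and> estimate_distance n tie (A \<omega>) T p k \<ge> \<delta> \<and> k \<in> X. (A \<omega> i k - G i k) - (A \<omega> j k - G j k)\<bar>
          < 3 * \<sigma> * sqrt (n * ln n)"
        using lt \<sigma> by (simp add: abs_mult t_def algebra_simps)
    qed
    then show False using nsplit by simp
  qed
  have "{\<omega> \<in> space M. \<exists>u\<in>I. R u \<omega>} \<in> sets M"
    using R_sets finT unfolding I_def by (intro sets.sets_Collect_finite_Ex) auto
  then show ?thesis using finite_measure_mono[OF sub] bad by linarith
qed

text \<open>The partition is fixed here. Bounded entries and four index sets contribute
  \<open>26 / n ^ 6\<close>, the three parts \<open>12 / n ^ 3\<close>.\<close>

lemma noise_good_prob:
  fixes G :: "nat \<Rightarrow> nat \<Rightarrow> real"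
  assumes n: "24 \<le> n" and P: "P \<in> balanced_partitions n" and \<sigma>: "0 < \<sigma>"
    and G: "\<And>k l. k \<in> {1..n} \<Longrightarrow> l \<in> {1..n} \<Longrightarrow> 0 \<le> G k l \<and> G k l \<le> 1"
    and A: "\<And>\<omega> k l. A \<omega> k l = G k l + \<sigma> * E \<omega> k l"
  shows "prob {\<omega> \<in> space M. \<not> noise_good n tie G \<psi> \<delta> ((8 * \<sigma> + 48 * \<sigma>\<^sup>2) * sqrt n * ln n)
            (3 * \<sigma> * sqrt (n * ln n)) P (A \<omega>)} \<le> 38 / real n ^ 3"
proof -
  let ?e = "(8 * \<sigma> + 48 * \<sigma>\<^sup>2) * sqrt n * ln n" and ?\<tau> = "3 * \<sigma> * sqrt (n * ln n)"
  have Am: "(\<lambda>\<omega>. A \<omega> k l) \<in> borel_measurable M" if "k \<in> {1..n}" "l \<in> {1..n}" for k l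
    unfolding A using E_measurable[OF that] by measurable
  have TS: "T \<subseteq> {1..n}" "T \<noteq> {}" "real (card T) \<le> real n / 3 + 1" if "T \<in> parts P" for T
    using parts_subset[OF P that] part_card[OF P that] n by auto
  define B1 where "B1 = {\<omega> \<in> space M. \<not> bounded_noise (4 * sqrt (ln n)) \<omega>}"
  define B2 where "B2 = {\<omega> \<in> space M. \<exists>S\<in>insert {1..n} (parts P). bounded_noise (4 * sqrt (ln n)) \<omega> \<and>
      \<not> inner_good G ?e S (A \<omega>)}"
  define B3 where "B3 = {\<omega> \<in> space M. \<exists>T\<in>parts P. \<not> split_good n tie G \<psi> \<delta> ?\<tau> T (A \<omega>)}"
  have inner_sets: "{\<omega> \<in> space M. bounded_noise (4 * sqrt (ln n)) \<omega> \<and> \<not> inner_good G ?e S (A \<omega>)} \<in> sets M"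
    if "S \<in> insert {1..n} (parts P)" for S
    using that TS by (intro sets.sets_Collect_conj sets.sets_Collect_neg bounded_noise_sets inner_good_measurable[OF Am]) auto
  have split_sets: "{\<omega> \<in> space M. \<not> split_good n tie G \<psi> \<delta> ?\<tau> T (A \<omega>)} \<in> sets M"
    if "T \<in> parts P" for T
    using that TS by (intro sets.sets_Collect_neg split_good_measurable[OF Am]) auto
  have B_sets: "B1 \<in> sets M" "B2 \<in> sets M" "B3 \<in> sets M"
    unfolding B1_def B2_def B3_def
    by (intro sets.sets_Collect_neg bounded_noise_sets sets.sets_Collect_finite_Ex inner_sets split_sets
         finite_parts finite.insertI; assumption)+
  have p1: "prob B1 \<le> 2 / real n ^ 6" unfolding B1_def using n by (intro bounded_noise_prob) auto
  have p2: "prob B2 \<le> 4 * (6 / real n ^ 6)"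
    unfolding B2_def
  proof (rule prob_Ex_le[OF _ inner_sets])
    show "prob {\<omega> \<in> space M. bounded_noise (4 * sqrt (ln n)) \<omega> \<and> \<not> inner_good G ?e S (A \<omega>)} \<le> 6 / real n ^ 6"
      if "S \<in> insert {1..n} (parts P)" for S
      using that n TS \<sigma> G A by (intro inner_good_prob) auto
    have "card (insert {1..n} (parts P)) \<le> 4"
      using card_parts_le[of P] finite_parts[of P] by (simp add: card_insert_if)
    then show "real (card (insert {1..n} (parts P))) \<le> 4" by linarith
  qed (use finite_parts in auto)
  have p3: "prob B3 \<le> 3 * (4 / real n ^ 3)"
    unfolding B3_def
  proof (rule prob_Ex_le[OF finite_parts split_sets])
    show "prob {\<omega> \<in> space M. \<not> split_good n tie G \<psi> \<delta> ?\<tau> T (A \<omega>)} \<le> 4 / real n ^ 3"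
      if "T \<in> parts P" for T
      using TS[OF that] n \<sigma> A by (intro split_good_prob) auto
    show "real (card (parts P)) \<le> 3" using card_parts_le[of P] by simp
  qed auto
  have "{\<omega> \<in> space M. \<not> noise_good n tie G \<psi> \<delta> ?e ?\<tau> P (A \<omega>)} \<subseteq> B1 \<union> B2 \<union> B3"
    unfolding noise_good_def B1_def B2_def B3_def by blast
  then have "prob {\<omega> \<in> space M. \<not> noise_good n tie G \<psi> \<delta> ?e ?\<tau> P (A \<omega>)} \<le> prob (B1 \<union> B2 \<union> B3)"
    using B_sets by (intro finite_measure_mono) auto
  also have "\<dots> \<le> prob (B1 \<union> B2) + prob B3" using B_sets by (intro measure_Un_le) auto
  also have "prob (B1 \<union> B2) \<le> prob B1 + prob B2" using B_sets by (intro measure_Un_le) auto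
  finally have "prob {\<omega> \<in> space M. \<not> noise_good n tie G \<psi> \<delta> ?e ?\<tau> P (A \<omega>)} \<le> 26 / real n ^ 6 + 12 / real n ^ 3"
    using p1 p2 p3 by simp
  also have "26 / real n ^ 6 \<le> 26 / real n ^ 3"
    using n by (intro divide_left_mono power_increasing) auto
  finally show ?thesis by (simp add: add_divide_distrib[symmetric])
qed

end

section \<open>Restriction to the parts\<close>

text \<open>The hypothesis \<open>spread\<close> makes the Chernoff exponent at least of order
  \<open>sqrt n\<close> for each weight, which outweighs the polynomial number of weights and the
  factor \<open>(n + 1)\<^sup>2\<close>.\<close>

lemma balanced_partitions_union:
  fixes \<W> :: "(nat \<Rightarrow> real) set"
  assumes fin: "finite \<W>" and card: "real (card \<W>) \<le> d" and n: "1 \<le> n"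
    and nonneg: "\<And>x k. x \<in> \<W> \<Longrightarrow> k \<in> {1..n} \<Longrightarrow> 0 \<le> x k"
    and V: "\<And>x. x \<in> \<W> \<Longrightarrow> 0 < (\<Sum>k\<in>{1..n}. (x k)\<^sup>2)"
    and spread: "\<And>x. x \<in> \<W> \<Longrightarrow> g * sqrt n * (\<Sum>k\<in>{1..n}. (x k)\<^sup>2) \<le> (\<Sum>k\<in>{1..n}. x k)\<^sup>2"
  shows "real (card {P \<in> balanced_partitions n. \<exists>x\<in>\<W>. \<exists>T\<in>parts P. (\<Sum>k\<in>T. x k) < (\<Sum>k\<in>{1..n}. x k) / 5})
    \<le> d * (3 * (real n + 1)\<^sup>2 * exp (- 2 * g * sqrt n / 75)) * real (card (balanced_partitions n))"
proof -
  define Bad where "Bad x = {P \<in> balanced_partitions n. \<exists>T\<in>parts P. (\<Sum>k\<in>T. x k) < (\<Sum>k\<in>{1..n}. x k) / 5}" for x :: "nat \<Rightarrow> real"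
  define c where "c = 3 * (real n + 1)\<^sup>2 * exp (- 2 * g * sqrt n / 75) * real (card (balanced_partitions n))"
  have le: "real (card (Bad x)) \<le> c" if x: "x \<in> \<W>" for x
  proof -
    let ?V = "\<Sum>k\<in>{1..n}. (x k)\<^sup>2" and ?X = "\<Sum>k\<in>{1..n}. x k"
    have "real (card (Bad x)) \<le> 3 * (real n + 1)\<^sup>2 * exp (- 2 * ?X\<^sup>2 / (75 * ?V)) * real (card (balanced_partitions n))"
      unfolding Bad_def by (rule balanced_partitions_tail[OF nonneg[OF x] V[OF x]])
    also have "\<dots> \<le> c"
    proof -
      have "g * sqrt n \<le> ?X\<^sup>2 / ?V" using spread[OF x] V[OF x] by (simp add: pos_le_divide_eq)
      then have "- 2 * ?X\<^sup>2 / (75 * ?V) \<le> - 2 * g * sqrt n / 75" by simp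
      then show ?thesis unfolding c_def by (intro mult_right_mono mult_left_mono) auto
    qed
    finally show ?thesis .
  qed
  have "{P \<in> balanced_partitions n. \<exists>x\<in>\<W>. \<exists>T\<in>parts P. (\<Sum>k\<in>T. x k) < (\<Sum>k\<in>{1..n}. x k) / 5} = (\<Union>x\<in>\<W>. Bad x)"
    unfolding Bad_def by auto
  moreover have "real (card (\<Union>x\<in>\<W>. Bad x)) \<le> real (\<Sum>x\<in>\<W>. card (Bad x))"
    using card_UN_le[OF fin, of Bad] by (simp only: of_nat_le_iff)
  ultimately have "real (card {P \<in> balanced_partitions n. \<exists>x\<in>\<W>. \<exists>T\<in>parts P. (\<Sum>k\<in>T. x k) < (\<Sum>k\<in>{1..n}. x k) / 5})
      \<le> real (\<Sum>x\<in>\<W>. card (Bad x))" by simp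
  also have "\<dots> \<le> (\<Sum>x\<in>\<W>. c)" unfolding of_nat_sum using le by (rule sum_mono)
  also have "\<dots> = real (card \<W>) * c" by simp
  also have "\<dots> \<le> d * c" using card unfolding c_def by (intro mult_right_mono) auto
  finally show ?thesis unfolding c_def by (simp add: mult.assoc)
qed

text \<open>The model expressed through the ranks \<open>\<psi>\<close> of the rows of the noiseless
  matrix, in a form that is invariant under reversing the ranks. The same locale then serves for
  whichever order the first stage recovers. Distances are squared and multiplied by \<open>n\<close>
  so that they compare with squared rank gaps.\<close>

locale seriation =
  fixes n :: nat and \<psi> :: "nat \<Rightarrow> nat" and G :: "nat \<Rightarrow> nat \<Rightarrow> real" and \<alpha> \<beta> r r' :: real
  assumes pos: "0 < \<alpha>" "0 < \<beta>" "0 < r" "0 < r'"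
    and bij: "bij_betw \<psi> {1..n} {1..n}"
    and G01: "\<And>i j. i \<in> {1..n} \<Longrightarrow> j \<in> {1..n} \<Longrightarrow> 0 \<le> G i j \<and> G i j \<le> 1"
    and mono_left: "\<And>i j k. i \<in> {1..n} \<Longrightarrow> j \<in> {1..n} \<Longrightarrow> k \<in> {1..n} \<Longrightarrow>
          \<psi> k \<le> \<psi> i \<Longrightarrow> \<psi> i < \<psi> j \<Longrightarrow> G j k \<le> G i k"
    and mono_right: "\<And>i j k. i \<in> {1..n} \<Longrightarrow> j \<in> {1..n} \<Longrightarrow> k \<in> {1..n} \<Longrightarrow>
          \<psi> i < \<psi> j \<Longrightarrow> \<psi> j \<le> \<psi> k \<Longrightarrow> G i k \<le> G j k"
    and lipschitz: "\<And>i j. i \<in> {1..n} \<Longrightarrow> j \<in> {1..n} \<Longrightarrow> \<psi> i < \<psi> j \<Longrightarrow> real (\<psi> j) - real (\<psi> i) \<le> r * n \<Longrightarrow>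
          real n * (\<Sum>k\<in>{1..n}. (G i k - G j k)\<^sup>2) \<le> (\<beta> * (real (\<psi> j) - real (\<psi> i)))\<^sup>2"
    and signal: "\<And>i j. i \<in> {1..n} \<Longrightarrow> j \<in> {1..n} \<Longrightarrow> \<psi> i < \<psi> j \<Longrightarrow> real (\<psi> j) - real (\<psi> i) \<le> r * n \<Longrightarrow>
          \<alpha> * (real (\<psi> j) - real (\<psi> i)) \<le>
          max (\<Sum>k | k \<in> {1..n} \<and> real (\<psi> k) < real (\<psi> i) - real n / 32. G i k - G j k)
              (\<Sum>k | k \<in> {1..n} \<and> real (\<psi> k) > real (\<psi> j) + real n / 32. G j k - G i k)"
    and separated: "\<And>i j. i \<in> {1..n} \<Longrightarrow> j \<in> {1..n} \<Longrightarrow> \<bar>real (\<psi> i) - real (\<psi> j)\<bar> > r * n \<Longrightarrow>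
          r'\<^sup>2 * real n \<le> (\<Sum>k\<in>{1..n}. (G i k - G j k)\<^sup>2)"
begin

lemma range: "i \<in> {1..n} \<Longrightarrow> 1 \<le> \<psi> i \<and> \<psi> i \<le> n"
  using bij_betwE[OF bij] by simp

lemma inj: "i \<in> {1..n} \<Longrightarrow> j \<in> {1..n} \<Longrightarrow> \<psi> i = \<psi> j \<longleftrightarrow> i = j"
  by (rule inj_on_eq_iff[OF bij_betw_imp_inj_on[OF bij]])

text \<open>The last clause has two uses: it supplies the near row in the distance estimate on
  \<open>T\<close>, and it guarantees that an index outside \<open>T\<close> has a close proxy in
  \<open>T\<close>.\<close>

definition part_good :: "nat set \<Rightarrow> bool" where
  "part_good T \<longleftrightarrow>
    (\<forall>i\<in>{1..n}. \<forall>j\<in>{1..n}. \<psi> i < \<psi> j \<longrightarrow> real (\<psi> j) - real (\<psi> i) \<le> r * n \<longrightarrow>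
        \<alpha> / 5 * (real (\<psi> j) - real (\<psi> i)) \<le>
          max (\<Sum>k | k \<in> T \<and> real (\<psi> k) < real (\<psi> i) - real n / 32. G i k - G j k)
              (\<Sum>k | k \<in> T \<and> real (\<psi> k) > real (\<psi> j) + real n / 32. G j k - G i k)) \<and>
    (\<forall>i\<in>{1..n}. \<forall>j\<in>{1..n}. \<bar>real (\<psi> i) - real (\<psi> j)\<bar> > r * n \<longrightarrow>
        r'\<^sup>2 * real n / 5 \<le> (\<Sum>k\<in>T. (G i k - G j k)\<^sup>2)) \<and>
    (\<forall>i\<in>{1..n}. \<exists>k\<in>T. k \<noteq> i \<and> \<bar>real (\<psi> k) - real (\<psi> i)\<bar> \<le> sqrt n)"

text \<open>A common lower bound, over all weights used below, for \<open>(\<Sum>x)\<^sup>2 / (sqrt n * \<Sum>x\<^sup>2)\<close>, the quantity in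
  the exponent of the Chernoff bound.\<close>

definition "spread_const = min (\<alpha>\<^sup>2 / \<beta>\<^sup>2) (min (r'\<^sup>2) (1 / 2))"

lemma spread_const_pos: "0 < spread_const"
  using pos by (simp add: spread_const_def)

text \<open>A maximum of two sums is not linear in the column set. The side that attains the bound
  on all columns is therefore fixed once for each pair, which leaves one nonnegative weight to which
  the tail bound applies.\<close>

definition signal_weight :: "nat \<times> nat \<Rightarrow> nat \<Rightarrow> real" where
  "signal_weight = (\<lambda>(i, j) k.
     if \<alpha> * (real (\<psi> j) - real (\<psi> i)) \<le> (\<Sum>k | k \<in> {1..n} \<and> real (\<psi> k) < real (\<psi> i) - real n / 32. G i k - G j k)
     then (if real (\<psi> k) < real (\<psi> i) - real n / 32 then G i k - G j k else 0)
     else (if real (\<psi> k) > real (\<psi> j) + real n / 32 then G j k - G i k else 0))"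

definition square_weight :: "nat \<times> nat \<Rightarrow> nat \<Rightarrow> real" where
  "square_weight = (\<lambda>(i, j) k. (G i k - G j k)\<^sup>2)"

text \<open>The window lies on one side of \<open>i\<close>, to the right if there is room and to
  the left otherwise. It thus keeps its full size near the ends and does not contain
  \<open>i\<close>.\<close>

definition window :: "nat \<Rightarrow> nat set" where
  "window i = {k \<in> {1..n}. if \<psi> i + nat \<lfloor>sqrt n\<rfloor> \<le> n then \<psi> i < \<psi> k \<and> \<psi> k \<le> \<psi> i + nat \<lfloor>sqrt n\<rfloor>
       else \<psi> k < \<psi> i \<and> \<psi> i \<le> \<psi> k + nat \<lfloor>sqrt n\<rfloor>}"

definition window_weight :: "nat \<Rightarrow> nat \<Rightarrow> real" where
  "window_weight i k = of_bool (k \<in> window i)"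

definition weights :: "(nat \<Rightarrow> real) set" where
  "weights =
    signal_weight ` {(i, j). i \<in> {1..n} \<and> j \<in> {1..n} \<and> \<psi> i < \<psi> j \<and> real (\<psi> j) - real (\<psi> i) \<le> r * n} \<union>
    square_weight ` {(i, j). i \<in> {1..n} \<and> j \<in> {1..n} \<and> \<bar>real (\<psi> i) - real (\<psi> j)\<bar> > r * n} \<union>
    window_weight ` {1..n}"

lemma weights_card: "finite weights" "real (card weights) \<le> 2 * (real n)\<^sup>2 + real n"
proof -
  have sub: "{(i, j). i \<in> {1..n} \<and> j \<in> {1..n} \<and> \<psi> i < \<psi> j \<and> real (\<psi> j) - real (\<psi> i) \<le> r * n} \<subseteq> {1..n} \<times> {1..n}" (is "?A \<subseteq> _")
    "{(i, j). i \<in> {1..n} \<and> j \<in> {1..n} \<and> \<bar>real (\<psi> i) - real (\<psi> j)\<bar> > r * n} \<subseteq> {1..n} \<times> {1..n}" (is "?B \<subseteq> _")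
    by auto
  have fin: "finite ?A" "finite ?B" using sub by (auto intro: finite_subset)
  then show "finite weights" unfolding weights_def by auto
  have "card ?A \<le> n * n" "card ?B \<le> n * n"
    using card_mono[OF _ sub(1)] card_mono[OF _ sub(2)] by (auto simp: card_cartesian_product)
  then have c: "card (signal_weight ` ?A) \<le> n * n" "card (square_weight ` ?B) \<le> n * n" "card (window_weight ` {1..n}) \<le> n"
    using card_image_le[OF fin(1), of signal_weight] card_image_le[OF fin(2), of square_weight]
      card_image_le[of "{1..n}" window_weight] by auto
  have "card weights \<le> card (signal_weight ` ?A \<union> square_weight ` ?B) + card (window_weight ` {1..n})"
    unfolding weights_def by (rule card_Un_le)
  also have "card (signal_weight ` ?A \<union> square_weight ` ?B) \<le> card (signal_weight ` ?A) + card (square_weight ` ?B)"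
    by (rule card_Un_le)
  finally have "card weights \<le> n * n + n * n + n" using c by linarith
  then have "real (card weights) \<le> real (n * n + n * n + n)" by (simp only: of_nat_le_iff)
  then show "real (card weights) \<le> 2 * (real n)\<^sup>2 + real n" by (simp add: power2_eq_square)
qed

text \<open>Signal and square weights concentrate at rate \<open>n\<close>, windows only at rate
  \<open>sqrt n\<close>; the former are weakened to the common rate.\<close>

lemma spread_from_ge:
  assumes "0 \<le> V" "1 \<le> n" "y * real n * V \<le> X" "spread_const \<le> y" "0 \<le> y"
  shows "spread_const * sqrt n * V \<le> X"
proof -
  have "sqrt (real n) \<le> real n" using assms(2) by (simp add: real_le_lsqrt power2_eq_square)
  then have "spread_const * sqrt n * V \<le> y * real n * V"
    using assms spread_const_pos by (intro mult_right_mono mult_mono) auto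
  then show ?thesis using assms(3) by linarith
qed

lemma sum_square_le_sum:
  assumes "\<And>k. k \<in> I \<Longrightarrow> 0 \<le> x k \<and> x k \<le> (1::real)"
  shows "(\<Sum>k\<in>I. (x k)\<^sup>2) \<le> (\<Sum>k\<in>I. x k)"
  using assms by (intro sum_mono) (simp add: power2_eq_square mult_left_le)

lemma sum_square_pos:
  assumes "0 < (\<Sum>k\<in>I. x k)" "finite I"
  shows "0 < (\<Sum>k\<in>I. (x k :: real)\<^sup>2)"
proof -
  obtain k where "k \<in> I" "x k \<noteq> 0" using assms by (metis less_irrefl sum.neutral)
  then show ?thesis using assms(2) by (intro sum_pos2[of I k]) auto
qed

text \<open>The total weight is at least \<open>\<alpha>\<close> times the gap, while the Lipschitz
  condition bounds the sum of squares by \<open>\<beta>\<^sup>2 / n\<close> times the squared gap.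
  The gap cancels in the ratio, so the concentration is uniform over all pairs, even adjacent
  ones.\<close>

lemma signal_weight_props:
  assumes ij: "i \<in> {1..n}" "j \<in> {1..n}" "\<psi> i < \<psi> j" "real (\<psi> j) - real (\<psi> i) \<le> r * n" and n: "1 \<le> n"
  defines "x \<equiv> signal_weight (i, j)"
  shows "\<And>k. k \<in> {1..n} \<Longrightarrow> 0 \<le> x k"
    "0 < (\<Sum>k\<in>{1..n}. (x k)\<^sup>2)" "spread_const * sqrt n * (\<Sum>k\<in>{1..n}. (x k)\<^sup>2) \<le> (\<Sum>k\<in>{1..n}. x k)\<^sup>2"
    "\<alpha> * (real (\<psi> j) - real (\<psi> i)) \<le> (\<Sum>k\<in>{1..n}. x k)"
    "T \<subseteq> {1..n} \<Longrightarrow> (\<Sum>k\<in>T. x k) \<le> max (\<Sum>k | k \<in> T \<and> real (\<psi> k) < real (\<psi> i) - real n / 32. G i k - G j k)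
              (\<Sum>k | k \<in> T \<and> real (\<psi> k) > real (\<psi> j) + real n / 32. G j k - G i k)"
proof -
  let ?d = "real (\<psi> j) - real (\<psi> i)"
  have d: "0 < ?d" using ij by simp
  show nn: "0 \<le> x k" if "k \<in> {1..n}" for k
    using mono_left[OF ij(1,2) that _ ij(3)] mono_right[OF ij(1,2) that ij(3)] n
    unfolding x_def signal_weight_def by auto
  have eqL: "(\<Sum>k | k \<in> T \<and> real (\<psi> k) < real (\<psi> i) - real n / 32. G i k - G j k)
      = (\<Sum>k\<in>T. if real (\<psi> k) < real (\<psi> i) - real n / 32 then G i k - G j k else 0)" if "finite T" for T
    using that by (rule sum.inter_filter)
  have eqR: "(\<Sum>k | k \<in> T \<and> real (\<psi> k) > real (\<psi> j) + real n / 32. G j k - G i k)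
      = (\<Sum>k\<in>T. if real (\<psi> k) > real (\<psi> j) + real n / 32 then G j k - G i k else 0)" if "finite T" for T
    using that by (rule sum.inter_filter)
  show X: "\<alpha> * ?d \<le> (\<Sum>k\<in>{1..n}. x k)"
  proof (cases "\<alpha> * ?d \<le> (\<Sum>k | k \<in> {1..n} \<and> real (\<psi> k) < real (\<psi> i) - real n / 32. G i k - G j k)")
    case True
    then show ?thesis unfolding x_def signal_weight_def using eqL[of "{1..n}"] by simp
  next
    case False
    then have "\<alpha> * ?d \<le> (\<Sum>k | k \<in> {1..n} \<and> real (\<psi> k) > real (\<psi> j) + real n / 32. G j k - G i k)"
      using signal[OF ij] by linarith
    then show ?thesis using False unfolding x_def signal_weight_def using eqR[of "{1..n}"] by simp
  qed
  have "0 < (\<Sum>k\<in>{1..n}. x k)" using X d pos by (smt (verit) mult_pos_pos)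
  then show Vpos: "0 < (\<Sum>k\<in>{1..n}. (x k)\<^sup>2)" by (rule sum_square_pos) simp
  have "(\<Sum>k\<in>{1..n}. (x k)\<^sup>2) \<le> (\<Sum>k\<in>{1..n}. (G i k - G j k)\<^sup>2)"
    unfolding x_def signal_weight_def by (intro sum_mono) (auto simp: power2_commute)
  then have "real n * (\<Sum>k\<in>{1..n}. (x k)\<^sup>2) \<le> (\<beta> * ?d)\<^sup>2"
    using lipschitz[OF ij] by (meson mult_left_mono of_nat_0_le_iff order_trans)
  then have "\<alpha>\<^sup>2 / \<beta>\<^sup>2 * (real n * (\<Sum>k\<in>{1..n}. (x k)\<^sup>2)) \<le> \<alpha>\<^sup>2 / \<beta>\<^sup>2 * (\<beta> * ?d)\<^sup>2"
    by (intro mult_left_mono) auto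
  also have "\<dots> = (\<alpha> * ?d)\<^sup>2" using pos by (simp add: power_mult_distrib)
  also have "\<dots> \<le> (\<Sum>k\<in>{1..n}. x k)\<^sup>2" using X d pos by (intro power_mono) auto
  finally show "spread_const * sqrt n * (\<Sum>k\<in>{1..n}. (x k)\<^sup>2) \<le> (\<Sum>k\<in>{1..n}. x k)\<^sup>2"
    using Vpos n by (intro spread_from_ge[where y = "\<alpha>\<^sup>2 / \<beta>\<^sup>2"]) (auto simp: spread_const_def mult.assoc)
  assume "T \<subseteq> {1..n}"
  then have T: "finite T" by (rule finite_subset) simp
  show "(\<Sum>k\<in>T. x k) \<le> max (\<Sum>k | k \<in> T \<and> real (\<psi> k) < real (\<psi> i) - real n / 32. G i k - G j k)
              (\<Sum>k | k \<in> T \<and> real (\<psi> k) > real (\<psi> j) + real n / 32. G j k - G i k)"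
    unfolding eqL[OF T] eqR[OF T] x_def signal_weight_def
    by (cases "\<alpha> * ?d \<le> (\<Sum>k | k \<in> {1..n} \<and> real (\<psi> k) < real (\<psi> i) - real n / 32. G i k - G j k)")
      simp_all
qed

text \<open>These weights lie in the unit interval, so the sum of their squares is at most their
  sum, which is at least of order \<open>n\<close>.\<close>

lemma square_weight_props:
  assumes ij: "i \<in> {1..n}" "j \<in> {1..n}" "\<bar>real (\<psi> i) - real (\<psi> j)\<bar> > r * n" and n: "1 \<le> n"
  defines "x \<equiv> square_weight (i, j)"
  shows "0 < (\<Sum>k\<in>{1..n}. (x k)\<^sup>2)" "spread_const * sqrt n * (\<Sum>k\<in>{1..n}. (x k)\<^sup>2) \<le> (\<Sum>k\<in>{1..n}. x k)\<^sup>2"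
proof -
  have x: "(\<Sum>k\<in>{1..n}. x k) = (\<Sum>k\<in>{1..n}. (G i k - G j k)\<^sup>2)"
    unfolding x_def square_weight_def by simp
  have X: "r'\<^sup>2 * real n \<le> (\<Sum>k\<in>{1..n}. x k)" unfolding x using separated[OF ij] .
  moreover have "0 < r'\<^sup>2 * real n" using pos n by simp
  ultimately have "0 < (\<Sum>k\<in>{1..n}. x k)" by linarith
  then show "0 < (\<Sum>k\<in>{1..n}. (x k)\<^sup>2)" by (rule sum_square_pos) simp
  have V: "(\<Sum>k\<in>{1..n}. (x k)\<^sup>2) \<le> (\<Sum>k\<in>{1..n}. x k)"
  proof (rule sum_square_le_sum)
    fix k assume "k \<in> {1..n}"
    then have "\<bar>G i k - G j k\<bar> \<le> 1" using G01[OF ij(1), of k] G01[OF ij(2), of k] by (auto simp: abs_le_iff)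
    then show "0 \<le> x k \<and> x k \<le> 1" unfolding x_def square_weight_def by (simp add: abs_square_le_1)
  qed
  have "r'\<^sup>2 * real n * (\<Sum>k\<in>{1..n}. (x k)\<^sup>2) \<le> (\<Sum>k\<in>{1..n}. x k) * (\<Sum>k\<in>{1..n}. x k)"
    using X V \<open>0 < (\<Sum>k\<in>{1..n}. x k)\<close> by (intro mult_mono) (auto intro: sum_nonneg)
  then show "spread_const * sqrt n * (\<Sum>k\<in>{1..n}. (x k)\<^sup>2) \<le> (\<Sum>k\<in>{1..n}. x k)\<^sup>2"
    using n by (intro spread_from_ge[where y = "r'\<^sup>2"]) (auto simp: spread_const_def power2_eq_square[of "sum _ _"] intro: sum_nonneg)
qed

lemma window_card:
  assumes i: "i \<in> {1..n}" and n: "4 \<le> n"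
  shows "card (window i) = nat \<lfloor>sqrt n\<rfloor>"
proof -
  define w where "w = nat \<lfloor>sqrt n\<rfloor>"
  have "sqrt (real n) * 2 \<le> sqrt (real n) * sqrt (real n)"
    using n by (intro mult_left_mono real_le_rsqrt) auto
  then have "2 * sqrt (real n) \<le> real n" by simp
  \<comment> \<open>If the window does not fit on the right, then
    \<open>\<psi> i > n - w \<ge> w\<close>, so it fits on the left.\<close>
  then have w: "2 * w \<le> n" unfolding w_def by linarith
  define J where "J = (if \<psi> i + w \<le> n then {\<psi> i<..\<psi> i + w} else {\<psi> i - w..<\<psi> i})"
  have Jn: "J \<subseteq> {1..n}" and cJ: "card J = w"
    unfolding J_def using range[OF i] w by auto
  have win: "window i = {k \<in> {1..n}. \<psi> k \<in> J}"
    unfolding window_def J_def w_def[symmetric] by auto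
  have "\<psi> ` window i = J"
  proof (intro equalityI subsetI)
    fix y assume y: "y \<in> J"
    then obtain k where "k \<in> {1..n}" "\<psi> k = y"
      using Jn bij_betw_imp_surj_on[OF bij] by (metis imageE subsetD)
    then show "y \<in> \<psi> ` window i" using y unfolding win by auto
  qed (auto simp: win)
  moreover have "card (\<psi> ` window i) = card (window i)"
    using bij_betw_imp_inj_on[OF bij] by (intro card_image) (auto simp: win intro: inj_on_subset)
  ultimately show ?thesis using cJ unfolding w_def by simp
qed

lemma window_weight_props:
  assumes i: "i \<in> {1..n}" and n: "4 \<le> n"
  defines "x \<equiv> window_weight i"
  shows "0 < (\<Sum>k\<in>{1..n}. x k)" "0 < (\<Sum>k\<in>{1..n}. (x k)\<^sup>2)"
    "spread_const * sqrt n * (\<Sum>k\<in>{1..n}. (x k)\<^sup>2) \<le> (\<Sum>k\<in>{1..n}. x k)\<^sup>2"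
proof -
  have sub: "window i \<subseteq> {1..n}" unfolding window_def by auto
  have X: "(\<Sum>k\<in>{1..n}. x k) = real (nat \<lfloor>sqrt n\<rfloor>)"
    using window_card[OF i n] sub unfolding x_def window_weight_def
    by (simp add: of_bool_def sum.If_cases Int_absorb1)
  have V: "(\<Sum>k\<in>{1..n}. (x k)\<^sup>2) = (\<Sum>k\<in>{1..n}. x k)"
    unfolding x_def window_weight_def by (intro sum.cong) (auto simp: of_bool_def)
  have s2: "2 \<le> sqrt (real n)" using n by (intro real_le_rsqrt) auto
  then have w: "sqrt n / 2 \<le> real (nat \<lfloor>sqrt n\<rfloor>)" by linarith
  then show P: "0 < (\<Sum>k\<in>{1..n}. x k)" "0 < (\<Sum>k\<in>{1..n}. (x k)\<^sup>2)" unfolding V X using s2 by linarith+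
  have "spread_const \<le> 1 / 2" unfolding spread_const_def by (meson min.cobounded2 order_trans)
  then have "spread_const * sqrt n \<le> 1 / 2 * sqrt n"
    by (intro mult_right_mono) auto
  then have "spread_const * sqrt n \<le> real (nat \<lfloor>sqrt n\<rfloor>)" using w by simp
  then show "spread_const * sqrt n * (\<Sum>k\<in>{1..n}. (x k)\<^sup>2) \<le> (\<Sum>k\<in>{1..n}. x k)\<^sup>2"
    unfolding V unfolding X power2_eq_square by (intro mult_right_mono) auto
qed

lemma part_good_from_weights:
  assumes n: "4 \<le> n" and T: "T \<subseteq> {1..n}"
    and W: "\<And>x. x \<in> weights \<Longrightarrow> (\<Sum>k\<in>{1..n}. x k) / 5 \<le> (\<Sum>k\<in>T. x k)"
  shows "part_good T"
  unfolding part_good_def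
proof (intro conjI ballI impI)
  have n1: "1 \<le> n" using n by simp
  fix i j assume ij: "i \<in> {1..n}" "j \<in> {1..n}" "\<psi> i < \<psi> j" "real (\<psi> j) - real (\<psi> i) \<le> r * n"
  then have "signal_weight (i, j) \<in> weights" unfolding weights_def by auto
  from W[OF this] signal_weight_props(4)[OF ij n1] signal_weight_props(5)[OF ij n1 T]
  show "\<alpha> / 5 * (real (\<psi> j) - real (\<psi> i)) \<le>
          max (\<Sum>k | k \<in> T \<and> real (\<psi> k) < real (\<psi> i) - real n / 32. G i k - G j k)
              (\<Sum>k | k \<in> T \<and> real (\<psi> k) > real (\<psi> j) + real n / 32. G j k - G i k)" by linarith
next
  fix i j assume ij: "i \<in> {1..n}" "j \<in> {1..n}" "\<bar>real (\<psi> i) - real (\<psi> j)\<bar> > r * n"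
  then have "square_weight (i, j) \<in> weights" unfolding weights_def by auto
  from W[OF this] separated[OF ij] show "r'\<^sup>2 * real n / 5 \<le> (\<Sum>k\<in>T. (G i k - G j k)\<^sup>2)"
    unfolding square_weight_def by simp
next
  fix i assume i: "i \<in> {1..n}"
  then have "window_weight i \<in> weights" unfolding weights_def by auto
  from W[OF this] window_weight_props(1)[OF i n] have "0 < (\<Sum>k\<in>T. window_weight i k)" by linarith
  then obtain k where k: "k \<in> T" "window_weight i k \<noteq> 0" by (metis less_irrefl sum.neutral)
  then have "k \<in> window i" unfolding window_weight_def by (auto simp: of_bool_def split: if_splits)
  moreover have "real (nat \<lfloor>sqrt n\<rfloor>) \<le> sqrt n" by simp
  ultimately have "k \<noteq> i" "\<bar>real (\<psi> k) - real (\<psi> i)\<bar> \<le> sqrt n"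
    unfolding window_def by (auto split: if_splits, linarith+)
  then show "\<exists>k\<in>T. k \<noteq> i \<and> \<bar>real (\<psi> k) - real (\<psi> i)\<bar> \<le> sqrt n" using k by auto
qed

lemma part_good_fraction:
  assumes n: "4 \<le> n"
  shows "real (card {P \<in> balanced_partitions n. \<not> (\<forall>T\<in>parts P. part_good T)})
    \<le> (2 * (real n)\<^sup>2 + real n) * (3 * (real n + 1)\<^sup>2 * exp (- 2 * spread_const * sqrt n / 75))
       * real (card (balanced_partitions n))"
proof -
  have n1: "1 \<le> n" using n by simp
  have "{P \<in> balanced_partitions n. \<not> (\<forall>T\<in>parts P. part_good T)}
    \<subseteq> {P \<in> balanced_partitions n. \<exists>x\<in>weights. \<exists>T\<in>parts P. (\<Sum>k\<in>T. x k) < (\<Sum>k\<in>{1..n}. x k) / 5}"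
    using part_good_from_weights[OF n parts_subset] by (force simp: not_less)
  then have "card {P \<in> balanced_partitions n. \<not> (\<forall>T\<in>parts P. part_good T)}
    \<le> card {P \<in> balanced_partitions n. \<exists>x\<in>weights. \<exists>T\<in>parts P. (\<Sum>k\<in>T. x k) < (\<Sum>k\<in>{1..n}. x k) / 5}"
    by (intro card_mono) (auto intro: finite_subset[OF _ finite_balanced_partitions])
  then have "real (card {P \<in> balanced_partitions n. \<not> (\<forall>T\<in>parts P. part_good T)})
    \<le> real (card {P \<in> balanced_partitions n. \<exists>x\<in>weights. \<exists>T\<in>parts P. (\<Sum>k\<in>T. x k) < (\<Sum>k\<in>{1..n}. x k) / 5})"
    by simp
  also have "\<dots> \<le> (2 * (real n)\<^sup>2 + real n) * (3 * (real n + 1)\<^sup>2 * exp (- 2 * spread_const * sqrt n / 75))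
       * real (card (balanced_partitions n))"
  proof (rule balanced_partitions_union[OF weights_card n1])
    fix x assume "x \<in> weights"
    then consider (a) i j where "x = signal_weight (i, j)" "i \<in> {1..n}" "j \<in> {1..n}" "\<psi> i < \<psi> j" "real (\<psi> j) - real (\<psi> i) \<le> r * n"
      | (b) i j where "x = square_weight (i, j)" "i \<in> {1..n}" "j \<in> {1..n}" "\<bar>real (\<psi> i) - real (\<psi> j)\<bar> > r * n"
      | (c) i where "x = window_weight i" "i \<in> {1..n}"
      unfolding weights_def by auto
    then have "(\<forall>k\<in>{1..n}. 0 \<le> x k) \<and> 0 < (\<Sum>k\<in>{1..n}. (x k)\<^sup>2) \<and>
      spread_const * sqrt n * (\<Sum>k\<in>{1..n}. (x k)\<^sup>2) \<le> (\<Sum>k\<in>{1..n}. x k)\<^sup>2"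
    proof cases
      case a
      then show ?thesis using signal_weight_props(1-3)[OF a(2-5) n1] by simp
    next
      case b
      then show ?thesis using square_weight_props[OF b(2-4) n1] by (simp add: square_weight_def)
    next
      case c
      then show ?thesis using window_weight_props(2,3)[OF c(2) n] by (simp add: window_weight_def)
    qed
    then show "\<And>k. k \<in> {1..n} \<Longrightarrow> 0 \<le> x k" "0 < (\<Sum>k\<in>{1..n}. (x k)\<^sup>2)"
      "spread_const * sqrt n * (\<Sum>k\<in>{1..n}. (x k)\<^sup>2) \<le> (\<Sum>k\<in>{1..n}. x k)\<^sup>2" by auto
  qed
  finally show ?thesis .
qed

end

section \<open>Thresholds for large n\<close>

text \<open>The first two lines restate \<open>embedded_distance\<close> together with the bound 24.
  In the remaining ones \<open>(\<delta>3 + \<omega>) / a + 1\<close> bounds the gap of an undecided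
  pair and \<open>(b * sqrt n + 2 * \<omega>) / a\<close> the gap from an index to its proxy. They
  ensure that an estimated distance of \<open>\<delta>4\<close> means being far from both compared
  indices, that the signal columns reach this distance on the correct side of the proxy, and that
  undecided pairs fall in the Lipschitz range.\<close>

definition large_enough :: "real \<Rightarrow> real \<Rightarrow> real \<Rightarrow> nat \<Rightarrow> real \<Rightarrow> real \<Rightarrow> real \<Rightarrow> real \<Rightarrow> real \<Rightarrow> bool" where
  "large_enough a b r n \<omega> \<delta>1 \<delta>2 \<delta>3 \<delta>4 \<longleftrightarrow>
    24 \<le> n \<and> b + \<omega> \<le> \<delta>1 \<and> (\<delta>1 + \<omega>) / a * b < \<delta>2 - \<omega> \<and> (\<delta>2 + \<omega>) / a \<le> (\<delta>3 - \<omega>) / b \<and> \<delta>2 \<le> \<delta>3 \<and>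
    (\<delta>3 + \<omega>) / a + 2 * ((\<delta>2 + \<omega>) / a) + 5 \<le> real n / 2 \<and>
    2 * ((\<delta>3 + \<omega>) / a + 1) + (b * sqrt n + 2 * \<omega>) / a \<le> (\<delta>4 - \<omega>) / b \<and>
    \<delta>4 \<le> a * (real n / 32 - ((\<delta>3 + \<omega>) / a + 1 + (b * sqrt n + 2 * \<omega>) / a)) - \<omega> \<and>
    2 * ((\<delta>3 + \<omega>) / a + 1 + (b * sqrt n + 2 * \<omega>) / a) < real n / 32 \<and>
    (\<delta>3 + \<omega>) / a + 1 \<le> r * real n"

lemma eventually_large_enough:
  fixes a b r c :: real
  assumes pos: "a > 0" "b > 0" "r > 0" "c > 0"
  defines "\<omega> \<equiv> \<lambda>n::nat. c * (real n powr (3/4) * sqrt (ln n))"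
  defines "\<delta> \<equiv> \<lambda>k::nat. \<lambda>n::nat. real n powr (3/4) * ln n ^ k"
  shows "\<forall>\<^sub>F n in sequentially. large_enough a b r n (\<omega> n) (\<delta> 1 n) (\<delta> 2 n) (\<delta> 3 n) (\<delta> 4 n)"
proof -
  define p q where "p = 1 / a" and "q = 1 / b"
  have pq: "p > 0" "q > 0" using pos by (simp_all add: p_def q_def)
  have "\<forall>\<^sub>F n in sequentially. b + \<omega> n \<le> \<delta> 1 n"
    using pos unfolding \<omega>_def \<delta>_def by real_asymp
  moreover have "\<forall>\<^sub>F n in sequentially. (\<delta> 1 n + \<omega> n) * p * b < \<delta> 2 n - \<omega> n"
    using pos pq unfolding \<omega>_def \<delta>_def by real_asymp
  moreover have "\<forall>\<^sub>F n in sequentially. (\<delta> 2 n + \<omega> n) * p \<le> (\<delta> 3 n - \<omega> n) * q"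
    using pos pq unfolding \<omega>_def \<delta>_def by real_asymp
  moreover have "\<forall>\<^sub>F n in sequentially. \<delta> 2 n \<le> \<delta> 3 n"
    unfolding \<delta>_def by real_asymp
  moreover have "\<forall>\<^sub>F n in sequentially. (\<delta> 3 n + \<omega> n) * p + 2 * ((\<delta> 2 n + \<omega> n) * p) + 5 \<le> real n / 2"
    using pos pq unfolding \<omega>_def \<delta>_def by real_asymp
  moreover have "\<forall>\<^sub>F n in sequentially.
      2 * ((\<delta> 3 n + \<omega> n) * p + 1) + (b * sqrt n + 2 * \<omega> n) * p \<le> (\<delta> 4 n - \<omega> n) * q"
    using pos pq unfolding \<omega>_def \<delta>_def by real_asymp
  moreover have "\<forall>\<^sub>F n in sequentially.
      \<delta> 4 n \<le> a * (real n / 32 - ((\<delta> 3 n + \<omega> n) * p + 1 + (b * sqrt n + 2 * \<omega> n) * p)) - \<omega> n"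
    using pos pq unfolding \<omega>_def \<delta>_def by real_asymp
  moreover have "\<forall>\<^sub>F n in sequentially.
      2 * ((\<delta> 3 n + \<omega> n) * p + 1 + (b * sqrt n + 2 * \<omega> n) * p) < real n / 32"
    using pos pq unfolding \<omega>_def \<delta>_def by real_asymp
  moreover have "\<forall>\<^sub>F n in sequentially. (\<delta> 3 n + \<omega> n) * p + 1 \<le> r * real n"
    using pos pq unfolding \<omega>_def \<delta>_def by real_asymp
  ultimately show ?thesis
    using eventually_ge_at_top[of 24]
    by eventually_elim (simp add: large_enough_def p_def q_def)
qed

lemma eventually_failure_small:
  fixes g :: real
  assumes "g > 0"
  shows "\<forall>\<^sub>F n::nat in sequentially.
    (2 * (real n)\<^sup>2 + real n) * (3 * (real n + 1)\<^sup>2 * exp (- 2 * g * sqrt n / 75)) + 38 / real n ^ 3 \<le> 1 / (real n)\<^sup>2"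
  using assms by real_asymp

section \<open>Deterministic error bound\<close>

lemma sgn_diff_swap: "sgn (x - y) = - sgn (y - x :: real)"
  by (simp add: sgn_if)

context seriation
begin

text \<open>Constants comparing \<open>sqrt n\<close> times a row distance with the rank gap. Beyond
  gap \<open>r * n\<close> the local condition is silent, but there the row distance is of full
  order \<open>sqrt n\<close> and the gap of order \<open>n\<close>; this brings in
  \<open>r'\<close> and \<open>1 / r\<close>. The divisor 5 is the loss when restricting to a
  part.\<close>

definition "lower = min \<alpha> r' / 5"
definition "upper = max \<beta> (1 / r)"

lemma lower_upper_pos: "0 < lower" "0 < upper"
  using pos by (simp_all add: lower_def upper_def)

lemma row_distance_upper:
  assumes S: "S \<subseteq> {1..n}" and ij: "i \<in> {1..n}" "j \<in> {1..n}"
  shows "real n * (\<Sum>k\<in>S. (G i k - G j k)\<^sup>2) \<le> (upper * \<bar>real (\<psi> i) - real (\<psi> j)\<bar>)\<^sup>2"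
proof -
  have *: "real n * (\<Sum>k\<in>{1..n}. (G i k - G j k)\<^sup>2) \<le> (upper * (real (\<psi> j) - real (\<psi> i)))\<^sup>2"
    if ij: "i \<in> {1..n}" "j \<in> {1..n}" "\<psi> i < \<psi> j" for i j
  proof (cases "real (\<psi> j) - real (\<psi> i) \<le> r * n")
    case True
    have "(\<beta> * (real (\<psi> j) - real (\<psi> i)))\<^sup>2 \<le> (upper * (real (\<psi> j) - real (\<psi> i)))\<^sup>2"
      using pos ij by (intro power_mono mult_right_mono) (auto simp: upper_def)
    then show ?thesis using lipschitz[OF ij True] by linarith
  next
    case False
    have "(\<Sum>k\<in>{1..n}. (G i k - G j k)\<^sup>2) \<le> real (card {1..n})"
      using G01 ij by (intro sum_sq_diff_le_card) auto
    then have "real n * (\<Sum>k\<in>{1..n}. (G i k - G j k)\<^sup>2) \<le> (real n)\<^sup>2"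
      unfolding power2_eq_square by (intro mult_left_mono) auto
    also have "\<dots> \<le> (upper * (real (\<psi> j) - real (\<psi> i)))\<^sup>2"
    proof (rule power_mono)
      have "real n \<le> 1 / r * (real (\<psi> j) - real (\<psi> i))" using False pos by (simp add: field_simps)
      also have "\<dots> \<le> upper * (real (\<psi> j) - real (\<psi> i))"
        using ij by (intro mult_right_mono) (auto simp: upper_def)
      finally show "real n \<le> upper * (real (\<psi> j) - real (\<psi> i))" .
    qed simp
    finally show ?thesis .
  qed
  have "real n * (\<Sum>k\<in>S. (G i k - G j k)\<^sup>2) \<le> real n * (\<Sum>k\<in>{1..n}. (G i k - G j k)\<^sup>2)"
    using S by (intro mult_left_mono sum_mono2) auto
  also have "\<dots> \<le> (upper * \<bar>real (\<psi> i) - real (\<psi> j)\<bar>)\<^sup>2"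
  proof -
    consider "i = j" | "\<psi> i < \<psi> j" | "\<psi> j < \<psi> i" using inj[OF ij] by linarith
    then show ?thesis
    proof cases
      case 2
      then show ?thesis using *[OF ij] by (simp add: abs_if)
    next
      case 3
      then show ?thesis using *[OF ij(2,1)] by (simp add: abs_if power2_commute)
    qed simp
  qed
  finally show ?thesis .
qed

text \<open>For pairs in the Lipschitz range, Cauchy-Schwarz bounds the signal sum by
  \<open>sqrt n\<close> times the row distance on \<open>T\<close>, so the signal condition itself
  yields separation of rows. Beyond it, the separation condition takes over.\<close>

lemma row_distance_lower:
  assumes T: "T \<subseteq> S" "S \<subseteq> {1..n}" "part_good T" and ij: "i \<in> {1..n}" "j \<in> {1..n}"
  shows "(lower * \<bar>real (\<psi> i) - real (\<psi> j)\<bar>)\<^sup>2 \<le> real n * (\<Sum>k\<in>S. (G i k - G j k)\<^sup>2)"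
proof -
  have Tn: "T \<subseteq> {1..n}" using T(1,2) by (rule order_trans)
  then have finT: "finite T" by (rule finite_subset) simp
  have cT: "card T \<le> n" using card_mono[OF _ Tn] by simp
  have *: "(lower * (real (\<psi> j) - real (\<psi> i)))\<^sup>2 \<le> real n * (\<Sum>k\<in>T. (G i k - G j k)\<^sup>2)"
    if ij: "i \<in> {1..n}" "j \<in> {1..n}" "\<psi> i < \<psi> j" for i j
  proof (cases "real (\<psi> j) - real (\<psi> i) \<le> r * n")
    case True
    let ?d = "real (\<psi> j) - real (\<psi> i)"
    have cs: "(\<Sum>k\<in>U. u k)\<^sup>2 \<le> real n * (\<Sum>k\<in>T. (G i k - G j k)\<^sup>2)"
      if U: "U \<subseteq> T" and u: "\<And>k. (u k)\<^sup>2 = (G i k - G j k)\<^sup>2" for U and u :: "nat \<Rightarrow> real"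
    proof -
      have "(\<Sum>k\<in>U. 1 * u k)\<^sup>2 \<le> (\<Sum>k\<in>U. 1\<^sup>2) * (\<Sum>k\<in>U. (u k)\<^sup>2)" by (rule Cauchy_Schwarz_ineq_sum)
      also have "\<dots> = real (card U) * (\<Sum>k\<in>U. (G i k - G j k)\<^sup>2)" unfolding u by simp
      also have "\<dots> \<le> real n * (\<Sum>k\<in>T. (G i k - G j k)\<^sup>2)"
        using U finT card_mono[OF finT U] cT by (intro mult_mono sum_mono2) (auto intro: sum_nonneg)
      finally show ?thesis by simp
    qed
    have "\<alpha> / 5 * ?d \<le> max (\<Sum>k | k \<in> T \<and> real (\<psi> k) < real (\<psi> i) - real n / 32. G i k - G j k)
              (\<Sum>k | k \<in> T \<and> real (\<psi> k) > real (\<psi> j) + real n / 32. G j k - G i k)"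
      using T(3) ij True unfolding part_good_def by blast
    then obtain U u where U: "U \<subseteq> T" "\<And>k. (u k)\<^sup>2 = (G i k - G j k)\<^sup>2" "\<alpha> / 5 * ?d \<le> (\<Sum>k\<in>U. u k)"
    proof (cases "\<alpha> / 5 * ?d \<le> (\<Sum>k | k \<in> T \<and> real (\<psi> k) < real (\<psi> i) - real n / 32. G i k - G j k)")
      case True
      then show ?thesis by (intro that[of "{k. k \<in> T \<and> real (\<psi> k) < real (\<psi> i) - real n / 32}" "\<lambda>k. G i k - G j k"]) auto
    next
      case False
      then show ?thesis using \<open>_ \<le> max _ _\<close>
        by (intro that[of "{k. k \<in> T \<and> real (\<psi> k) > real (\<psi> j) + real n / 32}" "\<lambda>k. G j k - G i k"])
          (auto simp: power2_commute le_max_iff_disj)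
    qed
    have "0 \<le> ?d" using ij by simp
    then have "lower * ?d \<le> \<alpha> / 5 * ?d" by (intro mult_right_mono) (auto simp: lower_def)
    then have "lower * ?d \<le> (\<Sum>k\<in>U. u k)" using U(3) by linarith
    then have "(lower * ?d)\<^sup>2 \<le> (\<Sum>k\<in>U. u k)\<^sup>2"
      using lower_upper_pos \<open>0 \<le> ?d\<close> by (intro power_mono) auto
    then show ?thesis using cs[OF U(1,2)] by linarith
  next
    case False
    have "r'\<^sup>2 * real n / 5 \<le> (\<Sum>k\<in>T. (G i k - G j k)\<^sup>2)"
      using T(3) ij False unfolding part_good_def by auto
    then have ge: "real n * (r'\<^sup>2 * real n / 5) \<le> real n * (\<Sum>k\<in>T. (G i k - G j k)\<^sup>2)"
      by (intro mult_left_mono) auto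
    have "lower * (real (\<psi> j) - real (\<psi> i)) \<le> r' / 5 * real n"
      using ij range[OF ij(1)] range[OF ij(2)] pos by (intro mult_mono) (auto simp: lower_def)
    then have "(lower * (real (\<psi> j) - real (\<psi> i)))\<^sup>2 \<le> (r' / 5 * real n)\<^sup>2"
      using lower_upper_pos ij by (intro power_mono) auto
    also have "\<dots> \<le> real n * (r'\<^sup>2 * real n / 5)"
    proof -
      have "0 \<le> r'\<^sup>2 * (real n)\<^sup>2" by simp
      then show ?thesis by (simp add: power2_eq_square field_simps)
    qed
    finally show ?thesis using ge by linarith
  qed
  have "(lower * \<bar>real (\<psi> i) - real (\<psi> j)\<bar>)\<^sup>2 \<le> real n * (\<Sum>k\<in>T. (G i k - G j k)\<^sup>2)"
  proof -
    consider "i = j" | "\<psi> i < \<psi> j" | "\<psi> j < \<psi> i" using inj[OF ij] by linarith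
    then show ?thesis
    proof cases
      case 2
      then show ?thesis using *[OF ij] by (simp add: abs_if)
    next
      case 3
      then show ?thesis using *[OF ij(2,1)] by (simp add: abs_if power2_commute)
    qed simp
  qed
  also have "\<dots> \<le> real n * (\<Sum>k\<in>S. (G i k - G j k)\<^sup>2)"
    using T(1) finite_subset[OF T(2)] by (intro mult_left_mono sum_mono2) auto
  finally show ?thesis .
qed

text \<open>\<open>S\<close> is either a part or the full index set. In both cases one good part
  inside \<open>S\<close> supplies the near rows and the lower bound.\<close>

lemma estimate_distance_bounds:
  assumes n: "12 \<le> n" and T: "T \<subseteq> S" "S \<subseteq> {1..n}" "part_good T" "real n / 3 - 1 \<le> real (card T)"
    and tie: "valid_tie_rule tie" and A: "inner_good G e S A"
    and \<omega>: "sqrt (real n * (12 * e + 4 * (upper * sqrt n))) \<le> \<omega>"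
    and ij: "i \<in> S" "j \<in> S" "i \<noteq> j"
  shows "lower * \<bar>real (\<psi> i) - real (\<psi> j)\<bar> - \<omega> \<le> estimate_distance n tie A S i j"
    "estimate_distance n tie A S i j \<le> upper * \<bar>real (\<psi> i) - real (\<psi> j)\<bar> + \<omega>"
proof -
  let ?D = "sqrt (real n * (\<Sum>k\<in>S. (G i k - G j k)\<^sup>2))"
  have Sn: "k \<in> {1..n}" if "k \<in> S" for k using T(2) that by blast
  have cS: "3 \<le> card S"
  proof -
    have "3 \<le> card T" using T(4) n by linarith
    also have "card T \<le> card S" using T(1) finite_subset[OF T(2)] by (intro card_mono) auto
    finally show ?thesis .
  qed
  have near: "\<exists>i'\<in>S. i' \<noteq> i \<and> real n * (\<Sum>m\<in>S. (G i m - G i' m)\<^sup>2) \<le> (upper * sqrt n)\<^sup>2" if i: "i \<in> S" for i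
  proof -
    obtain k where k: "k \<in> T" "k \<noteq> i" "\<bar>real (\<psi> k) - real (\<psi> i)\<bar> \<le> sqrt n"
      using T(3) Sn[OF i] unfolding part_good_def by blast
    have "real n * (\<Sum>m\<in>S. (G i m - G k m)\<^sup>2) \<le> (upper * \<bar>real (\<psi> i) - real (\<psi> k)\<bar>)\<^sup>2"
      using Sn i subsetD[OF T(1) k(1)] by (intro row_distance_upper T(2)) auto
    also have "\<dots> \<le> (upper * sqrt n)\<^sup>2"
      using k lower_upper_pos by (intro power_mono mult_left_mono) (auto simp: abs_minus_commute)
    finally show ?thesis using k subsetD[OF T(1) k(1)] by blast
  qed
  have err: "\<bar>estimate_distance n tie A S i j - ?D\<bar> \<le> \<omega>"
  proof (rule order_trans[OF estimate_distance_error[OF T(2) cS _ tie _ _ near ij] \<omega>])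
    show "0 \<le> upper * sqrt n" using lower_upper_pos by simp
    show "0 \<le> G i l \<and> G i l \<le> 1" if "i \<in> S" "l \<in> S" for i l using G01 Sn that by blast
    show "\<bar>(\<Sum>m\<in>S. A k m * A l m) - (\<Sum>m\<in>S. G k m * G l m)\<bar> \<le> e" if "k \<in> S" "l \<in> S" "k \<noteq> l" for k l
      using A that unfolding inner_good_def by blast
  qed
  have "?D \<le> upper * \<bar>real (\<psi> i) - real (\<psi> j)\<bar>"
    using row_distance_upper[OF T(2) Sn[OF ij(1)] Sn[OF ij(2)]] lower_upper_pos by (intro real_le_lsqrt) (auto intro: sum_nonneg)
  moreover have "lower * \<bar>real (\<psi> i) - real (\<psi> j)\<bar> \<le> ?D"
    using row_distance_lower[OF T(1-3) Sn[OF ij(1)] Sn[OF ij(2)]] by (intro real_le_rsqrt)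
  ultimately show "lower * \<bar>real (\<psi> i) - real (\<psi> j)\<bar> - \<omega> \<le> estimate_distance n tie A S i j"
    "estimate_distance n tie A S i j \<le> upper * \<bar>real (\<psi> i) - real (\<psi> j)\<bar> + \<omega>"
    using err by linarith+
qed

text \<open>On undecided pairs \<open>refined_comparison_less\<close> applies with threshold
  \<open>5\<close> and noise level \<open>3\<close>, in units of
  \<open>\<sigma> * sqrt (n * ln n)\<close>. The combined matrix then has no wrong sign and vanishes
  only up to gap \<open>B\<close>, which is the situation of \<open>kendall_tau_le\<close>.\<close>

lemma refined_output_loss:
  assumes large: "large_enough lower upper r n \<omega> \<delta>1 \<delta>2 \<delta>3 \<delta>4"
    and \<omega>: "sqrt (real n * (12 * e + 4 * (upper * sqrt n))) \<le> \<omega>" and \<omega>0: "0 \<le> \<omega>"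
    and \<sigma>: "0 < \<sigma>" and tie: "valid_tie_rule tie"
    and P: "P \<in> balanced_partitions n" and good: "\<And>T. T \<in> parts P \<Longrightarrow> part_good T"
    and noise: "\<And>S. S \<in> insert {1..n} (parts P) \<Longrightarrow> inner_good G e S A"
      "\<And>T. T \<in> parts P \<Longrightarrow> split_good n tie G \<psi> \<delta>4 (3 * \<sigma> * sqrt (real n * ln n)) T A"
    and D: "D = estimate_distance n tie A {1..n}"
    and H: "\<And>i j. i \<in> {1..n} \<Longrightarrow> j \<in> {1..n} \<Longrightarrow> H i j = 0 \<or> H i j = sgn (real (\<psi> i) - real (\<psi> j))"
    and H_far: "\<And>i j. i \<in> {1..n} \<Longrightarrow> j \<in> {1..n} \<Longrightarrow>
          \<bar>real (\<psi> i) - real (\<psi> j)\<bar> \<ge> (\<delta>3 + \<omega>) / lower + 1 \<Longrightarrow> H i j \<noteq> 0"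
    and H_zero: "\<And>i j. i \<in> {1..n} \<Longrightarrow> j \<in> {1..n} \<Longrightarrow> H i j = 0 \<longleftrightarrow> H j i = 0"
    and H': "refined_seriation n tie A \<sigma> \<delta>4 P D H H'"
    and p: "\<And>i. i \<in> {1..n} \<Longrightarrow> p i = ((\<Sum>j\<in>{1..n}. H i j + H' i j) + real n + 1) / 2"
  shows "kendall_tau n p (\<lambda>i. real (\<psi> i)) \<le> 40 * (\<sigma> / \<alpha>) * sqrt (real n * ln n)"
proof -
  define \<tau> where "\<tau> = 5 * \<sigma> * sqrt (real n * ln n)"
  define B where "B = 40 * (\<sigma> / \<alpha>) * sqrt (real n * ln n)"
  define q where "q = (\<delta>3 + \<omega>) / lower + 1"
  \<comment> \<open>Bound on the gap from an index to its proxy: by minimality of the proxy it is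
    compared with an element of the part within \<open>sqrt n\<close> ranks, and the estimation
    error enters once for each of the two.\<close>
  define w where "w = (upper * sqrt n + 2 * \<omega>) / lower"
  note lu = lower_upper_pos
  have large': "24 \<le> n" "2 * q + w \<le> (\<delta>4 - \<omega>) / upper" "\<delta>4 \<le> lower * (real n / 32 - (q + w)) - \<omega>"
    "2 * (q + w) < real n / 32" "q \<le> r * n"
    "(\<delta>2 + \<omega>) / lower \<le> (\<delta>3 - \<omega>) / upper" "\<delta>2 \<le> \<delta>3" "upper + \<omega> \<le> \<delta>1" "(\<delta>1 + \<omega>) / lower * upper < \<delta>2 - \<omega>"
    using large unfolding large_enough_def q_def w_def by auto
  have L: "0 < ln (real n)" using large'(1) by simp
  have B0: "0 \<le> B" using \<sigma> pos L unfolding B_def by simp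
  have "0 < (\<delta>1 + \<omega>) / lower * upper" using large'(8) lu \<omega>0 by (intro mult_pos_pos divide_pos_pos) auto
  then have \<delta>3: "0 < \<delta>3" using large' \<omega>0 by linarith
  have q: "0 < q" using \<delta>3 \<omega>0 lu unfolding q_def by (simp add: add_pos_pos)
  have w: "0 \<le> w" using \<omega>0 lu unfolding w_def by simp
  have "0 < (\<delta>4 - \<omega>) / upper" using large'(2) q w by linarith
  then have "0 < \<delta>4 - \<omega>" using lu by (simp add: zero_less_divide_iff)
  then have \<delta>4: "0 < \<delta>4" using \<omega>0 by linarith
  have n12: "12 \<le> n" using large' by simp
  obtain T0 where T0: "T0 \<in> parts P" unfolding parts_def by (cases P) auto
  have D_bounds: "lower * \<bar>real (\<psi> i) - real (\<psi> j)\<bar> - \<omega> \<le> D i j" "D i j \<le> upper * \<bar>real (\<psi> i) - real (\<psi> j)\<bar> + \<omega>"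
    if "i \<in> {1..n}" "j \<in> {1..n}" "i \<noteq> j" for i j
    using estimate_distance_bounds[OF n12 parts_subset[OF P T0] order_refl good[OF T0] part_card(1)[OF P T0] tie
        noise(1)[OF insertI1] \<omega> that] unfolding D by auto
  define C where "C T pr i j = refined_comparison n tie A \<sigma> \<delta>4 H T pr i j" for T pr i j
  have compare: "(C T pr i j = 0 \<or> C T pr i j = - 1) \<and> (C T pr i j = 0 \<longrightarrow> real (\<psi> j) - real (\<psi> i) \<le> B)"
    if T: "T \<in> parts P" and ij: "i \<in> {1..n} - T" "j \<in> {1..n} - T" "\<psi> i < \<psi> j" "H i j = 0"
      and pr: "is_arg_min (D i) (\<lambda>x. x \<in> T) pr \<or> is_arg_min (D j) (\<lambda>x. x \<in> T) pr" for T pr i j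
  proof -
    have Tn: "T \<subseteq> {1..n}" by (rule parts_subset[OF P T])
    have ij': "i \<in> {1..n}" "j \<in> {1..n}" using ij by auto
    have prT: "pr \<in> T" "pr \<in> {1..n}" using pr Tn by (auto simp: is_arg_min_def)
    have d_ij: "\<bar>real (\<psi> i) - real (\<psi> j)\<bar> < q" using H_far[OF ij'] ij(4) unfolding q_def by (meson not_le)
    have proxy: "\<bar>real (\<psi> pr) - real (\<psi> x)\<bar> \<le> w"
      if x: "x \<in> {1..n} - T" "is_arg_min (D x) (\<lambda>y. y \<in> T) pr" for x
    proof -
      obtain k where k: "k \<in> T" "k \<noteq> x" "\<bar>real (\<psi> k) - real (\<psi> x)\<bar> \<le> sqrt n"
        using good[OF T] x unfolding part_good_def by blast
      have "lower * \<bar>real (\<psi> x) - real (\<psi> pr)\<bar> - \<omega> \<le> D x pr" using x prT by (intro D_bounds) auto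
      also have "D x pr \<le> D x k" using x(2) k(1) unfolding is_arg_min_def by (meson not_le)
      also have "D x k \<le> upper * \<bar>real (\<psi> x) - real (\<psi> k)\<bar> + \<omega>" using x k Tn by (intro D_bounds) auto
      also have "upper * \<bar>real (\<psi> x) - real (\<psi> k)\<bar> \<le> upper * sqrt n"
        using k(3) lu by (intro mult_left_mono) (auto simp: abs_minus_commute)
      finally have "lower * \<bar>real (\<psi> x) - real (\<psi> pr)\<bar> \<le> upper * sqrt n + 2 * \<omega>" by simp
      then show ?thesis unfolding w_def using lu by (simp add: pos_le_divide_eq mult.commute abs_minus_commute)
    qed
    have close: "\<bar>real (\<psi> pr) - real (\<psi> i)\<bar> \<le> q + w" "\<bar>real (\<psi> pr) - real (\<psi> j)\<bar> \<le> q + w"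
      using pr proxy[OF ij(1)] proxy[OF ij(2)] d_ij q by linarith+
    have est: "lower * \<bar>real (\<psi> pr) - real (\<psi> k)\<bar> - \<omega> \<le> estimate_distance n tie A T pr k"
      "estimate_distance n tie A T pr k \<le> upper * \<bar>real (\<psi> pr) - real (\<psi> k)\<bar> + \<omega>"
      if "k \<in> T" "k \<noteq> pr" for k
      using estimate_distance_bounds[OF n12 order_refl Tn good[OF T] part_card(1)[OF P T] tie _ \<omega> prT(1) that(1)]
        noise(1) T that by auto
    have est0: "estimate_distance n tie A T pr pr = 0" unfolding estimate_distance_def by simp
    have far: "\<bar>real (\<psi> pr) - real (\<psi> k)\<bar> \<ge> (q + w) + q" if k: "k \<in> T" "estimate_distance n tie A T pr k \<ge> \<delta>4" for k
    proof -
      have "k \<noteq> pr" using k est0 \<delta>4 by auto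
      then have "(\<delta>4 - \<omega>) / upper \<le> \<bar>real (\<psi> pr) - real (\<psi> k)\<bar>"
        using est(2)[OF k(1)] k(2) lu by (simp add: pos_divide_le_eq mult.commute)
      then show ?thesis using large'(2) by linarith
    qed
    have far': "estimate_distance n tie A T pr k \<ge> \<delta>4"
      if k: "k \<in> T" "\<bar>real (\<psi> pr) - real (\<psi> k)\<bar> \<ge> real n / 32 - (q + w)" for k
    proof -
      have "k \<noteq> pr" using k(2) large'(4) q w by auto
      have "lower * (real n / 32 - (q + w)) \<le> lower * \<bar>real (\<psi> pr) - real (\<psi> k)\<bar>"
        using k(2) lu by (intro mult_left_mono) auto
      then show ?thesis using est(1)[OF k(1) \<open>k \<noteq> pr\<close>] large'(3) by linarith
    qed
    have sig: "\<alpha> / 5 * (real (\<psi> j) - real (\<psi> i)) \<le> max (\<Sum>k | k \<in> T \<and> real (\<psi> k) < real (\<psi> i) - real n / 32. G i k - G j k)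
                         (\<Sum>k | k \<in> T \<and> real (\<psi> k) > real (\<psi> j) + real n / 32. G j k - G i k)"
      using good[OF T] ij' ij(3) d_ij large'(5) unfolding part_good_def by (simp add: abs_if split: if_splits)
    have noise': "\<bar>\<Sum>k | k \<in> T \<and> estimate_distance n tie A T pr k \<ge> \<delta>4 \<and> k \<in> Q. (A i k - G i k) - (A j k - G j k)\<bar>
        < 3 * \<sigma> * sqrt (real n * ln n)"
      if "Q \<in> {{k. \<psi> k < \<psi> pr}, {k. \<psi> pr < \<psi> k}}" for Q
      using noise(2)[OF T] prT(1) ij(1,2) that unfolding split_good_def by blast
    have \<tau>_le: "3 * \<sigma> * sqrt (real n * ln n) \<le> \<tau>"
      unfolding \<tau>_def using \<sigma> L by (intro mult_right_mono) auto
    have ml: "G j k \<le> G i k" if "k \<in> T" "\<psi> k \<le> \<psi> i" for k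
      using mono_left[OF ij' _ that(2) ij(3)] Tn that by blast
    have mr: "G i k \<le> G j k" if "k \<in> T" "\<psi> j \<le> \<psi> k" for k
      using mono_right[OF ij' _ ij(3) that(2)] Tn that by blast
    note rc = refined_comparison_less[where N = "\<lambda>k l. A k l - G k l" and G = G and W = "q + w" and q = q
        and \<psi> = \<psi> and s = "\<alpha> / 5 * (real (\<psi> j) - real (\<psi> i))" and \<tau> = \<tau> and \<tau>' = "3 * \<sigma> * sqrt (real n * ln n)",
        OF Tn prT(1) ij' ij(3) close q H H_far[folded q_def] far far' large'(4) _ noise' ml mr sig \<tau>_def \<tau>_le]
    have rc1: "C T pr i j = 0 \<or> C T pr i j = - 1" unfolding C_def by (rule rc(1)) auto
    have rc2: "\<alpha> / 5 * (real (\<psi> j) - real (\<psi> i)) < \<tau> + 3 * \<sigma> * sqrt (real n * ln n)" if "C T pr i j = 0"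
      using that unfolding C_def by (intro rc(2)) auto
    \<comment> \<open>Solving
      \<open>\<alpha> / 5 * gap < (5 + 3) * \<sigma> * sqrt (n * ln n)\<close> for the gap gives the
      factor 40.\<close>
    have "real (\<psi> j) - real (\<psi> i) \<le> B" if "C T pr i j = 0"
      using rc2[OF that] pos unfolding \<tau>_def B_def by (simp add: field_simps)
    then show ?thesis using rc1 by blast
  qed
  have raw: "(\<forall>i\<in>{1..n}. H' i i = 0) \<and> (\<forall>i\<in>{1..n}. \<forall>j\<in>{1..n}. i < j \<longrightarrow>
      H' j i = - H' i j \<and> (if H i j = 0 then \<exists>T\<in>parts P. i \<notin> T \<and> j \<notin> T \<and>
        (\<exists>pr. is_arg_min (\<lambda>q. D i q) (\<lambda>q. q \<in> T) pr \<and> H' i j = C T pr i j) else H' i j = 0))"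
  proof -
    obtain S1 S2 S3 where eq: "P = (S1, S2, S3)" by (metis prod_cases3)
    show ?thesis using H' unfolding refined_seriation_def parts_def C_def eq prod.case .
  qed
  have entry: "H' i j = 0 \<and> \<bar>real (\<psi> i) - real (\<psi> j)\<bar> \<le> B \<or> H' i j = sgn (real (\<psi> i) - real (\<psi> j))"
    if ij: "i \<in> {1..n}" "j \<in> {1..n}" "i < j" "H i j = 0" for i j
  proof -
    obtain T pr where T: "T \<in> parts P" "i \<notin> T" "j \<notin> T" and pr: "is_arg_min (\<lambda>q. D i q) (\<lambda>q. q \<in> T) pr"
      and H'ij: "H' i j = C T pr i j"
      using conjunct2[OF bspec[OF bspec[OF conjunct2[OF raw] ij(1)] ij(2), THEN mp, OF ij(3)]] ij(4) by auto
    consider "\<psi> i < \<psi> j" | "\<psi> j < \<psi> i" using inj[OF ij(1,2)] ij(3) by linarith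
    then show ?thesis
    proof cases
      case 1
      then show ?thesis using compare[OF T(1), of i j pr] ij T pr unfolding H'ij by (auto simp: sgn_if)
    next
      case 2
      have "C T pr i j = - C T pr j i" unfolding C_def by (rule refined_comparison_swap)
      moreover have "H j i = 0" using H_zero[OF ij(1,2)] ij(4) by simp
      ultimately show ?thesis using compare[OF T(1), of j i pr] ij T pr 2 unfolding H'ij by (auto simp: sgn_if)
    qed
  qed
  have H'_diag: "H' i i = 0" if "i \<in> {1..n}" for i using raw that by blast
  have H'_pair: "H' j i = - H' i j \<and> (H i j \<noteq> 0 \<longrightarrow> H' i j = 0)" if "i \<in> {1..n}" "j \<in> {1..n}" "i < j" for i j
    using bspec[OF bspec[OF conjunct2[OF raw] that(1)] that(2), THEN mp, OF that(3)] by simp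
  have H'_swap: "H' j i = - H' i j" if "i \<in> {1..n}" "j \<in> {1..n}" "i < j" for i j
    using H'_pair[OF that] by simp
  have H'_zero: "H' i j = 0" if "i \<in> {1..n}" "j \<in> {1..n}" "i < j" "H i j \<noteq> 0" for i j
    using H'_pair[OF that(1-3)] that(4) by simp
  have K: "H i j + H' i j = 0 \<and> \<bar>real (\<psi> i) - real (\<psi> j)\<bar> \<le> B \<or> H i j + H' i j = sgn (real (\<psi> i) - real (\<psi> j))"
    if ij: "i \<in> {1..n}" "j \<in> {1..n}" for i j
  proof -
    consider "i = j" | "i < j" | "j < i" by linarith
    then show ?thesis
    proof cases
      case 1
      then show ?thesis using H[OF ij] H'_diag[OF ij(1)] B0 by auto
    next
      case 2
      then show ?thesis using H[OF ij] entry[OF ij 2] H'_zero[OF ij 2] by (cases "H i j = 0") auto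
    next
      case 3
      show ?thesis
      proof (cases "H i j = 0")
        case True
        then have "H j i = 0" using H_zero[OF ij] by simp
        from entry[OF ij(2,1) 3 this] H'_swap[OF ij(2,1) 3] True
        show ?thesis using sgn_diff_swap[of "real (\<psi> i)" "real (\<psi> j)"] by (auto simp: abs_minus_commute)
      next
        case False
        then have "H j i \<noteq> 0" using H_zero[OF ij] by simp
        then show ?thesis using H[OF ij] H'_zero[OF ij(2,1) 3] H'_swap[OF ij(2,1) 3] False by auto
      qed
    qed
  qed
  have "kendall_tau n p (\<lambda>i. real (\<psi> i)) \<le> B"
  proof (rule kendall_tau_le[OF bij B0, where K = "\<lambda>i j. H i j + H' i j"])
    fix i j assume ij: "i \<in> {1..n}" "j \<in> {1..n}"
    show "H i j + H' i j = 0 \<or> H i j + H' i j = sgn (real (\<psi> i) - real (\<psi> j))" using K[OF ij] by auto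
    show "\<bar>real (\<psi> i) - real (\<psi> j)\<bar> \<le> B" if "H i j + H' i j = 0"
      using K[OF ij] that B0 by (auto simp: sgn_if split: if_splits)
  qed (use p in auto)
  then show ?thesis unfolding B_def .
qed

end

section \<open>Invariance of the good events under reversal of the ranks\<close>

context seriation
begin

lemma reversed_less: "i \<in> {1..n} \<Longrightarrow> j \<in> {1..n} \<Longrightarrow> n + 1 - \<psi> i < n + 1 - \<psi> j \<longleftrightarrow> \<psi> j < \<psi> i"
  using range[of i] range[of j] by linarith

lemma reversed_le: "i \<in> {1..n} \<Longrightarrow> j \<in> {1..n} \<Longrightarrow> n + 1 - \<psi> i \<le> n + 1 - \<psi> j \<longleftrightarrow> \<psi> j \<le> \<psi> i"
  using range[of i] range[of j] by linarith

lemma real_reversed: "i \<in> {1..n} \<Longrightarrow> real (n + 1 - \<psi> i) = real n + 1 - real (\<psi> i)"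
  using range[of i] by (simp add: of_nat_diff)

lemma reversed_sets:
  assumes "S \<subseteq> {1..n}" "i \<in> {1..n}"
  shows "{k. k \<in> S \<and> real (n + 1 - \<psi> k) < real (n + 1 - \<psi> i) - x} = {k. k \<in> S \<and> real (\<psi> k) > real (\<psi> i) + x}"
    "{k. k \<in> S \<and> real (n + 1 - \<psi> k) > real (n + 1 - \<psi> i) + x} = {k. k \<in> S \<and> real (\<psi> k) < real (\<psi> i) - x}"
  using real_reversed[OF assms(2)] real_reversed[OF subsetD[OF assms(1)]] by auto

text \<open>Reflection exchanges the two monotonicity conditions and the two sums in the signal
  condition; the distance conditions depend on absolute gaps only.\<close>

lemma reversed: "seriation n (\<lambda>i. n + 1 - \<psi> i) G \<alpha> \<beta> r r'"
proof
  show "0 < \<alpha>" "0 < \<beta>" "0 < r" "0 < r'" by (rule pos)+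
  have "bij_betw (\<lambda>x. n + 1 - x) {1..n} {1..n}"
    by (rule bij_betw_byWitness[where f'="\<lambda>x. n + 1 - x"]) auto
  from bij_betw_trans[OF bij this] show "bij_betw (\<lambda>i. n + 1 - \<psi> i) {1..n} {1..n}"
    by (simp add: comp_def)
  show "0 \<le> G i j \<and> G i j \<le> 1" if "i \<in> {1..n}" "j \<in> {1..n}" for i j
    using G01 that .
  show "G j k \<le> G i k" if ij: "i \<in> {1..n}" "j \<in> {1..n}" "k \<in> {1..n}"
    "n + 1 - \<psi> k \<le> n + 1 - \<psi> i" "n + 1 - \<psi> i < n + 1 - \<psi> j" for i j k
    using that(4,5) unfolding reversed_less[OF ij(1,2)] reversed_le[OF ij(3,1)]
    by (intro mono_right[OF ij(2,1,3)])
  show "G i k \<le> G j k" if ij: "i \<in> {1..n}" "j \<in> {1..n}" "k \<in> {1..n}"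
    "n + 1 - \<psi> i < n + 1 - \<psi> j" "n + 1 - \<psi> j \<le> n + 1 - \<psi> k" for i j k
    using that(4,5) unfolding reversed_less[OF ij(1,2)] reversed_le[OF ij(2,3)]
    by (intro mono_left[OF ij(2,1,3)])
  show "real n * (\<Sum>k\<in>{1..n}. (G i k - G j k)\<^sup>2) \<le> (\<beta> * (real (n + 1 - \<psi> j) - real (n + 1 - \<psi> i)))\<^sup>2"
    if ij: "i \<in> {1..n}" "j \<in> {1..n}" "n + 1 - \<psi> i < n + 1 - \<psi> j" "real (n + 1 - \<psi> j) - real (n + 1 - \<psi> i) \<le> r * n" for i j
  proof -
    have l: "\<psi> j < \<psi> i" using ij(3) unfolding reversed_less[OF ij(1,2)] .
    have "real (\<psi> i) - real (\<psi> j) \<le> r * n" using ij(4) unfolding real_reversed[OF ij(1)] real_reversed[OF ij(2)] by simp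
    from lipschitz[OF ij(2,1) l this] show ?thesis
      unfolding real_reversed[OF ij(1)] real_reversed[OF ij(2)] by (simp add: power2_commute)
  qed
  show "\<alpha> * (real (n + 1 - \<psi> j) - real (n + 1 - \<psi> i)) \<le>
          max (\<Sum>k | k \<in> {1..n} \<and> real (n + 1 - \<psi> k) < real (n + 1 - \<psi> i) - real n / 32. G i k - G j k)
              (\<Sum>k | k \<in> {1..n} \<and> real (n + 1 - \<psi> k) > real (n + 1 - \<psi> j) + real n / 32. G j k - G i k)"
    if ij: "i \<in> {1..n}" "j \<in> {1..n}" "n + 1 - \<psi> i < n + 1 - \<psi> j" "real (n + 1 - \<psi> j) - real (n + 1 - \<psi> i) \<le> r * n" for i j
  proof -
    have l: "\<psi> j < \<psi> i" using ij(3) unfolding reversed_less[OF ij(1,2)] .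
    have "real (\<psi> i) - real (\<psi> j) \<le> r * n" using ij(4) unfolding real_reversed[OF ij(1)] real_reversed[OF ij(2)] by simp
    from signal[OF ij(2,1) l this] show ?thesis
      unfolding reversed_sets[OF order_refl ij(1)] reversed_sets[OF order_refl ij(2)]
      unfolding real_reversed[OF ij(1)] real_reversed[OF ij(2)] by (simp add: max.commute)
  qed
  show "r'\<^sup>2 * real n \<le> (\<Sum>k\<in>{1..n}. (G i k - G j k)\<^sup>2)"
    if ij: "i \<in> {1..n}" "j \<in> {1..n}" "\<bar>real (n + 1 - \<psi> i) - real (n + 1 - \<psi> j)\<bar> > r * n" for i j
  proof (rule separated[OF ij(1,2)])
    show "\<bar>real (\<psi> i) - real (\<psi> j)\<bar> > r * n"
      using ij(3) unfolding real_reversed[OF ij(1)] real_reversed[OF ij(2)] by (simp add: abs_minus_commute)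
  qed
qed

end

context seriation
begin

interpretation rev: seriation n "\<lambda>i. n + 1 - \<psi> i" G \<alpha> \<beta> r r'
  by (rule reversed)

lemma reversed_part_good:
  assumes T: "T \<subseteq> {1..n}" and good: "part_good T"
  shows "rev.part_good T"
  unfolding rev.part_good_def
proof (intro conjI ballI impI)
  fix i j assume ij: "i \<in> {1..n}" "j \<in> {1..n}" "n + 1 - \<psi> i < n + 1 - \<psi> j" "real (n + 1 - \<psi> j) - real (n + 1 - \<psi> i) \<le> r * n"
  have l: "\<psi> j < \<psi> i" using ij(3) unfolding reversed_less[OF ij(1,2)] .
  have "real (\<psi> i) - real (\<psi> j) \<le> r * n" using ij(4) unfolding real_reversed[OF ij(1)] real_reversed[OF ij(2)] by simp
  then have "\<alpha> / 5 * (real (\<psi> i) - real (\<psi> j)) \<le>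
          max (\<Sum>k | k \<in> T \<and> real (\<psi> k) < real (\<psi> j) - real n / 32. G j k - G i k)
              (\<Sum>k | k \<in> T \<and> real (\<psi> k) > real (\<psi> i) + real n / 32. G i k - G j k)"
    using good l ij(1,2) unfolding part_good_def by blast
  then show "\<alpha> / 5 * (real (n + 1 - \<psi> j) - real (n + 1 - \<psi> i)) \<le>
          max (\<Sum>k | k \<in> T \<and> real (n + 1 - \<psi> k) < real (n + 1 - \<psi> i) - real n / 32. G i k - G j k)
              (\<Sum>k | k \<in> T \<and> real (n + 1 - \<psi> k) > real (n + 1 - \<psi> j) + real n / 32. G j k - G i k)"
    unfolding reversed_sets[OF T ij(1)] reversed_sets[OF T ij(2)]
    unfolding real_reversed[OF ij(1)] real_reversed[OF ij(2)] by (simp add: max.commute)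
next
  fix i j assume ij: "i \<in> {1..n}" "j \<in> {1..n}" "\<bar>real (n + 1 - \<psi> i) - real (n + 1 - \<psi> j)\<bar> > r * n"
  have "\<bar>real (\<psi> i) - real (\<psi> j)\<bar> > r * n"
    using ij(3) unfolding real_reversed[OF ij(1)] real_reversed[OF ij(2)] by (simp add: abs_minus_commute)
  then show "r'\<^sup>2 * real n / 5 \<le> (\<Sum>k\<in>T. (G i k - G j k)\<^sup>2)"
    using good ij(1,2) unfolding part_good_def by blast
next
  fix i assume i: "i \<in> {1..n}"
  then obtain k where k: "k \<in> T" "k \<noteq> i" "\<bar>real (\<psi> k) - real (\<psi> i)\<bar> \<le> sqrt n"
    using good unfolding part_good_def by blast
  have "\<bar>real (n + 1 - \<psi> k) - real (n + 1 - \<psi> i)\<bar> \<le> sqrt n"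
    using k(3) unfolding real_reversed[OF i] real_reversed[OF subsetD[OF T k(1)]] by (simp add: abs_minus_commute)
  then show "\<exists>k\<in>T. k \<noteq> i \<and> \<bar>real (n + 1 - \<psi> k) - real (n + 1 - \<psi> i)\<bar> \<le> sqrt n" using k by blast
qed

lemma reversed_split_good:
  assumes T: "T \<subseteq> {1..n}" and good: "split_good n tie G \<psi> \<delta> \<tau> T A"
  shows "split_good n tie G (\<lambda>i. n + 1 - \<psi> i) \<delta> \<tau> T A"
  unfolding split_good_def
proof (intro ballI)
  fix p i j Q assume p: "p \<in> T" and ij: "i \<in> {1..n} - T" "j \<in> {1..n} - T"
    and Q: "Q \<in> {{k. n + 1 - \<psi> k < n + 1 - \<psi> p}, {k. n + 1 - \<psi> p < n + 1 - \<psi> k}}"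
  \<comment> \<open>The sets are matched on \<open>T\<close> only: outside \<open>{1..n}\<close> the
    truncated subtraction need not reverse the order.\<close>
  have "\<exists>Q'\<in>{{k. \<psi> k < \<psi> p}, {k. \<psi> p < \<psi> k}}. \<forall>k\<in>T. k \<in> Q \<longleftrightarrow> k \<in> Q'"
    using Q reversed_less T p by (auto simp: subset_iff)
  then obtain Q' where Q': "Q' \<in> {{k. \<psi> k < \<psi> p}, {k. \<psi> p < \<psi> k}}" "\<And>k. k \<in> T \<Longrightarrow> k \<in> Q \<longleftrightarrow> k \<in> Q'" by blast
  have "\<bar>\<Sum>k | k \<in> T \<and> estimate_distance n tie A T p k \<ge> \<delta> \<and> k \<in> Q'. (A i k - G i k) - (A j k - G j k)\<bar> < \<tau>"
    using good p ij Q'(1) unfolding split_good_def by blast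
  moreover have "{k. k \<in> T \<and> estimate_distance n tie A T p k \<ge> \<delta> \<and> k \<in> Q}
      = {k. k \<in> T \<and> estimate_distance n tie A T p k \<ge> \<delta> \<and> k \<in> Q'}" using Q'(2) by blast
  ultimately show "\<bar>\<Sum>k | k \<in> T \<and> estimate_distance n tie A T p k \<ge> \<delta> \<and> k \<in> Q. (A i k - G i k) - (A j k - G j k)\<bar> < \<tau>"
    by simp
qed

text \<open>The orientation is known only after the data have been seen. As \<open>part_good\<close>
  and \<open>split_good\<close> carry over to the reversed ranks, the second stage can be analysed
  in the orientation found without any loss of probability, and the loss takes the minimum over
  both.\<close>

lemma sabre_loss:
  assumes large: "large_enough lower upper r n \<omega> \<delta>1 \<delta>2 \<delta>3 \<delta>4"
    and \<omega>: "sqrt (real n * (12 * e + 4 * (upper * sqrt n))) \<le> \<omega>" "0 \<le> \<omega>"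
    and \<sigma>: "0 < \<sigma>" and tie: "valid_tie_rule tie"
    and P: "P \<in> balanced_partitions n" and good: "\<And>T. T \<in> parts P \<Longrightarrow> part_good T"
    and noise: "noise_good n tie G \<psi> \<delta>4 e (3 * \<sigma> * sqrt (real n * ln n)) P A"
    and out: "sabre_output n tie A \<sigma> \<delta>1 \<delta>2 \<delta>3 \<delta>4 P p"
  shows "kendall_loss n p \<psi> \<le> 40 * (\<sigma> / \<alpha>) * sqrt (real n * ln n)"
proof -
  obtain D H H' where D: "D = estimate_distance n tie A {1..n}" and H: "first_seriation n D \<delta>1 \<delta>2 \<delta>3 H"
    and H': "refined_seriation n tie A \<sigma> \<delta>4 P D H H'"
    and p: "\<forall>i\<in>{1..n}. p i = ((\<Sum>j\<in>{1..n}. H i j + H' i j) + real n + 1) / 2"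
    using out unfolding sabre_output_def by blast
  have inner: "\<And>S. S \<in> insert {1..n} (parts P) \<Longrightarrow> inner_good G e S A"
    and split: "\<And>T. T \<in> parts P \<Longrightarrow> split_good n tie G \<psi> \<delta>4 (3 * \<sigma> * sqrt (real n * ln n)) T A"
    using noise unfolding noise_good_def by blast+
  obtain T0 where T0: "T0 \<in> parts P" unfolding parts_def by (cases P) auto
  have n12: "12 \<le> n" using large unfolding large_enough_def by simp
  note D_bounds = estimate_distance_bounds[OF n12 parts_subset[OF P T0] order_refl good[OF T0] part_card(1)[OF P T0] tie
        inner[OF insertI1] \<omega>(1), folded D]
  interpret D: embedded_distance n \<psi> D lower upper \<omega> \<delta>1 \<delta>2 \<delta>3
  proof
    show "D k l = D l k" for k l unfolding D by (rule estimate_distance_commute)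
    show "lower * \<bar>real (\<psi> i) - real (\<psi> j)\<bar> - \<omega> \<le> D i j" "D i j \<le> upper * \<bar>real (\<psi> i) - real (\<psi> j)\<bar> + \<omega>"
      if "i \<in> {1..n}" "j \<in> {1..n}" "i \<noteq> j" for i j using D_bounds[OF that] .
  qed (use bij lower_upper_pos \<omega>(2) large in \<open>simp_all add: large_enough_def\<close>)
  obtain \<phi> where \<phi>: "\<phi> \<in> {\<psi>, \<lambda>i. n + 1 - \<psi> i}"
    and H\<phi>: "\<forall>i\<in>{1..n}. \<forall>j\<in>{1..n}. (H i j = 0 \<or> H i j = sgn (real (\<phi> i) - real (\<phi> j))) \<and>
      (\<bar>real (\<phi> i) - real (\<phi> j)\<bar> \<ge> (\<delta>3 + \<omega>) / lower + 1 \<longrightarrow> H i j \<noteq> 0) \<and> (H i j = 0 \<longleftrightarrow> H j i = 0)"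
    using D.first_seriation_correct[OF H] by blast
  have "kendall_tau n p (\<lambda>i. real (\<phi> i)) \<le> 40 * (\<sigma> / \<alpha>) * sqrt (real n * ln n)"
  proof (cases "\<phi> = \<psi>")
    case True
    show ?thesis
      unfolding True
      by (rule refined_output_loss[OF large \<omega> \<sigma> tie P good inner split D _ _ _ H' p[rule_format]])
        (use H\<phi> in \<open>simp_all add: True\<close>)
  next
    case False
    then have \<phi>': "\<phi> = (\<lambda>i. n + 1 - \<psi> i)" using \<phi> by auto
    have g: "rev.part_good T" if "T \<in> parts P" for T
      using reversed_part_good[OF parts_subset[OF P that] good[OF that]] .
    have s: "split_good n tie G (\<lambda>i. n + 1 - \<psi> i) \<delta>4 (3 * \<sigma> * sqrt (real n * ln n)) T A" if "T \<in> parts P" for T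
      using reversed_split_good[OF parts_subset[OF P that] split[OF that]] .
    show ?thesis
      unfolding \<phi>'
      by (rule rev.refined_output_loss[OF large \<omega> \<sigma> tie P g inner s D _ _ _ H' p[rule_format]])
        (use H\<phi> in \<open>simp_all add: \<phi>'\<close>)
  qed
  then show ?thesis by (rule kendall_loss_le[OF bij \<phi>])
qed

end

text \<open>A permutation of the columns leaves row distances unchanged and carries the signal sums
  of the permuted matrix, whose ranges are stated in ranks, to those of \<open>F\<close>.\<close>

lemma seriation_of_avg_lipschitz:
  assumes pos: "0 < \<alpha>" "0 < \<beta>" "0 < r" "0 < r'" and n: "1 \<le> n"
    and \<pi>: "\<pi> permutes {1..n}" and F: "robinson n F" "F \<in> avg_lipschitz n \<alpha> \<beta> r r'"
  shows "seriation n \<pi> (\<lambda>i j. F (\<pi> i) (\<pi> j)) \<alpha> \<beta> r r'"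
proof
  show "0 < \<alpha>" "0 < \<beta>" "0 < r" "0 < r'" by (rule pos)+
  show bij: "bij_betw \<pi> {1..n} {1..n}" using \<pi> by (rule permutes_imp_bij)
  have range: "\<pi> i \<in> {1..n}" if "i \<in> {1..n}" for i using bij_betwE[OF bij] that by blast
  have reindex: "(\<Sum>k | k \<in> {1..n} \<and> R (\<pi> k). f (\<pi> k)) = (\<Sum>k | k \<in> {1..n} \<and> R k. f k)" for R and f :: "nat \<Rightarrow> real"
  proof (rule sum.reindex_bij_betw)
    show "bij_betw \<pi> {k. k \<in> {1..n} \<and> R (\<pi> k)} {k. k \<in> {1..n} \<and> R k}"
    proof (rule bij_betw_imageI)
      show "inj_on \<pi> {k. k \<in> {1..n} \<and> R (\<pi> k)}"
        by (rule inj_on_subset[OF bij_betw_imp_inj_on[OF bij]]) blast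
      have "\<pi> ` {k. k \<in> {1..n} \<and> R (\<pi> k)} = {y. y \<in> \<pi> ` {1..n} \<and> R y}" by blast
      then show "\<pi> ` {k. k \<in> {1..n} \<and> R (\<pi> k)} = {k. k \<in> {1..n} \<and> R k}"
        unfolding bij_betw_imp_surj_on[OF bij] .
    qed
  qed
  have reindex': "(\<Sum>k\<in>{1..n}. f (\<pi> k)) = (\<Sum>k\<in>{1..n}. f k)" for f :: "nat \<Rightarrow> real"
    by (rule sum.reindex_bij_betw[OF bij])
  show "0 \<le> F (\<pi> i) (\<pi> j) \<and> F (\<pi> i) (\<pi> j) \<le> 1" if "i \<in> {1..n}" "j \<in> {1..n}" for i j
    using F(2) range that unfolding avg_lipschitz_def by blast
  show "F (\<pi> j) (\<pi> k) \<le> F (\<pi> i) (\<pi> k)"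
    if "i \<in> {1..n}" "j \<in> {1..n}" "k \<in> {1..n}" "\<pi> k \<le> \<pi> i" "\<pi> i < \<pi> j" for i j k
    using F(1) range that unfolding robinson_def by (meson less_imp_le)
  show "F (\<pi> i) (\<pi> k) \<le> F (\<pi> j) (\<pi> k)"
    if "i \<in> {1..n}" "j \<in> {1..n}" "k \<in> {1..n}" "\<pi> i < \<pi> j" "\<pi> j \<le> \<pi> k" for i j k
    using F(1) range that unfolding robinson_def by (meson less_imp_le)
  have AL: "L2_set (\<lambda>k. F x k - F y k) {1..n} \<le> \<beta> * \<bar>real x - real y\<bar> / sqrt (real n) \<and>
           max (\<Sum>k | k \<in> {1..n} \<and> real k < real x - (1/32) * real n. F x k - F y k)
               (\<Sum>k | k \<in> {1..n} \<and> real k > real y + (1/32) * real n. F y k - F x k)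
             \<ge> \<alpha> * \<bar>real x - real y\<bar>"
    if "x \<in> {1..n}" "y \<in> {1..n}" "x < y" "real y - real x \<le> r * real n" for x y
    using F(2) that unfolding avg_lipschitz_def by blast
  show "real n * (\<Sum>k\<in>{1..n}. (F (\<pi> i) (\<pi> k) - F (\<pi> j) (\<pi> k))\<^sup>2) \<le> (\<beta> * (real (\<pi> j) - real (\<pi> i)))\<^sup>2"
    if ij: "i \<in> {1..n}" "j \<in> {1..n}" "\<pi> i < \<pi> j" "real (\<pi> j) - real (\<pi> i) \<le> r * n" for i j
  proof -
    let ?s = "\<Sum>k\<in>{1..n}. (F (\<pi> i) k - F (\<pi> j) k)\<^sup>2"
    have "sqrt ?s \<le> \<beta> * \<bar>real (\<pi> i) - real (\<pi> j)\<bar> / sqrt (real n)"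
      using AL[OF range[OF ij(1)] range[OF ij(2)] ij(3,4)] unfolding L2_set_def by blast
    then have "sqrt (real n) * sqrt ?s \<le> \<beta> * (real (\<pi> j) - real (\<pi> i))"
      using n ij(3) by (simp add: pos_le_divide_eq mult.commute)
    then have "(sqrt (real n * ?s))\<^sup>2 \<le> (\<beta> * (real (\<pi> j) - real (\<pi> i)))\<^sup>2"
      by (intro power_mono) (auto simp: real_sqrt_mult intro!: mult_nonneg_nonneg sum_nonneg)
    then have "real n * ?s \<le> (\<beta> * (real (\<pi> j) - real (\<pi> i)))\<^sup>2" by (simp add: sum_nonneg)
    then show ?thesis using reindex'[of "\<lambda>k. (F (\<pi> i) k - F (\<pi> j) k)\<^sup>2"] by simp
  qed
  show "\<alpha> * (real (\<pi> j) - real (\<pi> i)) \<le>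
          max (\<Sum>k | k \<in> {1..n} \<and> real (\<pi> k) < real (\<pi> i) - real n / 32. F (\<pi> i) (\<pi> k) - F (\<pi> j) (\<pi> k))
              (\<Sum>k | k \<in> {1..n} \<and> real (\<pi> k) > real (\<pi> j) + real n / 32. F (\<pi> j) (\<pi> k) - F (\<pi> i) (\<pi> k))"
    if ij: "i \<in> {1..n}" "j \<in> {1..n}" "\<pi> i < \<pi> j" "real (\<pi> j) - real (\<pi> i) \<le> r * n" for i j
  proof -
    have "\<alpha> * \<bar>real (\<pi> i) - real (\<pi> j)\<bar> \<le>
      max (\<Sum>k | k \<in> {1..n} \<and> real k < real (\<pi> i) - (1/32) * real n. F (\<pi> i) k - F (\<pi> j) k)
          (\<Sum>k | k \<in> {1..n} \<and> real k > real (\<pi> j) + (1/32) * real n. F (\<pi> j) k - F (\<pi> i) k)"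
      using AL[OF range[OF ij(1)] range[OF ij(2)] ij(3,4)] by blast
    then show ?thesis
      using ij(3) reindex[where R = "\<lambda>x. real x < real (\<pi> i) - real n / 32" and f = "\<lambda>x. F (\<pi> i) x - F (\<pi> j) x"]
        reindex[where R = "\<lambda>x. real x > real (\<pi> j) + real n / 32" and f = "\<lambda>x. F (\<pi> j) x - F (\<pi> i) x"]
      by (simp add: abs_if)
  qed
  show "r'\<^sup>2 * real n \<le> (\<Sum>k\<in>{1..n}. (F (\<pi> i) (\<pi> k) - F (\<pi> j) (\<pi> k))\<^sup>2)"
    if ij: "i \<in> {1..n}" "j \<in> {1..n}" "\<bar>real (\<pi> i) - real (\<pi> j)\<bar> > r * n" for i j
  proof -
    let ?s = "\<Sum>k\<in>{1..n}. (F (\<pi> i) k - F (\<pi> j) k)\<^sup>2"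
    have "L2_set (\<lambda>k. F (\<pi> i) k - F (\<pi> j) k) {1..n} > r' * sqrt (real n)"
      using F(2) range[OF ij(1)] range[OF ij(2)] ij(3) unfolding avg_lipschitz_def by blast
    then have "(r' * sqrt (real n))\<^sup>2 \<le> (sqrt ?s)\<^sup>2"
      using pos unfolding L2_set_def by (intro power_mono) auto
    then have "r'\<^sup>2 * real n \<le> ?s" by (simp add: power_mult_distrib sum_nonneg)
    then show ?thesis using reindex'[of "\<lambda>k. (F (\<pi> i) k - F (\<pi> j) k)\<^sup>2"] by simp
  qed
qed

section \<open>Probability of success\<close>

text \<open>Independence from the partition is available for the matrix restricted to
  \<open>{1..n} \<times> {1..n}\<close>; the event must be seen to depend on this restriction
  alone.\<close>

lemma noise_good_cong:
  assumes P: "P \<in> balanced_partitions n"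
    and AB: "\<And>k l. k \<in> {1..n} \<Longrightarrow> l \<in> {1..n} \<Longrightarrow> A k l = B k l"
  shows "noise_good n tie G \<psi> \<delta> e \<tau> P A \<longleftrightarrow> noise_good n tie G \<psi> \<delta> e \<tau> P B"
proof -
  have inner: "inner_good G e S A \<longleftrightarrow> inner_good G e S B" if "S \<subseteq> {1..n}" for S
  proof -
    have "(\<Sum>m\<in>S. A k m * A l m) = (\<Sum>m\<in>S. B k m * B l m)" if "k \<in> S" "l \<in> S" for k l
      using AB that \<open>S \<subseteq> {1..n}\<close> by (intro sum.cong) (auto simp: subset_iff)
    then show ?thesis unfolding inner_good_def by simp
  qed
  have split: "split_good n tie G \<psi> \<delta> \<tau> T A \<longleftrightarrow> split_good n tie G \<psi> \<delta> \<tau> T B" if T: "T \<subseteq> {1..n}" for T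
  proof -
    have "estimate_distance n tie A T p k = estimate_distance n tie B T p k" for p k
      using AB T by (intro estimate_distance_cong) (auto simp: subset_iff)
    then have "(\<Sum>k | k \<in> T \<and> estimate_distance n tie A T p k \<ge> \<delta> \<and> k \<in> Q. (A i k - G i k) - (A j k - G j k))
        = (\<Sum>k | k \<in> T \<and> estimate_distance n tie B T p k \<ge> \<delta> \<and> k \<in> Q. (B i k - G i k) - (B j k - G j k))"
      if "i \<in> {1..n} - T" "j \<in> {1..n} - T" for p i j Q
      using AB T that by (intro sum.cong) (auto simp: subset_iff)
    then show ?thesis unfolding split_good_def by simp
  qed
  show ?thesis unfolding noise_good_def using inner split parts_subset[OF P] by simp
qed

lemma balanced_partitions_nonempty: "balanced_partitions n \<noteq> {}"
  using card_balanced_partitions_ge[of n] by auto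

text \<open>For each fixed partition the noise event is a function of \<open>A\<close>, hence
  independent of drawing that partition. Summing the products over the good partitions, which form a
  fraction of at least \<open>1 - \<epsilon>\<close>, gives a lower bound for the union of these
  disjoint events. Removing the null set \<open>Z\<close> turns an almost sure property into one
  that holds everywhere on \<open>U\<close>.\<close>

lemma success_probability:
  fixes A :: "'w \<Rightarrow> nat \<Rightarrow> nat \<Rightarrow> real" and tie :: tie_rule and \<delta> :: real
  assumes "noise M n E" and n: "24 \<le> n" and \<sigma>: "0 < \<sigma>"
    and S: "seriation n \<psi> G \<alpha> \<beta> r r'"
    and A: "\<And>\<omega> k l. A \<omega> k l = G k l + \<sigma> * E \<omega> k l"
    and P: "random_partition n M A P"
    and Z: "Z \<in> null_sets M"
  defines "good Q \<equiv> \<forall>T\<in>parts Q. seriation.part_good n \<psi> G \<alpha> r r' T"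
    and "clean Q \<omega> \<equiv> noise_good n tie G \<psi> \<delta> ((8 * \<sigma> + 48 * \<sigma>\<^sup>2) * sqrt n * ln n) (3 * \<sigma> * sqrt (n * ln n)) Q (A \<omega>)"
    and "\<eta> \<equiv> (2 * (real n)\<^sup>2 + real n) * (3 * (real n + 1)\<^sup>2 * exp (- 2 * (min (\<alpha>\<^sup>2 / \<beta>\<^sup>2) (min (r'\<^sup>2) (1 / 2))) * sqrt n / 75))
       + 38 / real n ^ 3"
  shows "\<exists>U\<in>sets M. measure M U \<ge> 1 - \<eta> \<and>
    (\<forall>\<omega>\<in>U. \<omega> \<in> space M \<and> \<omega> \<notin> Z \<and> P \<omega> \<in> balanced_partitions n \<and> good (P \<omega>) \<and> clean (P \<omega>) \<omega>)"
proof -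
  interpret noise M n E by fact
  interpret S: seriation n \<psi> G \<alpha> \<beta> r r' by fact
  let ?Bal = "balanced_partitions n"
  let ?I = "{1..n} \<times> {1..n}"
  define K where "K = {Q \<in> ?Bal. good Q}"
  define X where "X Q = P -` {Q} \<inter> space M" for Q
  define Y where "Y Q = {\<omega> \<in> space M. clean Q \<omega>}" for Q
  define \<epsilon> where "\<epsilon> = (2 * (real n)\<^sup>2 + real n) * (3 * (real n + 1)\<^sup>2 * exp (- 2 * S.spread_const * sqrt n / 75))"
  have \<eta>: "\<eta> = \<epsilon> + 38 / real n ^ 3" unfolding \<eta>_def \<epsilon>_def S.spread_const_def ..
  have fin: "finite ?Bal" "finite K" using finite_balanced_partitions unfolding K_def by auto
  have c0: "0 < card ?Bal" using fin balanced_partitions_nonempty by (simp add: card_gt_0_iff)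
  have Pm: "P \<in> measurable M (count_space UNIV)" and distr: "distr M (count_space UNIV) P = measure_pmf (pmf_of_set ?Bal)"
    and ind: "indep_set
       {(\<lambda>\<omega>. \<lambda>(i, j)\<in>?I. A \<omega> i j) -` B \<inter> space M | B. B \<in> sets (PiM ?I (\<lambda>_. borel))}
       {P -` Q \<inter> space M | Q. Q \<in> sets (count_space UNIV)}"
    using P unfolding random_partition_def by auto
  have Am: "(\<lambda>\<omega>. A \<omega> k l) \<in> borel_measurable M" if "k \<in> {1..n}" "l \<in> {1..n}" for k l
    unfolding A using E_measurable[OF that] by measurable
  have X_sets: "X Q \<in> sets M" for Q unfolding X_def by (rule measurable_sets[OF Pm]) simp
  have Y_sets: "Y Q \<in> sets M" if "Q \<in> ?Bal" for Q
    unfolding Y_def clean_def by (rule noise_good_measurable[OF Am that])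
  have X_prob: "prob (X Q) = 1 / real (card ?Bal)" if "Q \<in> ?Bal" for Q
  proof -
    have "prob (X Q) = measure (distr M (count_space UNIV) P) {Q}"
      unfolding X_def by (rule measure_distr[symmetric, OF Pm]) simp
    also have "\<dots> = pmf (pmf_of_set ?Bal) Q" unfolding distr by (simp add: measure_pmf_single)
    also have "\<dots> = 1 / real (card ?Bal)" using that fin balanced_partitions_nonempty by (simp add: pmf_of_set)
    finally show ?thesis .
  qed
  have Y_prob: "1 - 38 / real n ^ 3 \<le> prob (Y Q)" if Q: "Q \<in> ?Bal" for Q
  proof -
    have "prob (space M - Y Q) = prob {\<omega> \<in> space M. \<not> clean Q \<omega>}"
      unfolding Y_def by (intro arg_cong[where f=prob]) auto
    also have "\<dots> \<le> 38 / real n ^ 3"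
      unfolding clean_def by (rule noise_good_prob[OF n Q \<sigma> S.G01 A])
    finally show ?thesis using prob_compl[OF Y_sets[OF Q]] by simp
  qed
  have XY: "prob (X Q \<inter> Y Q) = prob (X Q) * prob (Y Q)" if Q: "Q \<in> ?Bal" for Q
  proof -
    define B where "B = {x \<in> space (PiM ?I (\<lambda>_. borel :: real measure)).
        noise_good n tie G \<psi> \<delta> ((8 * \<sigma> + 48 * \<sigma>\<^sup>2) * sqrt n * ln n) (3 * \<sigma> * sqrt (n * ln n)) Q (\<lambda>i j. x (i, j))}"
    have "B \<in> sets (PiM ?I (\<lambda>_. borel))"
      unfolding B_def
    proof (rule noise_good_measurable[OF _ Q])
      fix k l assume "k \<in> {1..n}" "l \<in> {1..n}"
      then have "(k, l) \<in> ?I" by simp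
      then show "(\<lambda>x. x (k, l)) \<in> borel_measurable (PiM ?I (\<lambda>_. borel))" by measurable
    qed
    moreover have "Y Q = (\<lambda>\<omega>. \<lambda>(i, j)\<in>?I. A \<omega> i j) -` B \<inter> space M"
    proof -
      have "clean Q \<omega> \<longleftrightarrow> (\<lambda>(i, j)\<in>?I. A \<omega> i j) \<in> B" for \<omega>
      proof -
        have "(\<lambda>(i, j)\<in>?I. A \<omega> i j) \<in> space (PiM ?I (\<lambda>_. borel :: real measure))"
          by (simp add: space_PiM)
        moreover have "clean Q \<omega> \<longleftrightarrow> noise_good n tie G \<psi> \<delta> ((8 * \<sigma> + 48 * \<sigma>\<^sup>2) * sqrt n * ln n)
            (3 * \<sigma> * sqrt (n * ln n)) Q (\<lambda>i j. (\<lambda>(i, j)\<in>?I. A \<omega> i j) (i, j))"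
          unfolding clean_def by (rule noise_good_cong[OF Q]) auto
        ultimately show ?thesis unfolding B_def by simp
      qed
      then show ?thesis unfolding Y_def by auto
    qed
    ultimately have "prob (Y Q \<inter> X Q) = prob (Y Q) * prob (X Q)"
      unfolding X_def by (intro indep_setD[OF ind]) auto
    then show ?thesis by (simp add: Int_commute mult.commute)
  qed
  define U where "U = (\<Union>Q\<in>K. X Q \<inter> Y Q) - Z"
  have XY_sets: "X Q \<inter> Y Q \<in> sets M" if "Q \<in> K" for Q
    using X_sets Y_sets that unfolding K_def by auto
  have U_sets: "U \<in> sets M"
    unfolding U_def using fin XY_sets Z by (intro sets.Diff sets.finite_UN) auto
  have "measure M U = prob (\<Union>Q\<in>K. X Q \<inter> Y Q)"
    unfolding U_def using fin XY_sets Z by (intro measure_Diff_null_set sets.finite_UN) auto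
  also have "\<dots> = (\<Sum>Q\<in>K. prob (X Q \<inter> Y Q))"
    using fin XY_sets by (intro finite_measure_finite_Union) (auto simp: disjoint_family_on_def X_def)
  also have "\<dots> \<ge> (\<Sum>Q\<in>K. 1 / real (card ?Bal) * (1 - 38 / real n ^ 3))"
  proof (rule sum_mono)
    fix Q assume "Q \<in> K"
    then have Q: "Q \<in> ?Bal" unfolding K_def by simp
    show "1 / real (card ?Bal) * (1 - 38 / real n ^ 3) \<le> prob (X Q \<inter> Y Q)"
      unfolding XY[OF Q] X_prob[OF Q] using Y_prob[OF Q] by (intro mult_left_mono) auto
  qed
  also have "(\<Sum>Q\<in>K. 1 / real (card ?Bal) * (1 - 38 / real n ^ 3)) = real (card K) / real (card ?Bal) * (1 - 38 / real n ^ 3)"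
    by simp
  finally have U_prob: "real (card K) / real (card ?Bal) * (1 - 38 / real n ^ 3) \<le> measure M U" .
  have "K \<subseteq> ?Bal" unfolding K_def by auto
  then have cK: "card K \<le> card ?Bal" using fin by (intro card_mono)
  have "real (card ?Bal) - real (card K) = real (card (?Bal - K))"
    using cK \<open>K \<subseteq> ?Bal\<close> fin by (simp add: card_Diff_subset of_nat_diff)
  also have "?Bal - K = {Q \<in> ?Bal. \<not> (\<forall>T\<in>parts Q. S.part_good T)}" unfolding K_def good_def by auto
  also have "real (card \<dots>) \<le> \<epsilon> * real (card ?Bal)"
    unfolding \<epsilon>_def using n by (intro S.part_good_fraction) auto
  finally have "(1 - \<epsilon>) * real (card ?Bal) \<le> real (card K)" by (simp add: algebra_simps)
  then have frac: "1 - \<epsilon> \<le> real (card K) / real (card ?Bal)" using c0 by (simp add: pos_le_divide_eq)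
  have frac1: "real (card K) / real (card ?Bal) \<le> 1" using cK c0 by simp
  have "real (card K) / real (card ?Bal) * (38 / real n ^ 3) \<le> 1 * (38 / real n ^ 3)"
    using frac1 by (intro mult_right_mono) auto
  then have "1 - \<eta> \<le> measure M U" using U_prob frac unfolding \<eta> by (simp add: right_diff_distrib)
  moreover have "\<omega> \<in> space M \<and> \<omega> \<notin> Z \<and> P \<omega> \<in> ?Bal \<and> good (P \<omega>) \<and> clean (P \<omega>) \<omega>" if "\<omega> \<in> U" for \<omega>
    using that unfolding U_def X_def Y_def K_def by auto
  ultimately show ?thesis using U_sets by blast
qed

theorem corollary4p4:
  fixes \<alpha> \<beta> r r' \<sigma> :: real
  assumes "\<alpha> > 0" and "\<beta> > 0" and "r > 0" and "r' > 0" and "\<sigma> > 0"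
  shows "\<exists>C::real. \<forall>n::nat. real n \<ge> C \<longrightarrow>
    (\<forall>(\<pi> :: nat \<Rightarrow> nat) (F :: nat \<Rightarrow> nat \<Rightarrow> real)
      (M :: 'w measure) (E :: 'w \<Rightarrow> nat \<Rightarrow> nat \<Rightarrow> real) (A :: 'w \<Rightarrow> nat \<Rightarrow> nat \<Rightarrow> real)
      (P :: 'w \<Rightarrow> nat set \<times> nat set \<times> nat set) (tie :: tie_rule) (pihat :: 'w \<Rightarrow> nat \<Rightarrow> real)
      (\<delta>1 :: real) (\<delta>2 :: real) (\<delta>3 :: real) (\<delta>4 :: real).
      \<pi> permutes {1..n} \<longrightarrow>
      robinson n F \<longrightarrow>
      F \<in> avg_lipschitz n \<alpha> \<beta> r r' \<longrightarrow>
      prob_space M \<longrightarrow>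
      subgaussian_noise n M E \<longrightarrow>
      (\<forall>\<omega>. A \<omega> = observation \<sigma> \<pi> F (E \<omega>)) \<longrightarrow>
      random_partition n M A P \<longrightarrow>
      valid_tie_rule tie \<longrightarrow>
      \<delta>1 = real n powr (3/4) * ln (real n) \<longrightarrow>
      \<delta>2 = \<delta>1 * ln (real n) \<longrightarrow>
      \<delta>3 = \<delta>2 * ln (real n) \<longrightarrow>
      \<delta>4 = \<delta>3 * ln (real n) \<longrightarrow>
      (AE \<omega> in M. sabre_output n tie (A \<omega>) \<sigma> \<delta>1 \<delta>2 \<delta>3 \<delta>4 (P \<omega>) (pihat \<omega>)) \<longrightarrow>
      (\<exists>G\<in>sets M. measure M G \<ge> 1 - 1 / (real n)\<^sup>2 \<and>
         (\<forall>\<omega>\<in>G. kendall_loss n (pihat \<omega>) \<pi> \<le> 40 * (\<sigma> / \<alpha>) * sqrt (real n * ln (real n)))))"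
proof -
  \<comment> \<open>These repeat the locale constants \<open>lower\<close>, \<open>upper\<close> and
    \<open>spread_const\<close>. They are written out before \<open>n\<close> and \<open>F\<close>
    are fixed, so that the bound on \<open>n\<close> depends on the parameters alone.\<close>
  define a where "a = min \<alpha> r' / 5"
  define b where "b = max \<beta> (1 / r)"
  define g where "g = min (\<alpha>\<^sup>2 / \<beta>\<^sup>2) (min (r'\<^sup>2) (1 / 2))"
  define \<kappa> where "\<kappa> = 8 * \<sigma> + 48 * \<sigma>\<^sup>2"
  \<comment> \<open>Its square collects the coefficients of \<open>12 * e + 4 * (b * sqrt n)\<close>
    once both terms are expressed in \<open>sqrt n * ln n\<close>, so that \<open>\<omega>\<close>
    dominates the error of the distance estimate.\<close>
  define c where "c = sqrt (12 * \<kappa> + 4 * b)"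
  define \<omega> where "\<omega> n = c * (real n powr (3/4) * sqrt (ln n))" for n :: nat
  define \<delta> where "\<delta> k n = real n powr (3/4) * ln n ^ k" for k n :: nat
  define \<eta> where "\<eta> n = (2 * (real n)\<^sup>2 + real n) * (3 * (real n + 1)\<^sup>2 * exp (- 2 * g * sqrt n / 75)) + 38 / real n ^ 3" for n :: nat
  have pos: "0 < a" "0 < b" "0 < g" "0 < \<kappa>" "0 < c"
    using assms by (auto simp: a_def b_def g_def \<kappa>_def c_def less_max_iff_disj add_pos_pos)
  have "\<forall>\<^sub>F n in sequentially. large_enough a b r n (\<omega> n) (\<delta> 1 n) (\<delta> 2 n) (\<delta> 3 n) (\<delta> 4 n) \<and> \<eta> n \<le> 1 / (real n)\<^sup>2"
    using eventually_large_enough[OF pos(1,2) assms(3) pos(5)] eventually_failure_small[OF pos(3)]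
    unfolding \<omega>_def \<delta>_def \<eta>_def by (rule eventually_conj)
  then obtain N where N: "\<And>n. N \<le> n \<Longrightarrow> large_enough a b r n (\<omega> n) (\<delta> 1 n) (\<delta> 2 n) (\<delta> 3 n) (\<delta> 4 n) \<and> \<eta> n \<le> 1 / (real n)\<^sup>2"
    unfolding eventually_sequentially by blast
  show ?thesis
  proof (rule exI[of _ "real N"], intro allI impI)
    fix n :: nat and \<pi> :: "nat \<Rightarrow> nat" and F :: "nat \<Rightarrow> nat \<Rightarrow> real"
      and M :: "'w measure" and E A :: "'w \<Rightarrow> nat \<Rightarrow> nat \<Rightarrow> real"
      and P :: "'w \<Rightarrow> nat set \<times> nat set \<times> nat set" and tie :: tie_rule and pihat :: "'w \<Rightarrow> nat \<Rightarrow> real"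
      and \<delta>1 \<delta>2 \<delta>3 \<delta>4 :: real
    assume nN: "real N \<le> real n" and \<pi>: "\<pi> permutes {1..n}" and F: "robinson n F" "F \<in> avg_lipschitz n \<alpha> \<beta> r r'"
      and M: "prob_space M" and E: "subgaussian_noise n M E" and A: "\<forall>\<omega>. A \<omega> = observation \<sigma> \<pi> F (E \<omega>)"
      and P: "random_partition n M A P" and tie: "valid_tie_rule tie"
      and \<delta>s: "\<delta>1 = real n powr (3/4) * ln (real n)" "\<delta>2 = \<delta>1 * ln (real n)" "\<delta>3 = \<delta>2 * ln (real n)" "\<delta>4 = \<delta>3 * ln (real n)"
      and out: "AE \<omega> in M. sabre_output n tie (A \<omega>) \<sigma> \<delta>1 \<delta>2 \<delta>3 \<delta>4 (P \<omega>) (pihat \<omega>)"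
    define G where "G i j = F (\<pi> i) (\<pi> j)" for i j
    have \<delta>_eq: "\<delta>1 = \<delta> 1 n" "\<delta>2 = \<delta> 2 n" "\<delta>3 = \<delta> 3 n" "\<delta>4 = \<delta> 4 n"
      unfolding \<delta>s \<delta>_def by (simp_all add: eval_nat_numeral)
    have large: "large_enough a b r n (\<omega> n) \<delta>1 \<delta>2 \<delta>3 \<delta>4" and \<eta>: "\<eta> n \<le> 1 / (real n)\<^sup>2"
      using N[of n] nN unfolding \<delta>_eq by simp_all
    have n: "24 \<le> n" using large unfolding large_enough_def by simp
    have S: "seriation n \<pi> G \<alpha> \<beta> r r'"
      using seriation_of_avg_lipschitz[OF assms(1-4) _ \<pi> F] n unfolding G_def[abs_def] by simp
    interpret S: seriation n \<pi> G \<alpha> \<beta> r r' by (rule S)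
    have ab: "a = S.lower" "b = S.upper" unfolding a_def b_def S.lower_def S.upper_def by simp_all
    have noise: "noise M n E" using M E unfolding noise_def noise_axioms_def by simp
    have A': "A \<omega> k l = G k l + \<sigma> * E \<omega> k l" for \<omega> k l
      using A by (simp add: observation_def G_def)
    define e where "e = \<kappa> * sqrt n * ln n"
    have \<omega>0: "0 \<le> \<omega> n" unfolding \<omega>_def using pos n by simp
    have \<omega>: "sqrt (real n * (12 * e + 4 * (S.upper * sqrt n))) \<le> \<omega> n"
    proof -
      have "exp 1 < real n" using n exp_le order_le_less_trans[of "exp 1" 3 "real n"] by simp
      then have L: "1 \<le> ln (real n)" using n ln_less_cancel_iff[of "exp 1" "real n"] by simp
      have "b * sqrt n * 1 \<le> b * sqrt n * ln n" using L pos by (intro mult_left_mono) auto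
      then have "12 * e + 4 * (b * sqrt n) \<le> c\<^sup>2 * (sqrt n * ln n)"
        using pos unfolding e_def c_def by (simp add: algebra_simps)
      then have "real n * (12 * e + 4 * (b * sqrt n)) \<le> real n * (c\<^sup>2 * (sqrt n * ln n))"
        by (intro mult_left_mono) auto
      also have "\<dots> = (\<omega> n)\<^sup>2"
      proof -
        have "(real n powr (3/4))\<^sup>2 = real n powr (3/2)" using n by (simp add: powr_power)
        also have "\<dots> = real n powr (1 + 1/2)" by simp
        also have "\<dots> = real n * sqrt n" using n by (subst powr_add) (simp add: powr_half_sqrt)
        finally show ?thesis unfolding \<omega>_def using L by (simp add: power_mult_distrib)
      qed
      finally show ?thesis using \<omega>0 unfolding ab by (intro real_le_lsqrt)
    qed
    \<comment> \<open>The failure set of the almost sure hypothesis need not be measurable; a null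
      set covering it is removed from the good event.\<close>
    obtain Z where Z: "{\<omega> \<in> space M. \<not> sabre_output n tie (A \<omega>) \<sigma> \<delta>1 \<delta>2 \<delta>3 \<delta>4 (P \<omega>) (pihat \<omega>)} \<subseteq> Z" "Z \<in> null_sets M"
      using out unfolding eventually_ae_filter by blast
    obtain U where U: "U \<in> sets M" "1 - \<eta> n \<le> measure M U"
      and good: "\<And>\<omega>. \<omega> \<in> U \<Longrightarrow> \<omega> \<in> space M \<and> \<omega> \<notin> Z \<and> P \<omega> \<in> balanced_partitions n \<and>
          (\<forall>T\<in>parts (P \<omega>). S.part_good T) \<and>
          noise_good n tie G \<pi> \<delta>4 e (3 * \<sigma> * sqrt (real n * ln n)) (P \<omega>) (A \<omega>)"
      using success_probability[OF noise n assms(5) S A' P Z(2), of tie \<delta>4]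
      unfolding \<eta>_def g_def e_def \<kappa>_def by blast
    have "kendall_loss n (pihat \<omega>) \<pi> \<le> 40 * (\<sigma> / \<alpha>) * sqrt (real n * ln (real n))" if "\<omega> \<in> U" for \<omega>
    proof (rule S.sabre_loss[OF large[unfolded ab] \<omega> \<omega>0 assms(5) tie])
      show "P \<omega> \<in> balanced_partitions n" "noise_good n tie G \<pi> \<delta>4 e (3 * \<sigma> * sqrt (real n * ln n)) (P \<omega>) (A \<omega>)"
        using good[OF that] by auto
      show "S.part_good T" if "T \<in> parts (P \<omega>)" for T using good[OF \<open>\<omega> \<in> U\<close>] that by blast
      show "sabre_output n tie (A \<omega>) \<sigma> \<delta>1 \<delta>2 \<delta>3 \<delta>4 (P \<omega>) (pihat \<omega>)" using good[OF that] Z(1) by blast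
    qed
    moreover have "1 - 1 / (real n)\<^sup>2 \<le> measure M U" using U(2) \<eta> by linarith
    ultimately show "\<exists>G\<in>sets M. measure M G \<ge> 1 - 1 / (real n)\<^sup>2 \<and>
         (\<forall>\<omega>\<in>G. kendall_loss n (pihat \<omega>) \<pi> \<le> 40 * (\<sigma> / \<alpha>) * sqrt (real n * ln (real n)))"
      using U(1) by blast
  qed
qed

end
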